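(* Let $\mu$ be an absolutely continuous invariant measure of $(\mathsf P^t)_{t\ge0}$ with invariant densities $(\rho_i)_{i\in S}$. Assume that $u_1(0)=0$, that $u_i(0)\ne0$ for all $i\in S\setminus\{1\}$, that there is a constant $a\neq 0$ with $u_1(\eta)=-a\eta+O(\eta^2)$ as $\eta\downarrow0$, and that all vector fields $u_i$, $i\in S$, are analytic in an open interval around $0$. Let $\bar\rho(\eta)=\sum_{i>1}\lambda_{i,1}\rho_i(\eta)$. Then the following hold, where cases B and C (the position of $0$ relative to the support of $(\mu_i)_{i\in S}$) are as defined in the context. (1) Let $\lambda_1<a$. In cases B and C, there is a constant $c>0$ such that $\rho_1(\eta)=c\,\eta^{\frac{\lambda_1}{a}-1}+o(\eta^{\frac{\lambda_1}{a}-1})$ as $\eta\downarrow 0$. (2) Let $\lambda_1>a>0$. In case B, $\lim_{\eta\downarrow0}\rho_1(\eta)=\frac{\bar\rho(0)}{\lambda_1-a}>0$. In case C, there is a constant $c>0$ such that $\rho_1(\eta)=c\,\eta^{\frac{\lambda_1}{a}-1}+o(\eta^{\frac{\lambda_1}{a}-1})$ as $\eta\downarrow0$. (3) Let $\lambda_1=a$. In case B, there is a constant $c>0$ such that $\rho_1(\eta)=-c\ln(\eta)+o(\ln(\eta))$ as $\eta\downarrow0$. In case C, $\rho_1(\eta)$ converges to a positive constant as $\eta\downarrow0$.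
   Context: Setting. Let $S=\{1,\dots,N\}$ with $N\ge 2$, and let $D=\{u_i: i\in S\}$ be a finite collection of continuously differentiable vector fields on $\mathbb R$ that are forward-complete (for every $\xi\in\mathbb R$ the problem $\dot x=u_i(x)$, $x(0)=\xi$ has a unique solution $\Phi_i^t(\xi)$ for all $t\ge 0$). For $i\ne j$ in $S$ let $\lambda_{i,j}>0$ be the (constant) rate of switching from $i$ to $j$, and put $\lambda_i=\sum_{j\neq i}\lambda_{i,j}$. The switching process $(X,A)=(X_t,A_t)_{t\ge0}$ is the Markov process on $\mathbb R\times S$ in which $A$ is the continuous-time Markov chain on $S$ with jump rates $\lambda_{i,j}$, and $X$ is continuous and follows $\dot X_t=u_{A_t}(X_t)$ between the jumps of $A$. Its Markov semigroup is $(\mathsf P^t)_{t\ge0}$ with transition probabilities $\mathsf P^t_{\xi,i}$. A probability measure $\mu$ on $\mathbb R\times S$ is invariant if $\mu(E\times\{i\})=\sum_{j\in S}\int_{\mathbb R}\mathsf P^t_{\xi,j}(E\times\{i\})\,\mu(d\xi\times\{j\})$ for all Borel $E\subset\mathbb R$, $i\in S$, $t\ge0$. Put $\mu_i=\mu(\cdot\times\{i\})$. If $\mu$ is absolutely continuous (with respect to Lebesgue measure times counting measure), $\rho_i\in L^1(\mathbb R)$ denotes the Lebesgue density of $\mu_i$ (invariant density). A regularity property of $\rho_i$ means that the class $\rho_i$ has a representative with that property. A point is a critical point of $u_i$ if $u_i$ vanishes there. Standing assumption: the set of critical points of the vector fields in $D$ has no accumulation points. Representatives: on any open interval containing no critical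 point of $u_i$, the density $\rho_i$ has a continuous representative; these are used for $\rho_1$ on a right neighbourhood $(0,\delta)$ of $0$ and for $\rho_i$, $i>1$, on a neighbourhood of $0$, so that $\bar\rho(0)$ is well defined. Cases. A nonempty set $J\subset\mathbb R$ is invariant if every finite composition of flow maps $\Phi_{i_m}^{t_m}\circ\dots\circ\Phi_{i_1}^{t_1}$ with $i_k\in S$, $t_k\ge0$ maps $J$ into $J$; it is minimal invariant if no nonempty strict subset of it is invariant. For absolutely continuous invariant $\mu$, all measures $\mu_i$, $i\in S$, have the same support, called the support of $(\mu_i)_{i\in S}$; it is the union of a collection $\mathscr I$ of closed intervals of positive length, namely the closures of the minimal invariant sets $J$ with $\mu(J\times S)>0$. Exactly one of the following holds: (A) $0$ is the left endpoint of an open interval that contains no points of the support of $(\mu_i)_{i\in S}$; (B) $0$ is contained in the interior of an interval $I\in\mathscr I$; (C) $0$ is the left endpoint of an interval $I\in\mathscr I$. (Since $0$ is critical only for $u_1$, in case C the point $0$ is also the right endpoint of an open interval containing no points of the support.) *)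

theory Defs
  imports "HOL-Probability.Probability" "HOL-Library.Landau_Symbols"
begin

subsection \<open>Vector fields on the real line and their semiflows\<close>

definition solves_ivp :: "(real \<Rightarrow> real) \<Rightarrow> real \<Rightarrow> (real \<Rightarrow> real) \<Rightarrow> bool" where
  "solves_ivp v \<xi> x \<longleftrightarrow>
     x 0 = \<xi> \<and> (\<forall>t\<ge>0. (x has_real_derivative v (x t)) (at t within {0..}))"

definition forward_complete :: "(real \<Rightarrow> real) \<Rightarrow> bool" where
  "forward_complete v \<longleftrightarrow>
     (\<forall>\<xi>. \<exists>x. solves_ivp v \<xi> x \<and> (\<forall>y. solves_ivp v \<xi> y \<longrightarrow> (\<forall>t\<ge>0. y t = x t)))"

text \<open>Only meaningful for \<open>t \<ge> 0\<close> and forward-complete \<open>v\<close>.\<close>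

definition flow :: "(real \<Rightarrow> real) \<Rightarrow> real \<Rightarrow> real \<Rightarrow> real" where
  "flow v t \<xi> = (THE z. \<exists>x. solves_ivp v \<xi> x \<and> z = x t)"

definition real_analytic_on :: "(real \<Rightarrow> real) \<Rightarrow> real set \<Rightarrow> bool" where
  "real_analytic_on f S \<longleftrightarrow>
     (\<forall>x\<in>S. \<exists>r>0. \<exists>c :: nat \<Rightarrow> real. \<forall>y\<in>ball x r. (\<lambda>n. c n * (y - x) ^ n) sums f y)"

subsection \<open>The switching process\<close>

definition total_rate :: "nat \<Rightarrow> (nat \<Rightarrow> nat \<Rightarrow> real) \<Rightarrow> nat \<Rightarrow> real" where
  "total_rate N lam i = (\<Sum>j\<in>{1..N} - {i}. lam i j)"

text \<open>
  The continuous-time chain is built from its holding times and its embedded jump chain.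
  During each visit to state \<open>i\<close> the holding time is exponential with rate \<open>total_rate N lam i\<close>
  and, independently, the next state is \<open>j \<noteq> i\<close> with probability
  \<open>lam i j / total_rate N lam i\<close>.
  The driving noise \<open>\<omega>\<close> is a family of independent pairs, where \<open>\<omega> n i\<close> is the pair
  (holding time, next state) that is used if the \<open>n\<close>-th visited state is \<open>i\<close>.
\<close>

definition stay_law :: "nat \<Rightarrow> (nat \<Rightarrow> nat \<Rightarrow> real) \<Rightarrow> nat \<Rightarrow> (real \<times> nat) measure" where
  "stay_law N lam i =
     density lborel (\<lambda>s. ennreal (exponential_density (total_rate N lam i) s)) \<Otimes>\<^sub>M
     point_measure {1..N} (\<lambda>j. ennreal (if j = i then 0 else lam i j / total_rate N lam i))"

definition noise :: "nat \<Rightarrow> (nat \<Rightarrow> nat \<Rightarrow> real) \<Rightarrow> (nat \<Rightarrow> nat \<Rightarrow> real \<times> nat) measure" where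
  "noise N lam = PiM UNIV (\<lambda>n. PiM {1..N} (stay_law N lam))"

primrec visited :: "(nat \<Rightarrow> nat \<Rightarrow> real \<times> nat) \<Rightarrow> nat \<Rightarrow> nat \<Rightarrow> nat" where
  "visited \<omega> i 0 = i"
| "visited \<omega> i (Suc n) = snd (\<omega> n (visited \<omega> i n))"

definition holding_time :: "(nat \<Rightarrow> nat \<Rightarrow> real \<times> nat) \<Rightarrow> nat \<Rightarrow> nat \<Rightarrow> real" where
  "holding_time \<omega> i n = fst (\<omega> n (visited \<omega> i n))"

definition jump_time :: "(nat \<Rightarrow> nat \<Rightarrow> real \<times> nat) \<Rightarrow> nat \<Rightarrow> nat \<Rightarrow> real" where
  "jump_time \<omega> i n = (\<Sum>k<n. holding_time \<omega> i k)"

text \<open>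
  Almost surely the holding times are positive and the jump times tend to infinity,
  so that this is the number of jumps up to and including time \<open>t\<close>.
\<close>

definition num_jumps :: "(nat \<Rightarrow> nat \<Rightarrow> real \<times> nat) \<Rightarrow> nat \<Rightarrow> real \<Rightarrow> nat" where
  "num_jumps \<omega> i t = (LEAST n. t < jump_time \<omega> i (Suc n))"

primrec position_at_jump ::
    "(nat \<Rightarrow> real \<Rightarrow> real) \<Rightarrow> (nat \<Rightarrow> nat \<Rightarrow> real \<times> nat) \<Rightarrow> real \<Rightarrow> nat \<Rightarrow> nat \<Rightarrow> real" where
  "position_at_jump u \<omega> \<xi> i 0 = \<xi>"
| "position_at_jump u \<omega> \<xi> i (Suc n) =
     flow (u (visited \<omega> i n)) (holding_time \<omega> i n) (position_at_jump u \<omega> \<xi> i n)"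

definition state_process :: "(nat \<Rightarrow> nat \<Rightarrow> real \<times> nat) \<Rightarrow> nat \<Rightarrow> real \<Rightarrow> nat" where
  "state_process \<omega> i t = visited \<omega> i (num_jumps \<omega> i t)"

definition position_process ::
    "(nat \<Rightarrow> real \<Rightarrow> real) \<Rightarrow> (nat \<Rightarrow> nat \<Rightarrow> real \<times> nat) \<Rightarrow> real \<Rightarrow> nat \<Rightarrow> real \<Rightarrow> real" where
  "position_process u \<omega> \<xi> i t =
     flow (u (state_process \<omega> i t)) (t - jump_time \<omega> i (num_jumps \<omega> i t))
       (position_at_jump u \<omega> \<xi> i (num_jumps \<omega> i t))"

definition transition ::
    "nat \<Rightarrow> (nat \<Rightarrow> real \<Rightarrow> real) \<Rightarrow> (nat \<Rightarrow> nat \<Rightarrow> real) \<Rightarrow> real \<Rightarrow> real \<Rightarrow> nat \<Rightarrow> (real \<times> nat) measure"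
  where
  "transition N u lam t \<xi> i =
     distr (noise N lam) (borel \<Otimes>\<^sub>M count_space {1..N})
       (\<lambda>\<omega>. (position_process u \<omega> \<xi> i t, state_process \<omega> i t))"

subsection \<open>Invariant measures and densities\<close>

text \<open>The measure \<open>E \<mapsto> \<mu> (E \<times> {i})\<close> on the Borel sets of the line.\<close>

definition slice :: "(real \<times> nat) measure \<Rightarrow> nat \<Rightarrow> real measure" where
  "slice \<mu> i = distr (restrict_space \<mu> (UNIV \<times> {i})) borel fst"

definition invariant_measure ::
    "nat \<Rightarrow> (nat \<Rightarrow> real \<Rightarrow> real) \<Rightarrow> (nat \<Rightarrow> nat \<Rightarrow> real) \<Rightarrow> (real \<times> nat) measure \<Rightarrow> bool" where
  "invariant_measure N u lam \<mu> \<longleftrightarrow>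
     prob_space \<mu> \<and> sets \<mu> = sets (borel \<Otimes>\<^sub>M count_space {1..N}) \<and>
     (\<forall>E\<in>sets borel. \<forall>i\<in>{1..N}. \<forall>t\<ge>0.
        emeasure \<mu> (E \<times> {i}) =
          (\<Sum>j\<in>{1..N}. \<integral>\<^sup>+ \<xi>. emeasure (transition N u lam t \<xi> j) (E \<times> {i}) \<partial>(slice \<mu> j)))"

definition density_representatives ::
    "nat \<Rightarrow> (real \<times> nat) measure \<Rightarrow> (nat \<Rightarrow> real \<Rightarrow> real) \<Rightarrow> bool" where
  "density_representatives N \<mu> \<rho> \<longleftrightarrow>
     (\<forall>i\<in>{1..N}. \<rho> i \<in> borel_measurable lborel \<and> (AE x in lborel. 0 \<le> \<rho> i x) \<and>
        slice \<mu> i = density lborel (\<lambda>x. ennreal (\<rho> i x)))"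

definition rho_bar ::
    "nat \<Rightarrow> (nat \<Rightarrow> nat \<Rightarrow> real) \<Rightarrow> (nat \<Rightarrow> real \<Rightarrow> real) \<Rightarrow> real \<Rightarrow> real" where
  "rho_bar N lam \<rho> \<eta> = (\<Sum>i\<in>{2..N}. lam i 1 * \<rho> i \<eta>)"

subsection \<open>Minimal invariant sets\<close>

text \<open>The head of the list is the vector field that is followed first.\<close>

definition composed_flow :: "(nat \<Rightarrow> real \<Rightarrow> real) \<Rightarrow> (nat \<times> real) list \<Rightarrow> real \<Rightarrow> real" where
  "composed_flow u its x = fold (\<lambda>(i, t) y. flow (u i) t y) its x"

definition invariant_set :: "nat \<Rightarrow> (nat \<Rightarrow> real \<Rightarrow> real) \<Rightarrow> real set \<Rightarrow> bool" where
  "invariant_set N u J \<longleftrightarrow> J \<noteq> {} \<and>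
     (\<forall>its. (\<forall>(i, t)\<in>set its. i \<in> {1..N} \<and> 0 \<le> t) \<longrightarrow> composed_flow u its ` J \<subseteq> J)"

definition minimal_invariant_set :: "nat \<Rightarrow> (nat \<Rightarrow> real \<Rightarrow> real) \<Rightarrow> real set \<Rightarrow> bool" where
  "minimal_invariant_set N u J \<longleftrightarrow>
     invariant_set N u J \<and> \<not> (\<exists>K. K \<subset> J \<and> invariant_set N u K)"

text \<open>The closed intervals whose union is the common support of the measures \<open>slice \<mu> i\<close>.\<close>

definition support_intervals ::
    "nat \<Rightarrow> (nat \<Rightarrow> real \<Rightarrow> real) \<Rightarrow> (real \<times> nat) measure \<Rightarrow> real set set" where
  "support_intervals N u \<mu> =
     {closure J | J. minimal_invariant_set N u J \<and> emeasure \<mu> (J \<times> {1..N}) > 0}"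

definition case_B :: "nat \<Rightarrow> (nat \<Rightarrow> real \<Rightarrow> real) \<Rightarrow> (real \<times> nat) measure \<Rightarrow> bool" where
  "case_B N u \<mu> \<longleftrightarrow> (\<exists>I\<in>support_intervals N u \<mu>. 0 \<in> interior I)"

definition case_C :: "nat \<Rightarrow> (nat \<Rightarrow> real \<Rightarrow> real) \<Rightarrow> (real \<times> nat) measure \<Rightarrow> bool" where
  "case_C N u \<mu> \<longleftrightarrow> (\<exists>I\<in>support_intervals N u \<mu>. 0 \<in> I \<and> (\<forall>x\<in>I. 0 \<le> x))"

end

theory Submission
  imports Defs
begin

text \<open>
  All regimes have \<open>a > 0\<close>, so that the first field pushes mass towards \<open>0\<close> from the right. Let
  \<open>f = - u\<^sub>1 \<rho>\<^sub>1 \<ge> 0\<close> be the flux that it carries there. Stationarity gives the forward equation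
  \<open>f' = (\<lambda>\<^sub>1 / (- u\<^sub>1)) f - \<rho>bar\<close> to the right of \<open>0\<close>, which is singular at \<open>0\<close> because
  \<open>- u\<^sub>1(\<eta>)\<close> behaves like \<open>a \<eta>\<close>. An integrating factor \<open>H\<close> turns it into \<open>(H f)' = - H \<rho>bar\<close>, and
  since \<open>u\<^sub>1(\<eta>) + a \<eta> = O(\<eta>\<^sup>2)\<close>, the product of \<open>H(\<eta>)\<close> and \<open>\<eta> powr (\<lambda>\<^sub>1 / a)\<close> has a positive limit.
  Hence \<open>H f\<close> increases towards \<open>0\<close>, and everything depends on how fast it grows there.

  \<^item> If \<open>H f\<close> stays bounded, then it has a positive limit, which is the power law for \<open>\<rho>\<^sub>1\<close>
    (\<open>power_law_of_bounded\<close>). For \<open>\<lambda>\<^sub>1 < a\<close> it stays bounded because \<open>H\<close> is integrable at \<open>0\<close>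
    and \<open>\<rho>bar\<close> is bounded.
    In case C it stays bounded for every \<open>\<lambda>\<^sub>1\<close>: the total flux \<open>\<Sum>\<^sub>i u\<^sub>i \<rho>\<^sub>i\<close> vanishes and the other
    fields point into the support interval, so \<open>f = \<Sum>\<^sub>i\<^sub>>\<^sub>1 u\<^sub>i \<rho>\<^sub>i\<close> dominates \<open>\<rho>bar\<close> up to a constant
    (\<open>case_C_source_bound\<close>) and the logarithmic derivative of \<open>H f\<close> is bounded.
  \<^item> In case B the source \<open>\<rho>bar(0)\<close> is positive. For \<open>\<lambda>\<^sub>1 \<ge> a\<close> the integral of \<open>H \<rho>bar\<close> diverges at
    \<open>0\<close>, and l'Hopital's rule compares \<open>H f\<close> with the power or the logarithm that diverges at the
    same rate (\<open>limit_supercritical\<close>, \<open>log_law_critical\<close>).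

  The forward equation comes from lower bounds on the transition probabilities alone: the events of
  no jump and of exactly one jump before a short time \<open>t\<close> give, for a nonnegative test function \<open>f\<close>,
  one inequality per state (\<open>generator_inequality\<close>). For the test function \<open>1\<close> these inequalities sum
  to the equality \<open>0 = 0\<close>, so each of them is an equality. Applied to \<open>B + f\<close> and \<open>B - f\<close> with a bound
  \<open>B\<close> of \<open>\<bar>f\<bar>\<close>, they give \<open>stationary_equation\<close>. A test function only needs a derivative with compact
  support, so smoothed steps are allowed. They yield \<open>flux_eq_mass_above\<close>, which expresses
  \<open>u\<^sub>i \<rho>\<^sub>i\<close> at a point by the masses to the right of that point; summing over \<open>i\<close> shows that
  the total flux is zero.

  Cases B and C enter through the set of points that every \<open>\<mu>\<^sub>i\<close> charges. This set is closed and
  invariant under all flows, and minimality puts each support interval inside it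
  (\<open>support_interval_charged\<close>). In case B, a zero of some \<open>\<rho>\<^sub>i\<close> with \<open>i > 1\<close> at \<open>0\<close> would leave an
  uncharged interval upstream of \<open>0\<close> (\<open>uncharged_upstream\<close>). In case C, invariance of the support
  interval forces \<open>u\<^sub>i(0) > 0\<close> for \<open>i > 1\<close>.
\<close>

section \<open>Flows of forward-complete fields\<close>

lemma solves_ivp_continuous_on:
  assumes "solves_ivp v \<xi> x"
  shows "continuous_on {0..} x"
  using assms unfolding solves_ivp_def continuous_on_eq_continuous_within
  by (auto intro: DERIV_continuous)

lemma solves_ivp_deriv:
  assumes "solves_ivp v \<xi> x" "0 < t"
  shows "(x has_real_derivative v (x t)) (at t)"
proof -
  have "at t within {0..} = at t"
    using assms(2) by (intro at_within_interior) (auto simp: interior_real_atLeast)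
  then show ?thesis using assms unfolding solves_ivp_def by (metis less_imp_le)
qed

lemma solves_ivp_shift:
  assumes "solves_ivp v \<xi> x" "0 \<le> s"
  shows "solves_ivp v (x s) (\<lambda>r. x (s + r))"
  unfolding solves_ivp_def
proof (intro conjI allI impI)
  fix t :: real assume t: "0 \<le> t"
  have "(x has_real_derivative v (x (s + t))) (at (s + t) within {0..})"
    using assms t unfolding solves_ivp_def by simp
  then have "(x has_real_derivative v (x (s + t))) (at (s + t) within (\<lambda>r. s + r) ` {0..})"
    by (rule has_field_derivative_subset) (use assms in auto)
  moreover have "((\<lambda>r. s + r) has_real_derivative 1) (at t within {0..})"
    by (auto intro!: derivative_eq_intros)
  ultimately have "(x \<circ> (\<lambda>r. s + r) has_real_derivative v (x (s + t)) * 1) (at t within {0..})"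
    by (rule DERIV_image_chain)
  then show "((\<lambda>r. x (s + r)) has_real_derivative v (x (s + t))) (at t within {0..})"
    by (simp add: o_def)
qed simp

lemma flow_eqI:
  assumes "forward_complete v" "solves_ivp v \<xi> x" "0 \<le> t"
  shows "flow v t \<xi> = x t"
  unfolding flow_def
proof (rule the_equality)
  show "\<exists>y. solves_ivp v \<xi> y \<and> x t = y t" using assms by blast
  fix z assume "\<exists>y. solves_ivp v \<xi> y \<and> z = y t"
  then show "z = x t" using assms unfolding forward_complete_def by metis
qed

lemma solves_ivp_flow:
  assumes "forward_complete v"
  shows "solves_ivp v \<xi> (\<lambda>t. flow v t \<xi>)"
proof -
  obtain x where x: "solves_ivp v \<xi> x"
    using assms unfolding forward_complete_def by metis
  have eq: "flow v t \<xi> = x t" if "0 \<le> t" for t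
    using flow_eqI[OF assms x that] .
  show ?thesis unfolding solves_ivp_def
  proof (intro conjI allI impI)
    show "flow v 0 \<xi> = \<xi>" using eq x by (simp add: solves_ivp_def)
    fix t :: real assume t: "0 \<le> t"
    have "(x has_real_derivative v (x t)) (at t within {0..})"
      using x t by (simp add: solves_ivp_def)
    then have "((\<lambda>t. flow v t \<xi>) has_real_derivative v (x t)) (at t within {0..})"
      by (rule has_field_derivative_transform_within[where d = 1]) (use t eq in auto)
    then show "((\<lambda>t. flow v t \<xi>) has_real_derivative v (flow v t \<xi>)) (at t within {0..})"
      using eq t by simp
  qed
qed

lemma flow_0 [simp]: "forward_complete v \<Longrightarrow> flow v 0 \<xi> = \<xi>"
  using solves_ivp_flow[of v \<xi>] by (simp add: solves_ivp_def)

lemma flow_deriv: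
  "forward_complete v \<Longrightarrow> 0 < t \<Longrightarrow> ((\<lambda>t. flow v t \<xi>) has_real_derivative v (flow v t \<xi>)) (at t)"
  using solves_ivp_deriv[OF solves_ivp_flow] .

lemma flow_continuous_on: "forward_complete v \<Longrightarrow> continuous_on {0..} (\<lambda>t. flow v t \<xi>)"
  using solves_ivp_continuous_on[OF solves_ivp_flow] .

text \<open>
  At negative times the defining description of the flow holds for every real number, because
  \<open>solves_ivp\<close> does not constrain solutions there. The flow is then one fixed default value, and
  it remains measurable on all of \<open>\<real> \<times> \<real>\<close>.
\<close>

lemma flow_neg:
  assumes "forward_complete v" "t < 0"
  shows "flow v t \<xi> = (THE z. True)"
proof -
  obtain x where x: "solves_ivp v \<xi> x"
    using assms unfolding forward_complete_def by metis
  have "\<exists>x. solves_ivp v \<xi> x \<and> z = x t" for z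
  proof (intro exI conjI)
    show "solves_ivp v \<xi> (x(t := z))" unfolding solves_ivp_def
    proof (intro conjI allI impI)
      show "(x(t := z)) 0 = \<xi>" using x assms by (simp add: solves_ivp_def)
      fix s :: real assume s: "0 \<le> s"
      have "(x has_real_derivative v (x s)) (at s within {0..})"
        using x s by (simp add: solves_ivp_def)
      then have "(x(t := z) has_real_derivative v (x s)) (at s within {0..})"
        by (rule has_field_derivative_transform_within[where d = 1]) (use s assms in auto)
      then show "(x(t := z) has_real_derivative v ((x(t := z)) s)) (at s within {0..})"
        using s assms by simp
    qed
  qed simp
  then show ?thesis unfolding flow_def by simp
qed

text \<open>
  Two solutions that exchange their order must meet by the intermediate value theorem, and from
  then on they agree by forward uniqueness.
\<close>

lemma flow_mono:
  assumes fc: "forward_complete v" and "0 \<le> t" "\<xi> \<le> \<eta>"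
  shows "flow v t \<xi> \<le> flow v t \<eta>"
proof (rule ccontr)
  assume neg: "\<not> flow v t \<xi> \<le> flow v t \<eta>"
  define d where "d s = flow v s \<xi> - flow v s \<eta>" for s
  have "continuous_on {0..t} d" unfolding d_def
    by (intro continuous_intros; rule continuous_on_subset[OF flow_continuous_on[OF fc]]) auto
  moreover have "d 0 \<le> 0" "0 \<le> d t" using neg assms by (auto simp: d_def)
  ultimately obtain s where s: "0 \<le> s" "s \<le> t" "d s = 0"
    using IVT'[of d 0 0 t] assms by auto
  have "flow v (s + (t - s)) \<xi> = flow v (t - s) (flow v s \<xi>)"
    using flow_eqI[OF fc solves_ivp_shift[OF solves_ivp_flow[OF fc] s(1)], of "t - s"] s by simp
  moreover have "flow v (s + (t - s)) \<eta> = flow v (t - s) (flow v s \<eta>)"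
    using flow_eqI[OF fc solves_ivp_shift[OF solves_ivp_flow[OF fc] s(1)], of "t - s"] s by simp
  ultimately show False using s neg by (simp add: d_def)
qed

lemma C1_lipschitz_interval:
  fixes v :: "real \<Rightarrow> real"
  assumes "v C1_differentiable_on UNIV"
  obtains L where "0 \<le> L" "\<And>p q. p \<in> {-R..R} \<Longrightarrow> q \<in> {-R..R} \<Longrightarrow> \<bar>v p - v q\<bar> \<le> L * \<bar>p - q\<bar>"
proof -
  obtain D where D: "\<And>x. (v has_vector_derivative D x) (at x)" "continuous_on UNIV D"
    using assms unfolding C1_differentiable_on_def by auto
  have "compact (D ` {-R..R})"
    by (intro compact_continuous_image continuous_on_subset[OF D(2)]) auto
  then obtain L where L: "\<And>x. x \<in> {-R..R} \<Longrightarrow> \<bar>D x\<bar> \<le> L" "L > 0"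
    using compact_imp_bounded[THEN bounded_pos[THEN iffD1]] by (metis imageI real_norm_def)
  have "\<bar>v p - v q\<bar> \<le> L * \<bar>p - q\<bar>" if "p \<in> {-R..R}" "q \<in> {-R..R}" for p q
    using field_differentiable_bound[of "{-R..R}" v D L p q] that D(1) L(1)
    by (auto simp: has_real_derivative_iff_has_vector_derivative has_vector_derivative_at_within)
  then show thesis using that L(2) by (meson less_imp_le)
qed

text \<open>
  Monotonicity traps all solutions that start within distance 1 of \<open>\<xi>0\<close> between two fixed ones,
  hence in one compact interval. There the field is Lipschitz, and the squared distance of two
  solutions, damped by \<open>exp (- 2 * L * s)\<close>, decreases.
\<close>

lemma flow_lipschitz:
  assumes fc: "forward_complete v" and C1: "v C1_differentiable_on UNIV" and t: "0 \<le> t"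
  obtains C where "\<And>\<xi>. \<bar>\<xi> - \<xi>0\<bar> \<le> 1 \<Longrightarrow> \<bar>flow v t \<xi> - flow v t \<xi>0\<bar> \<le> C * \<bar>\<xi> - \<xi>0\<bar>"
proof -
  define K where "K = (\<lambda>s. flow v s (\<xi>0 - 1)) ` {0..t} \<union> (\<lambda>s. flow v s (\<xi>0 + 1)) ` {0..t}"
  have "compact K" unfolding K_def
    by (intro compact_Un compact_continuous_image continuous_on_subset[OF flow_continuous_on[OF fc]]) auto
  then obtain R where R: "\<And>x. x \<in> K \<Longrightarrow> \<bar>x\<bar> \<le> R"
    using compact_imp_bounded[THEN bounded_pos[THEN iffD1]] by (metis real_norm_def)
  obtain L where L: "0 \<le> L" "\<And>p q. p \<in> {-R..R} \<Longrightarrow> q \<in> {-R..R} \<Longrightarrow> \<bar>v p - v q\<bar> \<le> L * \<bar>p - q\<bar>"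
    using C1_lipschitz_interval[OF C1] by metis
  have in_R: "flow v s \<xi> \<in> {-R..R}" if "0 \<le> s" "s \<le> t" "\<bar>\<xi> - \<xi>0\<bar> \<le> 1" for s \<xi>
  proof -
    have "flow v s (\<xi>0 - 1) \<le> flow v s \<xi>" "flow v s \<xi> \<le> flow v s (\<xi>0 + 1)"
      using that by (intro flow_mono[OF fc]; simp add: abs_le_iff)+
    moreover have "flow v s (\<xi>0 - 1) \<in> K" "flow v s (\<xi>0 + 1) \<in> K"
      using that by (auto simp: K_def)
    ultimately show ?thesis using R[of "flow v s (\<xi>0 - 1)"] R[of "flow v s (\<xi>0 + 1)"] by auto
  qed
  have "\<bar>flow v t \<xi> - flow v t \<xi>0\<bar> \<le> exp (L * t) * \<bar>\<xi> - \<xi>0\<bar>" if \<xi>: "\<bar>\<xi> - \<xi>0\<bar> \<le> 1" for \<xi>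
  proof -
    define E where "E s = (flow v s \<xi> - flow v s \<xi>0)\<^sup>2 * exp (- 2 * L * s)" for s
    have "E 0 \<ge> E t"
    proof (rule DERIV_nonpos_imp_decreasing_open[OF t])
      show "continuous_on {0..t} E" unfolding E_def
        by (intro continuous_intros; rule continuous_on_subset[OF flow_continuous_on[OF fc]]) auto
      fix s assume s: "0 < s" "s < t"
      let ?x = "flow v s \<xi>" and ?y = "flow v s \<xi>0"
      have d: "(E has_real_derivative
          (2 * (?x - ?y) * (v ?x - v ?y) - 2 * L * (?x - ?y)\<^sup>2) * exp (- 2 * L * s)) (at s)"
        unfolding E_def
        by (rule derivative_eq_intros flow_deriv[OF fc s(1)] refl)+ (simp add: algebra_simps power2_eq_square)
      have "(?x - ?y) * (v ?x - v ?y) \<le> \<bar>?x - ?y\<bar> * \<bar>v ?x - v ?y\<bar>"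
        by (metis abs_ge_self abs_mult)
      also have "\<dots> \<le> \<bar>?x - ?y\<bar> * (L * \<bar>?x - ?y\<bar>)"
        using s \<xi> by (intro mult_left_mono L in_R) auto
      also have "\<dots> = L * (?x - ?y)\<^sup>2" by (simp add: power2_eq_square algebra_simps flip: abs_mult)
      finally have "(2 * (?x - ?y) * (v ?x - v ?y) - 2 * L * (?x - ?y)\<^sup>2) * exp (- 2 * L * s) \<le> 0"
        by (intro mult_nonpos_nonneg) (simp_all add: algebra_simps)
      with d show "\<exists>y. (E has_real_derivative y) (at s) \<and> y \<le> 0" by blast
    qed
    then have "(flow v t \<xi> - flow v t \<xi>0)\<^sup>2 * exp (- 2 * L * t) \<le> (\<xi> - \<xi>0)\<^sup>2"
      by (simp add: E_def fc)
    then have "(flow v t \<xi> - flow v t \<xi>0)\<^sup>2 \<le> (exp (L * t) * \<bar>\<xi> - \<xi>0\<bar>)\<^sup>2"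
      by (simp add: exp_minus power_mult_distrib field_simps flip: exp_double)
    then show ?thesis by (simp add: abs_le_square_iff[symmetric] abs_mult)
  qed
  then show thesis using that by blast
qed

lemma isCont_flow:
  assumes "forward_complete v" "v C1_differentiable_on UNIV" "0 \<le> t"
  shows "isCont (flow v t) \<xi>0"
proof -
  obtain C where C: "\<And>\<xi>. \<bar>\<xi> - \<xi>0\<bar> \<le> 1 \<Longrightarrow> \<bar>flow v t \<xi> - flow v t \<xi>0\<bar> \<le> C * \<bar>\<xi> - \<xi>0\<bar>"
    using flow_lipschitz[OF assms] by metis
  have "\<forall>\<^sub>F \<xi> in at \<xi>0. \<bar>\<xi> - \<xi>0\<bar> \<le> 1"
    unfolding eventually_at by (auto simp: dist_real_def intro!: exI[of _ 1])
  then have "\<forall>\<^sub>F \<xi> in at \<xi>0. norm (flow v t \<xi> - flow v t \<xi>0) \<le> C * \<bar>\<xi> - \<xi>0\<bar>"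
    by eventually_elim (use C in auto)
  moreover have "((\<lambda>\<xi>. C * \<bar>\<xi> - \<xi>0\<bar>) \<longlongrightarrow> C * \<bar>\<xi>0 - \<xi>0\<bar>) (at \<xi>0)"
    by (intro tendsto_intros)
  ultimately have "((\<lambda>\<xi>. flow v t \<xi> - flow v t \<xi>0) \<longlongrightarrow> 0) (at \<xi>0)"
    by (auto intro: Lim_null_comparison)
  then show ?thesis by (simp add: isCont_def LIM_zero_iff)
qed

text \<open>
  The flow is monotone in space and continuous in time, so it is the pointwise limit of the
  functions in which time is rounded up to a grid.
\<close>

lemma borel_measurable_flow:
  assumes fc: "forward_complete v"
  shows "(\<lambda>p. flow v (fst p) (snd p)) \<in> borel_measurable (borel \<Otimes>\<^sub>M borel)"
proof -
  have fixed: "flow v t \<in> borel_measurable borel" for t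
  proof (cases "0 \<le> t")
    case True then show ?thesis by (intro borel_measurable_mono) (auto simp: mono_def flow_mono[OF fc])
  next
    case False
    then have "flow v t = (\<lambda>_. THE z. True)" using flow_neg[OF fc, of t] by auto
    then show ?thesis by simp
  qed
  define T where "T n p = (real_of_int (\<lfloor>real (Suc n) * fst p\<rfloor>) + 1) / real (Suc n)"
    for n and p :: "real \<times> real"
  have T_meas: "(\<lambda>p. flow v (T n p) (snd p)) \<in> borel_measurable (borel \<Otimes>\<^sub>M borel)" for n
    unfolding T_def
  proof (rule measurable_compose_countable[where g = "\<lambda>p. \<lfloor>real (Suc n) * fst p\<rfloor>"
      and f = "\<lambda>k p. flow v ((real_of_int k + 1) / real (Suc n)) (snd p)"])
    show "(\<lambda>p. flow v ((real_of_int k + 1) / real (Suc n)) (snd p)) \<in> borel_measurable (borel \<Otimes>\<^sub>M borel)" for k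
      by (rule measurable_compose[OF measurable_snd fixed])
  qed measurable
  have T_bounds: "fst p \<le> T n p" "T n p \<le> fst p + 1 / real (Suc n)" for n p
  proof -
    have "real (Suc n) * fst p \<le> of_int \<lfloor>real (Suc n) * fst p\<rfloor> + 1"
      "of_int \<lfloor>real (Suc n) * fst p\<rfloor> + 1 \<le> real (Suc n) * fst p + 1" by linarith+
    then show "fst p \<le> T n p" "T n p \<le> fst p + 1 / real (Suc n)"
      unfolding T_def by (simp_all add: field_simps del: of_nat_Suc)
  qed
  have lim: "(\<lambda>n. flow v (T n p) (snd p)) \<longlonglongrightarrow> flow v (fst p) (snd p)" if "0 \<le> fst p" for p
  proof (rule continuous_on_tendsto_compose[OF flow_continuous_on[OF fc]])
    have "(\<lambda>n. fst p + 1 / real (Suc n)) \<longlonglongrightarrow> fst p + 0"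
      by (intro tendsto_intros) (rule LIMSEQ_Suc[OF lim_1_over_n])
    then have upper: "(\<lambda>n. fst p + 1 / real (Suc n)) \<longlonglongrightarrow> fst p" by (simp only: add_0_right)
    show "(\<lambda>n. T n p) \<longlonglongrightarrow> fst p"
      by (rule tendsto_sandwich[OF always_eventually[OF allI[OF T_bounds(1)]]
          always_eventually[OF allI[OF T_bounds(2)]] tendsto_const upper])
    show "\<forall>\<^sub>F n in sequentially. T n p \<in> {0..}"
      using order_trans[OF that T_bounds(1)] by (intro always_eventually) auto
  qed (use that in auto)
  have "(\<lambda>p. if 0 \<le> fst p then flow v (fst p) (snd p) else (THE z. True))
      \<in> borel_measurable (borel \<Otimes>\<^sub>M borel)"
  proof (rule borel_measurable_LIMSEQ_real)
    show "(\<lambda>p. if 0 \<le> fst p then flow v (T n p) (snd p) else (THE z. True))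
      \<in> borel_measurable (borel \<Otimes>\<^sub>M borel)" for n
      using T_meas[of n] by measurable
    show "(\<lambda>n. if 0 \<le> fst p then flow v (T n p) (snd p) else (THE z. True))
      \<longlonglongrightarrow> (if 0 \<le> fst p then flow v (fst p) (snd p) else (THE z. True))" for p
      using lim[of p] by auto
  qed
  also have "(\<lambda>p. if 0 \<le> fst p then flow v (fst p) (snd p) else (THE z. True)) = (\<lambda>p. flow v (fst p) (snd p))"
    using flow_neg[OF fc] by (auto simp: not_le)
  finally show ?thesis .
qed

lemma borel_measurable_flow_compose [measurable (raw)]:
  assumes "forward_complete v" "s \<in> borel_measurable M" "x \<in> borel_measurable M"
  shows "(\<lambda>w. flow v (s w) (x w)) \<in> borel_measurable M"
  using measurable_compose[OF measurable_Pair[OF assms(2,3)] borel_measurable_flow[OF assms(1)]] by simp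

section \<open>The holding times and jumps of the chain\<close>

locale switching =
  fixes N :: nat and u :: "nat \<Rightarrow> real \<Rightarrow> real" and lam :: "nat \<Rightarrow> nat \<Rightarrow> real"
  assumes N_ge_2: "2 \<le> N"
    and C1: "\<And>i. i \<in> {1..N} \<Longrightarrow> u i C1_differentiable_on UNIV"
    and fc: "\<And>i. i \<in> {1..N} \<Longrightarrow> forward_complete (u i)"
    and rate_pos: "\<And>i j. i \<in> {1..N} \<Longrightarrow> j \<in> {1..N} \<Longrightarrow> i \<noteq> j \<Longrightarrow> 0 < lam i j"
begin

abbreviation "rate i \<equiv> total_rate N lam i"

lemma total_rate_pos:
  assumes "i \<in> {1..N}" shows "0 < rate i"
proof -
  have "(if i = 1 then 2 else 1) \<in> {1..N} - {i}" using N_ge_2 by auto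
  then have "{1..N} - {i} \<noteq> {}" by blast
  then show ?thesis unfolding total_rate_def using assms by (intro sum_pos rate_pos) auto
qed

lemma sets_stay_law: "sets (stay_law N lam i) = sets (borel \<Otimes>\<^sub>M count_space {1..N})"
  unfolding stay_law_def by (intro sets_pair_measure_cong) (auto simp: sets_point_measure)

lemma prob_space_next_state:
  assumes i: "i \<in> {1..N}"
  shows "prob_space (point_measure {1..N} (\<lambda>j. ennreal (if j = i then 0 else lam i j / rate i)))"
proof -
  have "(\<Sum>j\<in>{1..N}. ennreal (if j = i then 0 else lam i j / rate i))
      = ennreal (\<Sum>j\<in>{1..N}. if j = i then 0 else lam i j / rate i)"
    using rate_pos[OF i] total_rate_pos[OF i] by (intro sum_ennreal) (auto simp: less_imp_le)
  also have "(\<Sum>j\<in>{1..N}. if j = i then 0 else lam i j / rate i) = (\<Sum>j\<in>{1..N} - {i}. lam i j / rate i)"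
    by (rule sum.mono_neutral_cong_right) auto
  also have "\<dots> = 1"
    using total_rate_pos[OF i] by (simp add: total_rate_def flip: sum_divide_distrib)
  finally have "(\<Sum>j\<in>{1..N}. ennreal (if j = i then 0 else lam i j / rate i)) = 1" by simp
  then show ?thesis
    by (intro prob_spaceI) (simp add: space_point_measure emeasure_point_measure_finite)
qed

lemma prob_space_stay_law: "i \<in> {1..N} \<Longrightarrow> prob_space (stay_law N lam i)"
  unfolding stay_law_def
  by (intro prob_space_pair prob_space_exponential_density prob_space_next_state total_rate_pos)

lemma emeasure_stay_law_Times:
  assumes i: "i \<in> {1..N}" and A: "A \<in> sets borel" and B: "B \<subseteq> {1..N}"
  shows "emeasure (stay_law N lam i) (A \<times> B) =
    (\<integral>\<^sup>+ s. ennreal (exponential_density (rate i) s) * indicator A s \<partial>lborel) *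
    (\<Sum>j\<in>B. ennreal (if j = i then 0 else lam i j / rate i))"
proof -
  interpret P: prob_space "point_measure {1..N} (\<lambda>j. ennreal (if j = i then 0 else lam i j / rate i))"
    by (rule prob_space_next_state[OF i])
  show ?thesis unfolding stay_law_def
    using A B by (subst P.emeasure_pair_measure_Times)
      (auto simp: sets_point_measure emeasure_density emeasure_point_measure_finite)
qed

lemma exponential_density_integral_Icc:
  assumes "0 < l" "0 \<le> t"
  shows "(\<integral>\<^sup>+ s. ennreal (exponential_density l s) * indicator {0..t} s \<partial>lborel) = ennreal (1 - exp (- l * t))"
proof -
  have "(\<integral>\<^sup>+ s. ennreal (exponential_density l s) * indicator {0..t} s \<partial>lborel)
      = (\<integral>\<^sup>+ s. ennreal (l * exp (- l * s)) * indicator {0..t} s \<partial>lborel)"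
    by (intro nn_integral_cong) (auto simp: exponential_density_def indicator_def mult.commute)
  also have "\<dots> = ennreal (- exp (- l * t) - (- exp (- l * 0)))"
    using assms by (intro nn_integral_FTC_Icc) (auto intro!: derivative_eq_intros simp: less_imp_le)
  finally show ?thesis by simp
qed

lemma exponential_density_integral_tail:
  assumes "0 < l" "0 \<le> t"
  shows "(\<integral>\<^sup>+ s. ennreal (exponential_density l s) * indicator {t<..} s \<partial>lborel) = ennreal (exp (- l * t))"
proof -
  have lim: "((\<lambda>s. - exp (- l * s)) \<longlongrightarrow> 0) at_top"
    using assms by real_asymp
  have "(\<integral>\<^sup>+ s. ennreal (exponential_density l s) * indicator {t<..} s \<partial>lborel)
      = (\<integral>\<^sup>+ s. ennreal (l * exp (- l * s)) * indicator {t..} s \<partial>lborel)"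
    using assms AE_lborel_singleton[of t]
    by (intro nn_integral_cong_AE) (auto elim!: eventually_mono simp: exponential_density_def indicator_def mult.commute)
  also have "\<dots> = ennreal (0 - (- exp (- l * t)))"
    using assms lim by (intro nn_integral_FTC_atLeast) (auto intro!: derivative_eq_intros simp: less_imp_le)
  finally show ?thesis by simp
qed

lemma emeasure_holding_time_gt:
  assumes i: "i \<in> {1..N}" and "0 \<le> t"
  shows "emeasure (stay_law N lam i) ({t<..} \<times> {1..N}) = ennreal (exp (- rate i * t))"
proof -
  interpret P: prob_space "point_measure {1..N} (\<lambda>j. ennreal (if j = i then 0 else lam i j / rate i))"
    by (rule prob_space_next_state[OF i])
  have "(\<Sum>j\<in>{1..N}. ennreal (if j = i then 0 else lam i j / rate i)) = 1"
    using P.emeasure_space_1 by (simp add: space_point_measure emeasure_point_measure_finite)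
  then show ?thesis
    using assms by (subst emeasure_stay_law_Times)
      (simp_all add: exponential_density_integral_tail total_rate_pos)
qed

lemma emeasure_jump_within:
  assumes i: "i \<in> {1..N}" and j: "j \<in> {1..N}" "i \<noteq> j" and "0 \<le> t"
  shows "emeasure (stay_law N lam i) ({0..t} \<times> {j}) = ennreal ((1 - exp (- rate i * t)) * (lam i j / rate i))"
  using assms total_rate_pos[OF i] rate_pos[OF i j]
  by (subst emeasure_stay_law_Times)
    (simp_all add: exponential_density_integral_Icc less_imp_le flip: ennreal_mult'')

section \<open>Measurability of the switching process\<close>

lemma measurable_noise_component [measurable]:
  assumes "k \<in> {1..N}"
  shows "(\<lambda>\<omega>. \<omega> n k) \<in> measurable (noise N lam) (borel \<Otimes>\<^sub>M count_space {1..N})"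
proof -
  have "(\<lambda>\<omega>. \<omega> n k) \<in> measurable (noise N lam) (stay_law N lam k)"
    unfolding noise_def
    by (rule measurable_compose[where f = "\<lambda>\<omega>. \<omega> n" and g = "\<lambda>f. f k" and N = "PiM {1..N} (stay_law N lam)"];
        rule measurable_component_singleton) (use assms in auto)
  then show ?thesis
    by (subst measurable_cong_sets[OF refl sets_stay_law[symmetric]])
qed

lemma measurable_visited [measurable]:
  assumes "i \<in> {1..N}"
  shows "(\<lambda>\<omega>. visited \<omega> i n) \<in> measurable (noise N lam) (count_space {1..N})"
proof (induction n)
  case 0 then show ?case using assms by simp
next
  case (Suc n)
  show ?case unfolding visited.simps
    by (rule measurable_compose_countable'[where f = "\<lambda>k \<omega>. snd (\<omega> n k)", OF _ Suc],
        rule measurable_compose[OF measurable_noise_component measurable_snd]) auto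
qed

lemma measurable_holding_time [measurable]:
  assumes "i \<in> {1..N}"
  shows "(\<lambda>\<omega>. holding_time \<omega> i n) \<in> borel_measurable (noise N lam)"
  unfolding holding_time_def
  by (rule measurable_compose_countable'[where f = "\<lambda>k \<omega>. fst (\<omega> n k)", OF _ measurable_visited[OF assms]],
      rule measurable_compose[OF measurable_noise_component measurable_fst]) auto

lemma measurable_jump_time [measurable]:
  assumes [measurable]: "i \<in> {1..N}"
  shows "(\<lambda>\<omega>. jump_time \<omega> i n) \<in> borel_measurable (noise N lam)"
  unfolding jump_time_def by measurable

lemma measurable_num_jumps [measurable]:
  assumes [measurable]: "i \<in> {1..N}"
  shows "(\<lambda>\<omega>. num_jumps \<omega> i t) \<in> measurable (noise N lam) (count_space UNIV)"
  unfolding num_jumps_def by measurable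

lemma measurable_flow_visited:
  assumes i: "i \<in> {1..N}" and "s \<in> borel_measurable (noise N lam)" "x \<in> borel_measurable (noise N lam)"
  shows "(\<lambda>\<omega>. flow (u (visited \<omega> i n)) (s \<omega>) (x \<omega>)) \<in> borel_measurable (noise N lam)"
  by (rule measurable_compose_countable'[where f = "\<lambda>k \<omega>. flow (u k) (s \<omega>) (x \<omega>)", OF _ measurable_visited[OF i]])
    (auto intro!: borel_measurable_flow_compose fc assms)

lemma measurable_position_at_jump [measurable]:
  assumes i: "i \<in> {1..N}"
  shows "(\<lambda>\<omega>. position_at_jump u \<omega> \<xi> i n) \<in> borel_measurable (noise N lam)"
proof (induction n)
  case (Suc n)
  show ?case unfolding position_at_jump.simps
    by (intro measurable_flow_visited i measurable_holding_time Suc)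
qed simp

lemma measurable_process:
  assumes i: "i \<in> {1..N}"
  shows "(\<lambda>\<omega>. (position_process u \<omega> \<xi> i t, state_process \<omega> i t))
    \<in> measurable (noise N lam) (borel \<Otimes>\<^sub>M count_space {1..N})"
proof (rule measurable_Pair)
  show "(\<lambda>\<omega>. position_process u \<omega> \<xi> i t) \<in> borel_measurable (noise N lam)"
    unfolding position_process_def state_process_def
    by (rule measurable_compose_countable[OF _ measurable_num_jumps[OF i, of t], where
          f = "\<lambda>n \<omega>. flow (u (visited \<omega> i n)) (t - jump_time \<omega> i n) (position_at_jump u \<omega> \<xi> i n)"])
      (intro measurable_flow_visited i borel_measurable_diff borel_measurable_const
        measurable_jump_time measurable_position_at_jump)
  show "(\<lambda>\<omega>. state_process \<omega> i t) \<in> measurable (noise N lam) (count_space {1..N})"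
    unfolding state_process_def
    by (rule measurable_compose_countable[OF _ measurable_num_jumps[OF i, of t],
          where f = "\<lambda>n \<omega>. visited \<omega> i n"]) (rule measurable_visited[OF i])
qed

section \<open>Lower bounds for the transition probabilities\<close>

lemma prob_space_row: "prob_space (PiM {1..N} (stay_law N lam))"
  by (intro prob_space_PiM prob_space_stay_law)

lemma emeasure_row:
  assumes "k \<in> {1..N}" "A \<in> sets (stay_law N lam k)"
  shows "emeasure (PiM {1..N} (stay_law N lam)) {f \<in> space (PiM {1..N} (stay_law N lam)). f k \<in> A}
    = emeasure (stay_law N lam k) A"
proof -
  have "emeasure (stay_law N lam k) A
      = emeasure (distr (PiM {1..N} (stay_law N lam)) (stay_law N lam k) (\<lambda>f. f k)) A"
    using assms by (subst distr_PiM_component) (auto intro: prob_space_stay_law)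
  also have "\<dots> = emeasure (PiM {1..N} (stay_law N lam))
      ((\<lambda>f. f k) -` A \<inter> space (PiM {1..N} (stay_law N lam)))"
    using assms by (intro emeasure_distr measurable_component_singleton) auto
  also have "(\<lambda>f. f k) -` A \<inter> space (PiM {1..N} (stay_law N lam))
      = {f \<in> space (PiM {1..N} (stay_law N lam)). f k \<in> A}" by auto
  finally show ?thesis ..
qed

lemma sets_row:
  assumes "k \<in> {1..N}" "A \<in> sets (stay_law N lam k)"
  shows "{f \<in> space (PiM {1..N} (stay_law N lam)). f k \<in> A} \<in> sets (PiM {1..N} (stay_law N lam))"
proof -
  have "(\<lambda>f. f k) -` A \<inter> space (PiM {1..N} (stay_law N lam)) \<in> sets (PiM {1..N} (stay_law N lam))"
    using assms by (intro measurable_sets[OF measurable_component_singleton])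
  then show ?thesis by (auto simp: vimage_def Int_def conj_commute)
qed

text \<open>
  Entries of the first two rows of the noise are independent. These rows decide the process up to
  its second jump.
\<close>

lemma emeasure_noise_two:
  assumes k: "k \<in> {1..N}" "A \<in> sets (stay_law N lam k)" and l: "l \<in> {1..N}" "B \<in> sets (stay_law N lam l)"
  shows "emeasure (noise N lam) {\<omega> \<in> space (noise N lam). \<omega> 0 k \<in> A \<and> \<omega> 1 l \<in> B}
    = emeasure (stay_law N lam k) A * emeasure (stay_law N lam l) B"
proof -
  define R where "R = PiM {1..N} (stay_law N lam)"
  define X where "X n = (if n = 0 then {f \<in> space R. f k \<in> A} else {f \<in> space R. f l \<in> B})" for n :: nat
  have "{\<omega> \<in> space (noise N lam). \<omega> 0 k \<in> A \<and> \<omega> 1 l \<in> B} = prod_emb UNIV (\<lambda>_. R) {0, 1} (Pi\<^sub>E {0, 1} X)"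
    by (auto simp: noise_def prod_emb_def space_PiM X_def R_def PiE_iff restrict_def extensional_def)
  then have "emeasure (noise N lam) {\<omega> \<in> space (noise N lam). \<omega> 0 k \<in> A \<and> \<omega> 1 l \<in> B}
      = (\<Prod>n\<in>{0, 1}. emeasure R (X n))"
    unfolding noise_def R_def[symmetric]
    using assms by (simp only:) (rule emeasure_PiM_emb, auto simp: X_def R_def intro: sets_row prob_space_row[simplified])
  also have "\<dots> = emeasure (stay_law N lam k) A * emeasure (stay_law N lam l) B"
    using emeasure_row[OF k] emeasure_row[OF l] by (simp add: X_def R_def)
  finally show ?thesis .
qed

lemma emeasure_noise_one:
  assumes k: "k \<in> {1..N}" "A \<in> sets (stay_law N lam k)"
  shows "emeasure (noise N lam) {\<omega> \<in> space (noise N lam). \<omega> 0 k \<in> A} = emeasure (stay_law N lam k) A"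
proof -
  have eq: "{\<omega> \<in> space (noise N lam). \<omega> 0 k \<in> A}
      = {\<omega> \<in> space (noise N lam). \<omega> 0 k \<in> A \<and> \<omega> 1 k \<in> space (stay_law N lam k)}"
    using k by (auto simp: noise_def space_PiM PiE_iff)
  show ?thesis unfolding eq
    using k by (subst emeasure_noise_two) (auto simp: prob_space.emeasure_space_1[OF prob_space_stay_law])
qed

lemma transition_ge:
  assumes j: "j \<in> {1..N}" and i: "i \<in> {1..N}" and E: "E \<in> sets borel"
    and W: "\<And>\<omega>. \<omega> \<in> W \<Longrightarrow> \<omega> \<in> space (noise N lam) \<Longrightarrow>
      position_process u \<omega> \<xi> j t \<in> E \<and> state_process \<omega> j t = i"
  shows "emeasure (noise N lam) {\<omega> \<in> space (noise N lam). \<omega> \<in> W} \<le> emeasure (transition N u lam t \<xi> j) (E \<times> {i})"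
proof -
  let ?X = "\<lambda>\<omega>. (position_process u \<omega> \<xi> j t, state_process \<omega> j t)"
  have E': "E \<times> {i} \<in> sets (borel \<Otimes>\<^sub>M count_space {1..N})" using E i by auto
  have "emeasure (transition N u lam t \<xi> j) (E \<times> {i})
      = emeasure (noise N lam) (?X -` (E \<times> {i}) \<inter> space (noise N lam))"
    unfolding transition_def using measurable_process[OF j] E' by (rule emeasure_distr)
  moreover have "emeasure (noise N lam) {\<omega> \<in> space (noise N lam). \<omega> \<in> W} \<le> \<dots>"
    using W by (intro emeasure_mono measurable_sets[OF measurable_process[OF j] E']) auto
  ultimately show ?thesis by simp
qed

text \<open>On the event that the first holding time exceeds \<open>t\<close> the path follows \<open>u i\<close> throughout.\<close>

lemma transition_no_jump:
  assumes i: "i \<in> {1..N}" and E: "E \<in> sets borel" and t: "0 \<le> t"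
  shows "ennreal (exp (- rate i * t)) * indicator E (flow (u i) t \<xi>)
    \<le> emeasure (transition N u lam t \<xi> i) (E \<times> {i})"
proof (cases "flow (u i) t \<xi> \<in> E")
  case True
  have "emeasure (noise N lam) {\<omega> \<in> space (noise N lam). \<omega> \<in> {\<omega>. \<omega> (0::nat) i \<in> {t<..} \<times> {1..N}}}
      \<le> emeasure (transition N u lam t \<xi> i) (E \<times> {i})"
  proof (rule transition_ge[OF i i E])
    fix \<omega> :: "nat \<Rightarrow> nat \<Rightarrow> real \<times> nat"
    assume "\<omega> \<in> {\<omega>. \<omega> 0 i \<in> {t<..} \<times> {1..N}}"
    then have \<omega>: "\<omega> 0 i \<in> {t<..} \<times> {1..N}" by simp
    then have "num_jumps \<omega> i t = 0"
      unfolding num_jumps_def by (intro Least_equality) (auto simp: jump_time_def holding_time_def)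
    then show "position_process u \<omega> \<xi> i t \<in> E \<and> state_process \<omega> i t = i"
      using True by (auto simp: position_process_def state_process_def jump_time_def)
  qed
  then show ?thesis
    using True i emeasure_holding_time_gt[OF i t] by (simp add: emeasure_noise_one sets_stay_law)
qed simp

text \<open>
  The event that the chain leaves \<open>j\<close> for \<open>i\<close> within time \<open>t\<close> and then holds for longer than \<open>t\<close>. It
  is smaller than the event of exactly one jump, but its probability is a product and still equals
  \<open>lam j i * t\<close> to first order, which is all that the generator sees.
\<close>

lemma transition_one_jump:
  assumes i: "i \<in> {1..N}" and j: "j \<in> {1..N}" and ne: "i \<noteq> j" and E: "E \<in> sets borel" and t: "0 \<le> t"
    and stays: "\<And>s. 0 \<le> s \<Longrightarrow> s \<le> t \<Longrightarrow> flow (u i) (t - s) (flow (u j) s \<xi>) \<in> E"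
  shows "ennreal ((1 - exp (- rate j * t)) * (lam j i / rate j) * exp (- rate i * t))
    \<le> emeasure (transition N u lam t \<xi> j) (E \<times> {i})"
proof -
  have "emeasure (noise N lam) {\<omega> \<in> space (noise N lam). \<omega> \<in> {\<omega>. \<omega> (0::nat) j \<in> {0..t} \<times> {i} \<and> \<omega> 1 i \<in> {t<..} \<times> {1..N}}}
      \<le> emeasure (transition N u lam t \<xi> j) (E \<times> {i})"
  proof (rule transition_ge[OF j i E])
    fix \<omega> :: "nat \<Rightarrow> nat \<Rightarrow> real \<times> nat"
    assume "\<omega> \<in> {\<omega>. \<omega> 0 j \<in> {0..t} \<times> {i} \<and> \<omega> 1 i \<in> {t<..} \<times> {1..N}}"
    then have \<omega>: "\<omega> 0 j \<in> {0..t} \<times> {i}" "\<omega> 1 i \<in> {t<..} \<times> {1..N}" by auto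
    have v: "visited \<omega> j 1 = i" and h0: "holding_time \<omega> j 0 \<in> {0..t}" and h1: "t < holding_time \<omega> j 1"
      using \<omega> by (auto simp: holding_time_def)
    have T: "jump_time \<omega> j (Suc 0) = holding_time \<omega> j 0"
      "jump_time \<omega> j (Suc (Suc 0)) = holding_time \<omega> j 0 + holding_time \<omega> j 1"
      by (simp_all add: jump_time_def)
    have n: "num_jumps \<omega> j t = 1"
      unfolding num_jumps_def
    proof (rule Least_equality)
      show "t < jump_time \<omega> j (Suc 1)" using h0 h1 T by auto
      fix m assume "t < jump_time \<omega> j (Suc m)"
      then show "1 \<le> m" using T h0 by (cases m) auto
    qed
    have "state_process \<omega> j t = i" using n v by (simp add: state_process_def)
    moreover have "position_process u \<omega> \<xi> j t = flow (u i) (t - holding_time \<omega> j 0) (flow (u j) (holding_time \<omega> j 0) \<xi>)"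
      using n v T by (simp add: position_process_def state_process_def)
    ultimately show "position_process u \<omega> \<xi> j t \<in> E \<and> state_process \<omega> j t = i" using stays h0 by auto
  qed
  also have "emeasure (noise N lam) {\<omega> \<in> space (noise N lam). \<omega> \<in> {\<omega>. \<omega> (0::nat) j \<in> {0..t} \<times> {i} \<and> \<omega> 1 i \<in> {t<..} \<times> {1..N}}}
    = ennreal ((1 - exp (- rate j * t)) * (lam j i / rate j)) * ennreal (exp (- rate i * t))"
    using i j t ne emeasure_noise_two[of j "{0..t} \<times> {i}" i "{t<..} \<times> {1..N}"]
      emeasure_holding_time_gt[OF i t] emeasure_jump_within[OF j i not_sym[OF ne] t]
    by (simp add: sets_stay_law)
  also have "\<dots> = ennreal ((1 - exp (- rate j * t)) * (lam j i / rate j) * exp (- rate i * t))"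
    by (simp only: ennreal_mult'' exp_ge_zero)
  finally show ?thesis .
qed

end

section \<open>The stationary forward equation in weak form\<close>

text \<open>
  Invariance is a statement about sets. The superlevel sets of a test function carry it over to
  integrals.
\<close>

lemma layer_cake:
  assumes "sigma_finite_measure M" and f [measurable]: "f \<in> borel_measurable M" and "\<And>x. 0 \<le> f x"
  shows borel_measurable_emeasure_superlevel:
      "(\<lambda>c. emeasure M {x \<in> space M. c < f x}) \<in> borel_measurable (borel :: real measure)"
    and nn_integral_layer_cake:
      "(\<integral>\<^sup>+ x. ennreal (f x) \<partial>M) = (\<integral>\<^sup>+ c. emeasure M {x \<in> space M. c < f x} * indicator {0..} c \<partial>lborel)"
proof -
  interpret M: sigma_finite_measure M by fact
  interpret P: pair_sigma_finite M lborel by unfold_locales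
  have ind: "(\<integral>\<^sup>+ x. indicator {x. c < f x} x \<partial>M) = emeasure M {x \<in> space M. c < f x}" for c
  proof -
    have "(\<integral>\<^sup>+ x. indicator {x. c < f x} x \<partial>M) = (\<integral>\<^sup>+ x. indicator {x \<in> space M. c < f x} x \<partial>M)"
      by (intro nn_integral_cong) (simp add: indicator_def)
    then show ?thesis by simp
  qed
  have "(\<lambda>c. \<integral>\<^sup>+ x. indicator {x. c < f x} x \<partial>M) \<in> borel_measurable (borel :: real measure)"
    unfolding indicator_def by measurable
  then show *: "(\<lambda>c. emeasure M {x \<in> space M. c < f x}) \<in> borel_measurable (borel :: real measure)"
    unfolding ind .
  have "(\<integral>\<^sup>+ x. ennreal (f x) \<partial>M) = (\<integral>\<^sup>+ x. \<integral>\<^sup>+ c. indicator {x. c < f x} x * indicator {0..} c \<partial>lborel \<partial>M)"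
  proof (intro nn_integral_cong)
    fix x
    have "(\<integral>\<^sup>+ c. indicator {x. c < f x} x * indicator {0..} c \<partial>lborel) = (\<integral>\<^sup>+ c. indicator {0..<f x} c \<partial>lborel)"
      by (intro nn_integral_cong) (auto split: split_indicator)
    then show "ennreal (f x) = (\<integral>\<^sup>+ c. indicator {x. c < f x} x * indicator {0..} c \<partial>lborel)"
      using assms(3)[of x] by simp
  qed
  also have "\<dots> = (\<integral>\<^sup>+ c. \<integral>\<^sup>+ x. indicator {x. c < f x} x * indicator {0..} c \<partial>M \<partial>lborel)"
    by (rule P.Fubini'[symmetric]) (unfold indicator_def, measurable)
  also have "\<dots> = (\<integral>\<^sup>+ c. emeasure M {x \<in> space M. c < f x} * indicator {0..} c \<partial>lborel)"
    by (intro nn_integral_cong) (subst nn_integral_multc, auto simp: ind indicator_def)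
  finally show "(\<integral>\<^sup>+ x. ennreal (f x) \<partial>M) = (\<integral>\<^sup>+ c. emeasure M {x \<in> space M. c < f x} * indicator {0..} c \<partial>lborel)" .
qed

text \<open>
  Only the derivative has compact support: constants and smoothed steps have to be admissible. The
  compact support makes \<open>h * u k\<close> bounded for unbounded fields.
\<close>

definition test_function :: "(real \<Rightarrow> real) \<Rightarrow> (real \<Rightarrow> real) \<Rightarrow> bool" where
  "test_function f h \<longleftrightarrow> (\<forall>z. (f has_real_derivative h z) (at z)) \<and> continuous_on UNIV h \<and>
     (\<exists>R. \<forall>z. R \<le> \<bar>z\<bar> \<longrightarrow> h z = 0) \<and> (\<exists>B. \<forall>z. \<bar>f z\<bar> \<le> B)"

lemma test_function_measurable:
  assumes "test_function f h"
  shows "f \<in> borel_measurable borel" "h \<in> borel_measurable borel"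
proof -
  have "continuous_on UNIV f"
    using assms unfolding test_function_def by (intro DERIV_continuous_on) (auto intro: has_field_derivative_at_within)
  then show "f \<in> borel_measurable borel" by (rule borel_measurable_continuous_onI)
  show "h \<in> borel_measurable borel"
    using assms unfolding test_function_def by (intro borel_measurable_continuous_onI) auto
qed

locale stationary_switching = switching +
  fixes \<mu> :: "(real \<times> nat) measure"
  assumes inv: "invariant_measure N u lam \<mu>"
begin

abbreviation "m i \<equiv> slice \<mu> i"

lemma sets_\<mu>: "sets \<mu> = sets (borel \<Otimes>\<^sub>M count_space {1..N})" and prob_\<mu>: "prob_space \<mu>"
  using inv by (auto simp: invariant_measure_def)

lemma space_\<mu>: "space \<mu> = UNIV \<times> {1..N}"
  using sets_eq_imp_space_eq[OF sets_\<mu>] by (simp add: space_pair_measure)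

lemma sets_slice [simp, measurable_cong]: "sets (m i) = sets borel"
  and space_slice [simp]: "space (m i) = UNIV"
  by (simp_all add: slice_def)

lemma measurable_slice_iff: "F \<in> borel_measurable (m j) \<longleftrightarrow> F \<in> borel_measurable borel"
  by (rule arg_cong2[where f = "(\<in>)", OF refl measurable_cong_sets]) simp_all

lemma emeasure_slice:
  assumes i: "i \<in> {1..N}" and E: "E \<in> sets borel"
  shows "emeasure (m i) E = emeasure \<mu> (E \<times> {i})"
proof -
  have S: "UNIV \<times> {i} \<in> sets \<mu>" using i by (auto simp: sets_\<mu>)
  have f: "fst \<in> measurable (restrict_space \<mu> (UNIV \<times> {i})) borel"
    by (intro measurable_restrict_space1) (simp add: measurable_cong_sets[OF sets_\<mu> refl])
  have "emeasure (m i) E = emeasure (restrict_space \<mu> (UNIV \<times> {i}))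
      (fst -` E \<inter> space (restrict_space \<mu> (UNIV \<times> {i})))"
    unfolding slice_def by (rule emeasure_distr[OF f E])
  also have "fst -` E \<inter> space (restrict_space \<mu> (UNIV \<times> {i})) = E \<times> {i}"
    using i by (auto simp: space_restrict_space space_\<mu>)
  also have "emeasure (restrict_space \<mu> (UNIV \<times> {i})) (E \<times> {i}) = emeasure \<mu> (E \<times> {i})"
    using S by (intro emeasure_restrict_space) auto
  finally show ?thesis .
qed

lemma finite_slice: "i \<in> {1..N} \<Longrightarrow> finite_measure (m i)"
  using finite_measure.emeasure_finite[OF prob_space.finite_measure[OF prob_\<mu>]]
  by (intro finite_measureI) (simp add: emeasure_slice)

lemma integrable_slice:
  fixes F :: "real \<Rightarrow> real"
  assumes "j \<in> {1..N}" "F \<in> borel_measurable borel" "\<And>x. \<bar>F x\<bar> \<le> C"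
  shows "integrable (m j) F"
  using assms by (intro finite_measure.integrable_const_bound[OF finite_slice, of j F C]) (auto simp: measurable_slice_iff)

text \<open>The bound of \<open>transition_one_jump\<close>, which is \<open>lam j i * t\<close> to first order.\<close>

definition jump_prob :: "nat \<Rightarrow> nat \<Rightarrow> real \<Rightarrow> real" where
  "jump_prob j i t = (1 - exp (- rate j * t)) * (lam j i / rate j) * exp (- rate i * t)"

lemma jump_prob_nonneg:
  assumes "j \<in> {1..N}" "i \<in> {1..N}" "j \<noteq> i" "0 \<le> t"
  shows "0 \<le> jump_prob j i t"
  using rate_pos[OF assms(1-3)] total_rate_pos[OF assms(1)] assms(4)
  unfolding jump_prob_def by (intro mult_nonneg_nonneg) auto

lemma measurable_flow_at: "i \<in> {1..N} \<Longrightarrow> flow (u i) t \<in> borel_measurable borel"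
  by (rule borel_measurable_flow_compose[OF fc, where s = "\<lambda>_. t" and x = "\<lambda>x. x"]) auto

lemma slice_ge:
  assumes i: "i \<in> {1..N}" and t: "0 \<le> t" and E: "E \<in> sets borel"
    and A: "\<And>j. j \<in> {1..N} - {i} \<Longrightarrow> A j \<in> sets borel"
    and stays: "\<And>j \<xi> s. j \<in> {1..N} - {i} \<Longrightarrow> \<xi> \<in> A j \<Longrightarrow> 0 \<le> s \<Longrightarrow> s \<le> t \<Longrightarrow> flow (u i) (t - s) (flow (u j) s \<xi>) \<in> E"
  shows "ennreal (exp (- rate i * t)) * emeasure (m i) (flow (u i) t -` E)
      + (\<Sum>j\<in>{1..N} - {i}. ennreal (jump_prob j i t) * emeasure (m j) (A j)) \<le> emeasure (m i) E"
proof -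
  let ?P = "\<lambda>j \<xi>. emeasure (transition N u lam t \<xi> j) (E \<times> {i})"
  have pre: "flow (u i) t -` E \<in> sets borel"
    using measurable_sets[OF measurable_flow_at[OF i] E] by simp
  have "ennreal (exp (- rate i * t)) * emeasure (m i) (flow (u i) t -` E)
      = (\<integral>\<^sup>+ \<xi>. ennreal (exp (- rate i * t)) * indicator (flow (u i) t -` E) \<xi> \<partial>m i)"
    using pre by (simp add: nn_integral_cmult)
  also have "\<dots> \<le> (\<integral>\<^sup>+ \<xi>. ?P i \<xi> \<partial>m i)"
    using transition_no_jump[OF i E t] by (intro nn_integral_mono) (simp add: indicator_def)
  finally have 1: "ennreal (exp (- rate i * t)) * emeasure (m i) (flow (u i) t -` E) \<le> (\<integral>\<^sup>+ \<xi>. ?P i \<xi> \<partial>m i)" .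
  have 2: "ennreal (jump_prob j i t) * emeasure (m j) (A j) \<le> (\<integral>\<^sup>+ \<xi>. ?P j \<xi> \<partial>m j)" if j: "j \<in> {1..N} - {i}" for j
  proof -
    have "ennreal (jump_prob j i t) * emeasure (m j) (A j) = (\<integral>\<^sup>+ \<xi>. ennreal (jump_prob j i t) * indicator (A j) \<xi> \<partial>m j)"
      using A[OF j] by (simp add: nn_integral_cmult)
    also have "\<dots> \<le> (\<integral>\<^sup>+ \<xi>. ?P j \<xi> \<partial>m j)"
    proof (intro nn_integral_mono)
      fix \<xi> show "ennreal (jump_prob j i t) * indicator (A j) \<xi> \<le> ?P j \<xi>"
      proof (cases "\<xi> \<in> A j")
        case True
        then show ?thesis
          using transition_one_jump[OF i _ _ E t stays[OF j True]] j by (simp add: jump_prob_def)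
      qed simp
    qed
    finally show ?thesis .
  qed
  have "emeasure (m i) E = (\<Sum>j\<in>{1..N}. \<integral>\<^sup>+ \<xi>. ?P j \<xi> \<partial>m j)"
    using inv i t E unfolding invariant_measure_def by (simp add: emeasure_slice)
  also have "\<dots> = (\<integral>\<^sup>+ \<xi>. ?P i \<xi> \<partial>m i) + (\<Sum>j\<in>{1..N} - {i}. \<integral>\<^sup>+ \<xi>. ?P j \<xi> \<partial>m j)"
    using i by (intro sum.remove) auto
  finally have eq: "emeasure (m i) E = (\<integral>\<^sup>+ \<xi>. ?P i \<xi> \<partial>m i) + (\<Sum>j\<in>{1..N} - {i}. \<integral>\<^sup>+ \<xi>. ?P j \<xi> \<partial>m j)" .
  show ?thesis unfolding eq by (rule add_mono[OF 1 sum_mono[OF 2]])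
qed

text \<open>
  Along any flow \<open>f\<close> changes at speed at most \<open>K\<close>, so a path that makes one jump before time \<open>t\<close> and
  starts where \<open>f > c + K * t\<close> ends where \<open>f > c\<close>. This bounds the mass of each superlevel set of
  \<open>f\<close> from below, and integrating over \<open>c\<close> gives the claim.
\<close>

lemma slice_integral_ge:
  assumes i: "i \<in> {1..N}" and t: "0 \<le> t" and f: "f \<in> borel_measurable borel"
    and f0: "\<And>x. 0 \<le> f x" and fB: "\<And>x. f x \<le> B" and K: "0 \<le> K"
    and lip: "\<And>k s \<xi>. k \<in> {1..N} \<Longrightarrow> 0 \<le> s \<Longrightarrow> \<bar>f (flow (u k) s \<xi>) - f \<xi>\<bar> \<le> K * s"
  shows "exp (- rate i * t) * (\<integral>\<xi>. f (flow (u i) t \<xi>) \<partial>m i)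
      + (\<Sum>j\<in>{1..N} - {i}. jump_prob j i t * (\<integral>\<xi>. f \<xi> - K * t \<partial>m j)) \<le> (\<integral>\<xi>. f \<xi> \<partial>m i)"
proof -
  have fl: "(\<lambda>x. f (flow (u i) t x)) \<in> borel_measurable borel"
    by (rule measurable_compose[OF measurable_flow_at[OF i] f])
  define g where "g \<xi> = max 0 (f \<xi> - K * t)" for \<xi>
  have g: "g \<in> borel_measurable borel"
    unfolding g_def using f by (intro borel_measurable_max borel_measurable_diff borel_measurable_const)
  have sf: "sigma_finite_measure (m j)" if "j \<in> {1..N}" for j
    using finite_slice[OF that] by (rule finite_measure.axioms(1))
  have cake: "(\<integral>\<^sup>+ x. ennreal (F x) \<partial>m j) = (\<integral>\<^sup>+ c. emeasure (m j) {x. c < F x} * indicator {0..} c \<partial>lborel)"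
    and cm [measurable]: "(\<lambda>c. emeasure (m j) {x. c < F x}) \<in> borel_measurable borel"
    if "j \<in> {1..N}" "F \<in> borel_measurable borel" "\<And>x. 0 \<le> F x" for j F
    using layer_cake[OF sf[OF that(1)] that(2)[folded measurable_slice_iff[of F j]] that(3)]
    unfolding space_slice by simp_all
  have cmi: "(\<lambda>c. emeasure (m i) {x. c < f (flow (u i) t x)}) \<in> borel_measurable borel"
    by (rule cm[OF i fl f0])
  have cmj: "(\<lambda>c. emeasure (m j) {x. c < g x}) \<in> borel_measurable borel" if "j \<in> {1..N} - {i}" for j
    by (rule cm[OF _ g]) (use that in \<open>auto simp: g_def\<close>)
  have "ennreal (exp (- rate i * t)) * (\<integral>\<^sup>+ \<xi>. ennreal (f (flow (u i) t \<xi>)) \<partial>m i)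
      + (\<Sum>j\<in>{1..N} - {i}. ennreal (jump_prob j i t) * (\<integral>\<^sup>+ \<xi>. ennreal (g \<xi>) \<partial>m j))
    = ennreal (exp (- rate i * t)) * (\<integral>\<^sup>+ c. emeasure (m i) {x. c < f (flow (u i) t x)} * indicator {0..} c \<partial>lborel)
      + (\<Sum>j\<in>{1..N} - {i}. ennreal (jump_prob j i t) * (\<integral>\<^sup>+ c. emeasure (m j) {x. c < g x} * indicator {0..} c \<partial>lborel))"
  proof -
    have "(\<integral>\<^sup>+ \<xi>. ennreal (g \<xi>) \<partial>m j) = (\<integral>\<^sup>+ c. emeasure (m j) {x. c < g x} * indicator {0..} c \<partial>lborel)"
      if "j \<in> {1..N} - {i}" for j
      by (rule cake[OF _ g]) (use that in \<open>auto simp: g_def\<close>)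
    then have "(\<Sum>j\<in>{1..N} - {i}. ennreal (jump_prob j i t) * (\<integral>\<^sup>+ \<xi>. ennreal (g \<xi>) \<partial>m j))
      = (\<Sum>j\<in>{1..N} - {i}. ennreal (jump_prob j i t) * (\<integral>\<^sup>+ c. emeasure (m j) {x. c < g x} * indicator {0..} c \<partial>lborel))"
      by (intro sum.cong refl) (simp only:)
    then show ?thesis
      unfolding cake[OF i fl f0] by (rule arg_cong2[where f = "(+)", OF refl])
  qed
  also have "\<dots> = (\<integral>\<^sup>+ c. (ennreal (exp (- rate i * t)) * emeasure (m i) {x. c < f (flow (u i) t x)}
      + (\<Sum>j\<in>{1..N} - {i}. ennreal (jump_prob j i t) * emeasure (m j) {x. c < g x})) * indicator {0..} c \<partial>lborel)"
  proof -
    have "(\<Sum>j\<in>{1..N} - {i}. ennreal (jump_prob j i t) * (\<integral>\<^sup>+ c. emeasure (m j) {x. c < g x} * indicator {0..} c \<partial>lborel))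
        = (\<Sum>j\<in>{1..N} - {i}. \<integral>\<^sup>+ c. ennreal (jump_prob j i t) * (emeasure (m j) {x. c < g x} * indicator {0..} c) \<partial>lborel)"
      using cmj by (intro sum.cong refl nn_integral_cmult[symmetric] borel_measurable_times_ennreal) auto
    also have "\<dots> = (\<integral>\<^sup>+ c. (\<Sum>j\<in>{1..N} - {i}. ennreal (jump_prob j i t) * (emeasure (m j) {x. c < g x} * indicator {0..} c)) \<partial>lborel)"
      using cmj by (intro nn_integral_sum[symmetric] borel_measurable_times_ennreal) auto
    finally have S: "(\<Sum>j\<in>{1..N} - {i}. ennreal (jump_prob j i t) * (\<integral>\<^sup>+ c. emeasure (m j) {x. c < g x} * indicator {0..} c \<partial>lborel))
        = (\<integral>\<^sup>+ c. (\<Sum>j\<in>{1..N} - {i}. ennreal (jump_prob j i t) * (emeasure (m j) {x. c < g x} * indicator {0..} c)) \<partial>lborel)" .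
    have I: "ennreal (exp (- rate i * t)) * (\<integral>\<^sup>+ c. emeasure (m i) {x. c < f (flow (u i) t x)} * indicator {0..} c \<partial>lborel)
        = (\<integral>\<^sup>+ c. ennreal (exp (- rate i * t)) * (emeasure (m i) {x. c < f (flow (u i) t x)} * indicator {0..} c) \<partial>lborel)"
      using cmi by (intro nn_integral_cmult[symmetric] borel_measurable_times_ennreal) auto
    show ?thesis unfolding S I
    proof (subst nn_integral_add[symmetric])
      show "(\<lambda>c. \<Sum>j\<in>{1..N} - {i}. ennreal (jump_prob j i t) * (emeasure (m j) {x. c < g x} * indicator {0..} c)) \<in> borel_measurable lborel"
        using cmj by (intro borel_measurable_sum borel_measurable_times_ennreal) auto
      show "(\<lambda>c. ennreal (exp (- rate i * t)) * (emeasure (m i) {x. c < f (flow (u i) t x)} * indicator {0..} c)) \<in> borel_measurable lborel"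
        using cmi by (intro borel_measurable_times_ennreal) auto
    qed (simp add: distrib_right sum_distrib_right mult.assoc)
  qed
  also have "\<dots> \<le> (\<integral>\<^sup>+ c. emeasure (m i) {x. c < f x} * indicator {0..} c \<partial>lborel)"
  proof (intro nn_integral_mono)
    fix c :: real
    show "(ennreal (exp (- rate i * t)) * emeasure (m i) {x. c < f (flow (u i) t x)}
      + (\<Sum>j\<in>{1..N} - {i}. ennreal (jump_prob j i t) * emeasure (m j) {x. c < g x})) * indicator {0..} c
      \<le> emeasure (m i) {x. c < f x} * indicator {0..} c"
    proof (cases "0 \<le> c")
      case True
      have "ennreal (exp (- rate i * t)) * emeasure (m i) (flow (u i) t -` {x. c < f x})
        + (\<Sum>j\<in>{1..N} - {i}. ennreal (jump_prob j i t) * emeasure (m j) {x. c < g x}) \<le> emeasure (m i) {x. c < f x}"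
      proof (rule slice_ge[OF i t])
        fix j \<xi> s assume j: "j \<in> {1..N} - {i}" and \<xi>: "\<xi> \<in> {x. c < g x}" and s: "0 \<le> s" "s \<le> t"
        have "\<bar>f (flow (u i) (t - s) (flow (u j) s \<xi>)) - f (flow (u j) s \<xi>)\<bar> \<le> K * (t - s)"
          using lip i s by simp
        moreover have "\<bar>f (flow (u j) s \<xi>) - f \<xi>\<bar> \<le> K * s" using lip j s by simp
        moreover have "c < f \<xi> - K * t" using \<xi> True by (auto simp: g_def)
        ultimately show "flow (u i) (t - s) (flow (u j) s \<xi>) \<in> {x. c < f x}"
          unfolding mem_Collect_eq right_diff_distrib by linarith
      qed (use borel_measurable_less[OF borel_measurable_const f] borel_measurable_less[OF borel_measurable_const g]
          in \<open>simp_all\<close>)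
      then show ?thesis using True by (simp add: vimage_def)
    qed simp
  qed
  also have "\<dots> = (\<integral>\<^sup>+ \<xi>. ennreal (f \<xi>) \<partial>m i)" by (rule cake[OF i f f0, symmetric])
  finally have nn: "ennreal (exp (- rate i * t)) * (\<integral>\<^sup>+ \<xi>. ennreal (f (flow (u i) t \<xi>)) \<partial>m i)
      + (\<Sum>j\<in>{1..N} - {i}. ennreal (jump_prob j i t) * (\<integral>\<^sup>+ \<xi>. ennreal (g \<xi>) \<partial>m j))
    \<le> (\<integral>\<^sup>+ \<xi>. ennreal (f \<xi>) \<partial>m i)" .
  note int = integrable_slice
  have conv: "(\<integral>\<^sup>+ x. ennreal (F x) \<partial>m j) = ennreal (\<integral>x. F x \<partial>m j)"
    if "j \<in> {1..N}" "F \<in> borel_measurable borel" "\<And>x. 0 \<le> F x" "\<And>x. F x \<le> B" for j and F :: "real \<Rightarrow> real"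
    using that by (intro nn_integral_eq_integral int[of _ _ B]) auto
  have gB: "g x \<le> B" for x using fB[of x] f0[of x] K t by (auto simp: g_def max_def intro: order_trans[of _ "f x"])
  have "ennreal (exp (- rate i * t) * (\<integral>\<xi>. f (flow (u i) t \<xi>) \<partial>m i) + (\<Sum>j\<in>{1..N} - {i}. jump_prob j i t * (\<integral>\<xi>. g \<xi> \<partial>m j)))
      = ennreal (exp (- rate i * t)) * (\<integral>\<^sup>+ \<xi>. ennreal (f (flow (u i) t \<xi>)) \<partial>m i)
      + (\<Sum>j\<in>{1..N} - {i}. ennreal (jump_prob j i t) * (\<integral>\<^sup>+ \<xi>. ennreal (g \<xi>) \<partial>m j))"
  proof -
    have a: "(\<integral>\<^sup>+ \<xi>. ennreal (f (flow (u i) t \<xi>)) \<partial>m i) = ennreal (\<integral>\<xi>. f (flow (u i) t \<xi>) \<partial>m i)"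
      by (rule conv[OF i fl]) (use f0 fB in auto)
    have b: "(\<integral>\<^sup>+ \<xi>. ennreal (g \<xi>) \<partial>m j) = ennreal (\<integral>\<xi>. g \<xi> \<partial>m j)" if "j \<in> {1..N} - {i}" for j
      by (rule conv[OF _ g]) (use that gB in \<open>auto simp: g_def\<close>)
    have p: "0 \<le> jump_prob j i t * (\<integral>\<xi>. g \<xi> \<partial>m j)" if "j \<in> {1..N} - {i}" for j
      using that i t by (intro mult_nonneg_nonneg jump_prob_nonneg integral_nonneg) (auto simp: g_def)
    have "(\<Sum>j\<in>{1..N} - {i}. ennreal (jump_prob j i t) * (\<integral>\<^sup>+ \<xi>. ennreal (g \<xi>) \<partial>m j))
        = (\<Sum>j\<in>{1..N} - {i}. ennreal (jump_prob j i t * (\<integral>\<xi>. g \<xi> \<partial>m j)))"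
      using i t by (intro sum.cong refl) (subst b, auto simp: g_def intro!: ennreal_mult'[symmetric] jump_prob_nonneg)
    also have "\<dots> = ennreal (\<Sum>j\<in>{1..N} - {i}. jump_prob j i t * (\<integral>\<xi>. g \<xi> \<partial>m j))"
      by (intro sum_ennreal p)
    finally have s: "(\<Sum>j\<in>{1..N} - {i}. ennreal (jump_prob j i t) * (\<integral>\<^sup>+ \<xi>. ennreal (g \<xi>) \<partial>m j))
        = ennreal (\<Sum>j\<in>{1..N} - {i}. jump_prob j i t * (\<integral>\<xi>. g \<xi> \<partial>m j))" .
    show ?thesis unfolding a s
      using f0 by (subst ennreal_plus) (auto intro!: sum_nonneg p mult_nonneg_nonneg integral_nonneg simp: ennreal_mult')
  qed
  also note nn
  also have "(\<integral>\<^sup>+ \<xi>. ennreal (f \<xi>) \<partial>m i) = ennreal (\<integral>\<xi>. f \<xi> \<partial>m i)"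
    by (rule conv[OF i f f0 fB])
  finally have "exp (- rate i * t) * (\<integral>\<xi>. f (flow (u i) t \<xi>) \<partial>m i)
      + (\<Sum>j\<in>{1..N} - {i}. jump_prob j i t * (\<integral>\<xi>. g \<xi> \<partial>m j)) \<le> (\<integral>\<xi>. f \<xi> \<partial>m i)"
    using f0 by (subst (asm) ennreal_le_iff) (auto intro: integral_nonneg)
  moreover have "jump_prob j i t * (\<integral>\<xi>. f \<xi> - K * t \<partial>m j) \<le> jump_prob j i t * (\<integral>\<xi>. g \<xi> \<partial>m j)"
    if j: "j \<in> {1..N} - {i}" for j
  proof (intro mult_left_mono integral_mono)
    have "\<bar>f x - K * t\<bar> \<le> \<bar>B\<bar> + K * t" for x using f0[of x] fB[of x] mult_nonneg_nonneg[OF K t] by (auto simp: abs_le_iff)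
    then show "integrable (m j) (\<lambda>x. f x - K * t)" by (intro int[of _ _ "\<bar>B\<bar> + K * t"]) (use j f in auto)
    show "integrable (m j) g" by (rule int[of _ _ B]) (use j gB g in \<open>auto simp: g_def\<close>)
    show "0 \<le> jump_prob j i t" using jump_prob_nonneg i j t by auto
  qed (auto simp: g_def)
  then have "(\<Sum>j\<in>{1..N} - {i}. jump_prob j i t * (\<integral>\<xi>. f \<xi> - K * t \<partial>m j)) \<le> (\<Sum>j\<in>{1..N} - {i}. jump_prob j i t * (\<integral>\<xi>. g \<xi> \<partial>m j))"
    by (rule sum_mono)
  ultimately show ?thesis by linarith
qed

lemma u_continuous: "i \<in> {1..N} \<Longrightarrow> continuous_on UNIV (u i)"
  using C1_differentiable_imp_continuous_on[OF C1] .

lemma test_function_speed: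
  assumes T: "test_function f h"
  obtains K where "0 \<le> K" "\<And>k \<xi>. k \<in> {1..N} \<Longrightarrow> \<bar>h \<xi> * u k \<xi>\<bar> \<le> K"
proof -
  obtain R where R: "\<And>z. R \<le> \<bar>z\<bar> \<Longrightarrow> h z = 0" and h: "continuous_on UNIV h"
    using T unfolding test_function_def by blast
  define W where "W = (\<Union>k\<in>{1..N}. (\<lambda>\<xi>. h \<xi> * u k \<xi>) ` {-R..R})"
  have "compact W" unfolding W_def
    by (intro compact_UN compact_continuous_image continuous_intros continuous_on_subset[OF h] continuous_on_subset[OF u_continuous]) auto
  then obtain K where K: "0 < K" "\<And>w. w \<in> W \<Longrightarrow> \<bar>w\<bar> \<le> K"
    using compact_imp_bounded[THEN bounded_pos[THEN iffD1]] by (metis real_norm_def)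
  have "\<bar>h \<xi> * u k \<xi>\<bar> \<le> K" if k: "k \<in> {1..N}" for k \<xi>
  proof (cases "\<xi> \<in> {-R..R}")
    case True
    then have "h \<xi> * u k \<xi> \<in> W" unfolding W_def using k by blast
    then show ?thesis by (rule K(2))
  next
    case False
    then have "h \<xi> = 0" by (intro R) auto
    then show ?thesis using K by simp
  qed
  with K show thesis by (intro that[of K]) auto
qed

lemma test_function_along_flow:
  assumes T: "test_function f h" and k: "k \<in> {1..N}" and K: "\<And>\<xi>. \<bar>h \<xi> * u k \<xi>\<bar> \<le> K" and s: "0 \<le> s"
  shows "\<bar>f (flow (u k) s \<xi>) - f \<xi>\<bar> \<le> K * s"
proof (cases "s = 0")
  case False
  have df: "(f has_real_derivative h z) (at z)" for z using T by (simp add: test_function_def)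
  have d: "((\<lambda>t. f (flow (u k) t \<xi>)) has_real_derivative h (flow (u k) t \<xi>) * u k (flow (u k) t \<xi>)) (at t)" if "0 < t" for t
    by (rule DERIV_chain2[OF df flow_deriv[OF fc[OF k] that]])
  have "continuous_on UNIV f" using df by (intro DERIV_continuous_on) (auto intro: has_field_derivative_at_within)
  then have "continuous_on {0..s} (\<lambda>t. f (flow (u k) t \<xi>))"
    by (rule continuous_on_compose2) (auto intro: continuous_on_subset[OF flow_continuous_on[OF fc[OF k]]])
  then obtain l z where z: "0 < z" "z < s" "DERIV (\<lambda>t. f (flow (u k) t \<xi>)) z :> l"
      "f (flow (u k) s \<xi>) - f (flow (u k) 0 \<xi>) = (s - 0) * l"
    using MVT[of 0 s "\<lambda>t. f (flow (u k) t \<xi>)"] d s False by (auto simp: real_differentiable_def)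
  have "l = h (flow (u k) z \<xi>) * u k (flow (u k) z \<xi>)" using DERIV_unique[OF z(3) d[OF z(1)]] .
  then have "\<bar>l\<bar> \<le> K" using K by simp
  then have "s * \<bar>l\<bar> \<le> s * K" using s by (rule mult_left_mono)
  then show ?thesis using z(4) s by (simp add: fc[OF k] abs_mult mult.commute)
qed (simp add: fc[OF k])

lemma test_function_flow_limit:
  assumes T: "test_function f h" and k: "k \<in> {1..N}"
  shows "((\<lambda>t. (f (flow (u k) t \<xi>) - f \<xi>) / t) \<longlongrightarrow> h \<xi> * u k \<xi>) (at_right 0)"
proof -
  have "((\<lambda>t. flow (u k) t \<xi>) has_real_derivative u k (flow (u k) 0 \<xi>)) (at 0 within {0..})"
    using solves_ivp_flow[OF fc[OF k], of \<xi>] unfolding solves_ivp_def by blast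
  moreover have "(f has_real_derivative h (flow (u k) 0 \<xi>)) (at (flow (u k) 0 \<xi>))"
    using T by (simp add: test_function_def)
  ultimately have "((\<lambda>t. f (flow (u k) t \<xi>)) has_real_derivative h (flow (u k) 0 \<xi>) * u k (flow (u k) 0 \<xi>)) (at 0 within {0..})"
    by (rule DERIV_chain2[rotated])
  then show ?thesis
    by (simp add: has_field_derivative_iff at_within_Ici_at_right fc[OF k])
qed

text \<open>
  The estimate \<open>slice_integral_ge\<close>, divided by \<open>t\<close>, in the limit \<open>t \<rightarrow> 0\<close>. Difference quotients of \<open>f\<close> along the
  flow are bounded by \<open>K\<close>, so dominated convergence applies to the transport term.
\<close>

lemma generator_inequality:
  assumes T: "test_function f h" and i: "i \<in> {1..N}" and f0: "\<And>x. 0 \<le> f x"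
  shows "(\<Sum>j\<in>{1..N} - {i}. lam j i * (\<integral>\<xi>. f \<xi> \<partial>m j)) \<le> rate i * (\<integral>\<xi>. f \<xi> \<partial>m i) - (\<integral>\<xi>. h \<xi> * u i \<xi> \<partial>m i)"
proof -
  obtain B where B: "\<And>x. \<bar>f x\<bar> \<le> B" using T by (auto simp: test_function_def)
  obtain K where K: "0 \<le> K" "\<And>k \<xi>. k \<in> {1..N} \<Longrightarrow> \<bar>h \<xi> * u k \<xi>\<bar> \<le> K"
    using test_function_speed[OF T] by blast
  have lip: "\<bar>f (flow (u k) s \<xi>) - f \<xi>\<bar> \<le> K * s" if "k \<in> {1..N}" "0 \<le> s" for k s \<xi>
    using test_function_along_flow[OF T that(1) K(2)[OF that(1)] that(2)] .
  note fm = test_function_measurable(1)[OF T]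
  define t where "t n = 1 / real (Suc n)" for n
  have t_pos: "0 < t n" for n by (simp add: t_def)
  have "filterlim t (nhds 0) sequentially" unfolding t_def by (rule LIMSEQ_Suc[OF lim_1_over_n])
  then have t_lim: "filterlim t (at_right 0) sequentially"
    using t_pos by (simp add: filterlim_at order_less_imp_not_eq2)
  have fi: "integrable (m j) f" if "j \<in> {1..N}" for j using integrable_slice[OF that fm B] .
  have fl: "(\<lambda>x. f (flow (u i) s x)) \<in> borel_measurable borel" for s
    by (rule measurable_compose[OF measurable_flow_at[OF i] fm])
  have fli: "integrable (m i) (\<lambda>x. f (flow (u i) s x))" for s by (rule integrable_slice[OF i fl B])
  have step: "(\<Sum>j\<in>{1..N} - {i}. jump_prob j i (t n) / t n * (\<integral>\<xi>. f \<xi> - K * t n \<partial>m j))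
      \<le> (1 - exp (- rate i * t n)) / t n * (\<integral>\<xi>. f \<xi> \<partial>m i)
        - exp (- rate i * t n) * (\<integral>\<xi>. (f (flow (u i) (t n) \<xi>) - f \<xi>) / t n \<partial>m i)" for n
  proof -
    have "exp (- rate i * t n) * (\<integral>\<xi>. f (flow (u i) (t n) \<xi>) \<partial>m i)
      + (\<Sum>j\<in>{1..N} - {i}. jump_prob j i (t n) * (\<integral>\<xi>. f \<xi> - K * t n \<partial>m j)) \<le> (\<integral>\<xi>. f \<xi> \<partial>m i)"
      using slice_integral_ge[OF i _ fm f0 _ K(1) lip, of "t n" B] t_pos[of n] B by (auto simp: abs_le_iff less_imp_le)
    then have le: "(\<Sum>j\<in>{1..N} - {i}. jump_prob j i (t n) * (\<integral>\<xi>. f \<xi> - K * t n \<partial>m j)) / t n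
        \<le> ((\<integral>\<xi>. f \<xi> \<partial>m i) - exp (- rate i * t n) * (\<integral>\<xi>. f (flow (u i) (t n) \<xi>) \<partial>m i)) / t n"
      using t_pos[of n] by (intro divide_right_mono) auto
    have I: "(\<integral>\<xi>. (f (flow (u i) (t n) \<xi>) - f \<xi>) / t n \<partial>m i)
        = ((\<integral>\<xi>. f (flow (u i) (t n) \<xi>) \<partial>m i) - (\<integral>\<xi>. f \<xi> \<partial>m i)) / t n"
      using fi[OF i] fli by simp
    show ?thesis
      unfolding I using le by (simp add: sum_divide_distrib diff_divide_distrib algebra_simps)
  qed
  have flow_lim: "(\<lambda>n. \<integral>\<xi>. (f (flow (u i) (t n) \<xi>) - f \<xi>) / t n \<partial>m i) \<longlonglongrightarrow> (\<integral>\<xi>. h \<xi> * u i \<xi> \<partial>m i)"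
  proof (rule integral_dominated_convergence[where w = "\<lambda>_. K"])
    show "(\<lambda>\<xi>. h \<xi> * u i \<xi>) \<in> borel_measurable (m i)"
      unfolding measurable_slice_iff
      using test_function_measurable(2)[OF T] borel_measurable_continuous_onI[OF u_continuous[OF i]] by measurable
    show "(\<lambda>\<xi>. (f (flow (u i) (t n) \<xi>) - f \<xi>) / t n) \<in> borel_measurable (m i)" for n
      unfolding measurable_slice_iff using fl fm by measurable
    show "integrable (m i) (\<lambda>_. K)" using finite_slice[OF i] by (simp add: finite_measure.integrable_const)
    show "AE \<xi> in m i. (\<lambda>n. (f (flow (u i) (t n) \<xi>) - f \<xi>) / t n) \<longlonglongrightarrow> h \<xi> * u i \<xi>"
      using filterlim_compose[OF test_function_flow_limit[OF T i] t_lim] by simp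
    show "AE \<xi> in m i. norm ((f (flow (u i) (t n) \<xi>) - f \<xi>) / t n) \<le> K" for n
      using lip[OF i, of "t n"] t_pos[of n] by (simp add: divide_le_eq less_imp_le)
  qed
  have exp_lim: "(\<lambda>n. (1 - exp (- c * t n)) / t n) \<longlonglongrightarrow> c" for c
  proof -
    have "((\<lambda>s. (1 - exp (- c * s)) / s) \<longlongrightarrow> c) (at_right 0)" by real_asymp
    then show ?thesis by (rule filterlim_compose[OF _ t_lim])
  qed
  have t0: "t \<longlonglongrightarrow> 0" using t_lim by (simp add: filterlim_at)
  have p_lim: "(\<lambda>n. jump_prob j i (t n) / t n) \<longlonglongrightarrow> lam j i" if "j \<in> {1..N} - {i}" for j
  proof -
    have "(\<lambda>n. (1 - exp (- rate j * t n)) / t n * (lam j i / rate j) * exp (- rate i * t n))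
        \<longlonglongrightarrow> rate j * (lam j i / rate j) * exp (- rate i * 0)"
      by (intro tendsto_intros exp_lim t0)
    then show ?thesis using total_rate_pos[of j] that by (simp add: jump_prob_def mult.commute[of "t _"])
  qed
  have m_lim: "(\<lambda>n. \<integral>\<xi>. f \<xi> - K * t n \<partial>m j) \<longlonglongrightarrow> (\<integral>\<xi>. f \<xi> \<partial>m j)" if "j \<in> {1..N}" for j
  proof -
    have "(\<integral>\<xi>. f \<xi> - K * t n \<partial>m j) = (\<integral>\<xi>. f \<xi> \<partial>m j) - K * t n * measure (m j) UNIV" for n
      using fi[OF that] finite_slice[OF that] by (simp add: finite_measure.integrable_const)
    moreover have "(\<lambda>n. (\<integral>\<xi>. f \<xi> \<partial>m j) - K * t n * measure (m j) UNIV) \<longlonglongrightarrow> (\<integral>\<xi>. f \<xi> \<partial>m j) - K * 0 * measure (m j) UNIV"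
      by (intro tendsto_intros t0)
    ultimately show ?thesis by simp
  qed
  have "(\<lambda>n. \<Sum>j\<in>{1..N} - {i}. jump_prob j i (t n) / t n * (\<integral>\<xi>. f \<xi> - K * t n \<partial>m j))
      \<longlonglongrightarrow> (\<Sum>j\<in>{1..N} - {i}. lam j i * (\<integral>\<xi>. f \<xi> \<partial>m j))"
    by (intro tendsto_sum tendsto_mult p_lim m_lim) auto
  moreover have "(\<lambda>n. (1 - exp (- rate i * t n)) / t n * (\<integral>\<xi>. f \<xi> \<partial>m i)
        - exp (- rate i * t n) * (\<integral>\<xi>. (f (flow (u i) (t n) \<xi>) - f \<xi>) / t n \<partial>m i))
      \<longlonglongrightarrow> rate i * (\<integral>\<xi>. f \<xi> \<partial>m i) - exp (- rate i * 0) * (\<integral>\<xi>. h \<xi> * u i \<xi> \<partial>m i)"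
    by (intro tendsto_intros exp_lim t0 flow_lim)
  ultimately have "(\<Sum>j\<in>{1..N} - {i}. lam j i * (\<integral>\<xi>. f \<xi> \<partial>m j))
      \<le> rate i * (\<integral>\<xi>. f \<xi> \<partial>m i) - exp (- rate i * 0) * (\<integral>\<xi>. h \<xi> * u i \<xi> \<partial>m i)"
    by (rule LIMSEQ_le) (use step in blast)
  then show ?thesis by simp
qed

text \<open>What state \<open>j\<close> loses by switching is what the other states gain from it.\<close>

lemma sum_rates:
  "(\<Sum>i\<in>{1..N}. rate i * c i - (\<Sum>j\<in>{1..N} - {i}. lam j i * c j)) = 0"
proof -
  have "(\<Sum>i\<in>{1..N}. \<Sum>j\<in>{1..N} - {i}. lam j i * c j) = (\<Sum>i\<in>{1..N}. \<Sum>j\<in>{1..N}. if j \<noteq> i then lam j i * c j else 0)"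
    by (intro sum.cong sum.mono_neutral_cong_left refl) auto
  also have "\<dots> = (\<Sum>j\<in>{1..N}. \<Sum>i\<in>{1..N}. if j \<noteq> i then lam j i * c j else 0)" by (rule sum.swap)
  also have "\<dots> = (\<Sum>j\<in>{1..N}. \<Sum>i\<in>{1..N} - {j}. lam j i * c j)"
    by (intro sum.cong sum.mono_neutral_cong_right refl) auto
  also have "\<dots> = (\<Sum>j\<in>{1..N}. rate j * c j)"
    by (simp add: total_rate_def sum_distrib_right)
  finally show ?thesis by (simp add: sum_subtractf)
qed

lemma test_function_const: "test_function (\<lambda>_. c) (\<lambda>_. 0)"
  unfolding test_function_def by (auto intro!: exI[of _ "\<bar>c\<bar>"])

text \<open>
  The inequalities for the test function \<open>1\<close> sum to zero over the states, so none of them is strict.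
\<close>

lemma rate_balance:
  assumes i: "i \<in> {1..N}"
  shows "rate i * measure (m i) UNIV = (\<Sum>j\<in>{1..N} - {i}. lam j i * measure (m j) UNIV)"
proof -
  define D where "D i = rate i * measure (m i) UNIV - (\<Sum>j\<in>{1..N} - {i}. lam j i * measure (m j) UNIV)" for i
  have "0 \<le> D k" if "k \<in> {1..N}" for k
    using generator_inequality[OF test_function_const[of 1] that] by (simp add: D_def)
  moreover have "(\<Sum>k\<in>{1..N}. D k) = 0" unfolding D_def by (rule sum_rates)
  ultimately have "D i = 0" using i by (subst (asm) sum_nonneg_eq_0_iff) auto
  then show ?thesis by (simp add: D_def)
qed

text \<open>
  The generator inequality holds for the nonnegative functions \<open>B + f\<close> and \<open>B - f\<close>, and the constant
  \<open>B\<close> contributes nothing by \<open>rate_balance\<close>. The two inequalities are opposite.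
\<close>

lemma stationary_equation:
  assumes T: "test_function f h" and i: "i \<in> {1..N}"
  shows "(\<integral>\<xi>. h \<xi> * u i \<xi> \<partial>m i) = rate i * (\<integral>\<xi>. f \<xi> \<partial>m i) - (\<Sum>j\<in>{1..N} - {i}. lam j i * (\<integral>\<xi>. f \<xi> \<partial>m j))"
proof -
  obtain B where B: "\<And>x. \<bar>f x\<bar> \<le> B" using T by (auto simp: test_function_def)
  have fi: "integrable (m j) f" if "j \<in> {1..N}" for j
    by (rule integrable_slice[OF that test_function_measurable(1)[OF T] B])
  have c: "(\<integral>\<xi>. B + \<sigma> * f \<xi> \<partial>m j) = B * measure (m j) UNIV + \<sigma> * (\<integral>\<xi>. f \<xi> \<partial>m j)" if "j \<in> {1..N}" for j \<sigma>
    using fi[OF that] finite_slice[OF that] by (simp add: finite_measure.integrable_const)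
  have bal: "(\<Sum>j\<in>{1..N} - {i}. lam j i * (B * measure (m j) UNIV)) = rate i * (B * measure (m i) UNIV)"
    using arg_cong[OF rate_balance[OF i], of "\<lambda>x. B * x"] by (simp add: sum_distrib_left mult_ac)
  have ineq: "\<sigma> * (\<Sum>j\<in>{1..N} - {i}. lam j i * (\<integral>\<xi>. f \<xi> \<partial>m j)) \<le> \<sigma> * (rate i * (\<integral>\<xi>. f \<xi> \<partial>m i)) - \<sigma> * (\<integral>\<xi>. h \<xi> * u i \<xi> \<partial>m i)"
    if "\<bar>\<sigma>\<bar> = 1" for \<sigma>
  proof -
    have T': "test_function (\<lambda>\<xi>. B + \<sigma> * f \<xi>) (\<lambda>\<xi>. \<sigma> * h \<xi>)"
    proof -
      have "\<bar>B + \<sigma> * f z\<bar> \<le> \<bar>B\<bar> + B" for z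
        using B[of z] that by (intro order_trans[OF abs_triangle_ineq]) (simp add: abs_mult)
      moreover have "((\<lambda>\<xi>. B + \<sigma> * f \<xi>) has_real_derivative \<sigma> * h z) (at z)" for z
        using T by (auto intro!: derivative_eq_intros simp: test_function_def)
      ultimately show ?thesis
        using T unfolding test_function_def by (auto intro!: continuous_intros)
    qed
    have "0 \<le> B + \<sigma> * f z" for z
      using B[of z] that by (cases "\<sigma> = 1") (auto simp: abs_if split: if_splits)
    from generator_inequality[OF T' i this]
    have "(\<Sum>j\<in>{1..N} - {i}. lam j i * (\<integral>\<xi>. B + \<sigma> * f \<xi> \<partial>m j))
        \<le> rate i * (\<integral>\<xi>. B + \<sigma> * f \<xi> \<partial>m i) - (\<integral>\<xi>. \<sigma> * (h \<xi> * u i \<xi>) \<partial>m i)"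
      by (simp add: mult.assoc)
    also have "(\<Sum>j\<in>{1..N} - {i}. lam j i * (\<integral>\<xi>. B + \<sigma> * f \<xi> \<partial>m j))
        = (\<Sum>j\<in>{1..N} - {i}. lam j i * (B * measure (m j) UNIV)) + \<sigma> * (\<Sum>j\<in>{1..N} - {i}. lam j i * (\<integral>\<xi>. f \<xi> \<partial>m j))"
      unfolding sum_distrib_left sum.distrib[symmetric]
      by (intro sum.cong refl) (simp add: c distrib_left mult_ac)
    also have "rate i * (\<integral>\<xi>. B + \<sigma> * f \<xi> \<partial>m i) = rate i * (B * measure (m i) UNIV) + \<sigma> * (rate i * (\<integral>\<xi>. f \<xi> \<partial>m i))"
      by (simp only: c[OF i] distrib_left mult_ac)
    finally show ?thesis using bal by simp
  qed
  show ?thesis using ineq[of 1] ineq[of "-1"] by simp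
qed

end

section \<open>Smoothed step functions\<close>

text \<open>
  A continuously differentiable step from \<open>0\<close> at \<open>- 1\<close> to \<open>1\<close> at \<open>1\<close>: half the second difference of
  the squared positive part.
\<close>

definition smooth_step :: "real \<Rightarrow> real" where
  "smooth_step y = ((max 0 (y + 1))\<^sup>2 - 2 * (max 0 y)\<^sup>2 + (max 0 (y - 1))\<^sup>2) / 2"

definition tent :: "real \<Rightarrow> real" where
  "tent y = max 0 (y + 1) - 2 * max 0 y + max 0 (y - 1)"

lemma DERIV_pos_part_square:
  "((\<lambda>y. (max 0 (y + c))\<^sup>2) has_real_derivative 2 * max 0 (y + c)) (at (y::real))"
proof -
  have "((\<lambda>z. (max 0 z)\<^sup>2) has_real_derivative 2 * max 0 z) (at z)" for z :: real
  proof (cases "z = 0")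
    case True
    have "((\<lambda>h. ((max 0 (0 + h))\<^sup>2 - (max 0 (0::real))\<^sup>2) / h) \<longlongrightarrow> 0) (at 0)"
    proof (rule Lim_null_comparison)
      show "\<forall>\<^sub>F h in at (0::real). norm (((max 0 (0 + h))\<^sup>2 - (max 0 (0::real))\<^sup>2) / h) \<le> \<bar>h\<bar>"
        by (intro always_eventually) (auto simp: max_def power2_eq_square)
      show "((\<lambda>h::real. \<bar>h\<bar>) \<longlongrightarrow> 0) (at 0)" by (auto intro!: tendsto_eq_intros)
    qed
    then show ?thesis using True by (simp add: DERIV_def)
  next
    case False
    show ?thesis
    proof (cases "0 < z")
      case True
      have "((\<lambda>z. z\<^sup>2) has_real_derivative 2 * z) (at z)" by (auto intro!: derivative_eq_intros)
      then have "((\<lambda>z. (max 0 z)\<^sup>2) has_real_derivative 2 * z) (at z)"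
        by (rule has_field_derivative_transform_within_open[of _ _ _ "{0<..}"]) (use True in auto)
      then show ?thesis using True by simp
    next
      case F: False
      have "((\<lambda>z. (max 0 z)\<^sup>2) has_real_derivative 0) (at z)"
        by (rule has_field_derivative_transform_within_open[of "\<lambda>_. 0" _ _ "{..<0}"]) (use False F in auto)
      then show ?thesis using F by simp
    qed
  qed
  then have "((\<lambda>z. (max 0 z)\<^sup>2) has_real_derivative 2 * max 0 (y + c)) (at (y + c))" .
  moreover have "((\<lambda>y. y + c) has_real_derivative 1) (at y)" by (auto intro!: derivative_eq_intros)
  ultimately have "((\<lambda>y. (max 0 (y + c))\<^sup>2) has_real_derivative 2 * max 0 (y + c) * 1) (at y)"
    by (rule DERIV_chain2)
  then show ?thesis by simp
qed

lemma DERIV_smooth_step: "(smooth_step has_real_derivative tent y) (at y)"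
proof -
  have "((\<lambda>y. ((max 0 (y + 1))\<^sup>2 - 2 * (max 0 (y + 0))\<^sup>2 + (max 0 (y + - 1))\<^sup>2) / 2) has_real_derivative
      (2 * max 0 (y + 1) - 2 * (2 * max 0 (y + 0)) + 2 * max 0 (y + - 1)) / 2) (at y)"
    by (intro DERIV_cdivide DERIV_add DERIV_diff DERIV_cmult DERIV_pos_part_square)
  moreover have "(\<lambda>y. ((max 0 (y + 1))\<^sup>2 - 2 * (max 0 (y + 0))\<^sup>2 + (max 0 (y + - 1))\<^sup>2) / 2) = smooth_step"
    by (simp add: fun_eq_iff smooth_step_def)
  moreover have "(2 * max 0 (y + 1) - 2 * (2 * max 0 (y + 0)) + 2 * max 0 (y + - 1)) / 2 = tent y"
    by (simp add: tent_def)
  ultimately show ?thesis by simp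
qed

lemma continuous_on_tent: "continuous_on S tent"
  unfolding tent_def[abs_def] by (intro continuous_intros)

lemma tent_eq_0: "1 \<le> \<bar>y\<bar> \<Longrightarrow> tent y = 0" and tent_nonneg: "0 \<le> tent y"
  by (auto simp: tent_def max_def)

lemma smooth_step_left: "y \<le> - 1 \<Longrightarrow> smooth_step y = 0" and smooth_step_right: "1 \<le> y \<Longrightarrow> smooth_step y = 1"
  by (auto simp: smooth_step_def max_def power2_eq_square algebra_simps)

lemma smooth_step_mono: "x \<le> y \<Longrightarrow> smooth_step x \<le> smooth_step y"
  by (rule DERIV_nonneg_imp_nondecreasing) (use DERIV_smooth_step tent_nonneg in auto)

lemma smooth_step_bounds: "0 \<le> smooth_step y" "smooth_step y \<le> 1"
  using smooth_step_mono[of y "max 1 y"] smooth_step_mono[of "min (- 1) y" y]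
    smooth_step_left[of "min (- 1) y"] smooth_step_right[of "max 1 y"] by auto

lemma test_function_smooth_step:
  assumes "0 < c"
  shows "test_function (\<lambda>z. smooth_step ((z - x) / c)) (\<lambda>z. tent ((z - x) / c) / c)"
  unfolding test_function_def
proof (intro conjI allI exI impI)
  fix z
  show "((\<lambda>z. smooth_step ((z - x) / c)) has_real_derivative tent ((z - x) / c) / c) (at z)"
  proof -
    have "((\<lambda>z. (z - x) / c) has_real_derivative 1 / c) (at z)"
      using assms by (auto intro!: derivative_eq_intros)
    from DERIV_chain2[OF DERIV_smooth_step this] show ?thesis by simp
  qed
  show "continuous_on UNIV (\<lambda>z. tent ((z - x) / c) / c)"
    by (intro continuous_intros continuous_on_compose2[OF continuous_on_tent[of UNIV]]) (use assms in auto)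
  show "\<bar>smooth_step ((z - x) / c)\<bar> \<le> 1" using smooth_step_bounds by (simp add: abs_of_nonneg)
  assume "\<bar>x\<bar> + c \<le> \<bar>z\<bar>"
  then have "c \<le> \<bar>z - x\<bar>" by linarith
  then have "1 \<le> \<bar>(z - x) / c\<bar>" using assms by (simp add: abs_divide)
  then show "tent ((z - x) / c) / c = 0" by (simp add: tent_eq_0)
qed

lemma integral_tent: "(\<integral>y. tent y \<partial>lborel) = 1" and integrable_tent: "integrable lborel tent"
proof -
  have "has_bochner_integral lborel (\<lambda>y. tent y * indicator {-1..1} y) (smooth_step 1 - smooth_step (- 1))"
    by (rule has_bochner_integral_FTC_Icc_nonneg)
      (auto intro!: borel_measurable_continuous_onI continuous_on_tent DERIV_smooth_step tent_nonneg)
  moreover have "(\<lambda>y. tent y * indicator {-1..1} y) = tent"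
    using tent_eq_0 by (auto simp: indicator_def fun_eq_iff not_le intro!: tent_eq_0)
  ultimately have "has_bochner_integral lborel tent 1" by (simp add: smooth_step_left smooth_step_right)
  then show "(\<integral>y. tent y \<partial>lborel) = 1" "integrable lborel tent"
    by (auto simp: has_bochner_integral_iff)
qed

text \<open>
  The width \<open>r / (n + 2)\<close> is at most half of \<open>r\<close>, so the tents live on a compact interval inside the
  domain of continuity, where \<open>w\<close> is bounded.
\<close>

lemma tent_mollifier:
  fixes w :: "real \<Rightarrow> real"
  assumes w: "w \<in> borel_measurable borel" and r: "0 < r" and cont: "continuous_on {x - r<..<x + r} w"
  shows "(\<lambda>n. \<integral>z. tent ((z - x) / (r / real (n + 2))) / (r / real (n + 2)) * w z \<partial>lborel) \<longlonglongrightarrow> w x"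
proof -
  define c where "c n = r / real (n + 2)" for n
  have c: "0 < c n" "c n \<le> r / 2" for n
    using r by (simp_all add: c_def field_simps)
  have c0: "c \<longlonglongrightarrow> 0"
    unfolding c_def by (rule LIMSEQ_ignore_initial_segment[of "\<lambda>n. r / real n" 0 2]) (rule lim_const_over_n)
  have "compact (w ` {x - r / 2..x + r / 2})"
    by (intro compact_continuous_image continuous_on_subset[OF cont]) (use r in auto)
  then obtain M where M: "0 < M" "\<And>z. z \<in> {x - r / 2..x + r / 2} \<Longrightarrow> \<bar>w z\<bar> \<le> M"
    using compact_imp_bounded[THEN bounded_pos[THEN iffD1]] by (metis imageI real_norm_def)
  have wx: "isCont w x" using cont r by (auto simp: continuous_on_eq_continuous_at)
  have tm: "tent \<in> borel_measurable borel" by (rule borel_measurable_continuous_onI[OF continuous_on_tent])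
  have "(\<lambda>n. \<integral>y. tent y * w (x + c n * y) \<partial>lborel) \<longlonglongrightarrow> (\<integral>y. tent y * w x \<partial>lborel)"
  proof (rule integral_dominated_convergence[where w = "\<lambda>y. M * tent y"])
    show "(\<lambda>y. tent y * w x) \<in> borel_measurable lborel" using tm by simp
    show "(\<lambda>y. tent y * w (x + c n * y)) \<in> borel_measurable lborel" for n
      using tm w by measurable
    show "integrable lborel (\<lambda>y. M * tent y)" using integrable_tent by simp
    show "AE y in lborel. (\<lambda>n. tent y * w (x + c n * y)) \<longlonglongrightarrow> tent y * w x"
    proof (intro AE_I2 tendsto_intros isCont_tendsto_compose[OF wx])
      fix y show "(\<lambda>n. x + c n * y) \<longlonglongrightarrow> x" by (rule tendsto_eq_intros c0 refl)+ simp
    qed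
    show "AE y in lborel. norm (tent y * w (x + c n * y)) \<le> M * tent y" for n
    proof (intro AE_I2)
      fix y show "norm (tent y * w (x + c n * y)) \<le> M * tent y"
      proof (cases "\<bar>y\<bar> \<le> 1")
        case True
        then have "\<bar>c n * y\<bar> \<le> r / 2 * 1" unfolding abs_mult using c[of n] r by (intro mult_mono) auto
        then have "\<bar>w (x + c n * y)\<bar> \<le> M" by (intro M(2)) (auto simp: abs_le_iff)
        then have "tent y * \<bar>w (x + c n * y)\<bar> \<le> tent y * M" by (intro mult_left_mono tent_nonneg)
        then show ?thesis using tent_nonneg[of y] by (simp add: abs_mult mult.commute)
      qed (simp add: tent_eq_0)
    qed
  qed
  moreover have "(\<integral>z. tent ((z - x) / c n) / c n * w z \<partial>lborel) = (\<integral>y. tent y * w (x + c n * y) \<partial>lborel)" for n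
  proof -
    have "(\<integral>z. tent ((z - x) / c n) / c n * w z \<partial>lborel) = c n * (\<integral>y. tent ((x + c n * y - x) / c n) / c n * w (x + c n * y) \<partial>lborel)"
      using c(1)[of n] by (subst lborel_integral_real_affine[of "c n" _ x]) auto
    also have "(\<lambda>y. tent ((x + c n * y - x) / c n) / c n * w (x + c n * y)) = (\<lambda>y. 1 / c n * (tent y * w (x + c n * y)))"
      using c(1)[of n] by auto
    also have "c n * (\<integral>y. 1 / c n * (tent y * w (x + c n * y)) \<partial>lborel) = (\<integral>y. tent y * w (x + c n * y) \<partial>lborel)"
      unfolding integral_mult_right_zero using c(1)[of n] by simp
    finally show ?thesis .
  qed
  ultimately show ?thesis by (simp add: c_def integral_tent)
qed

section \<open>The forward equation for the densities\<close>

locale stationary_density = stationary_switching +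
  fixes \<rho> :: "nat \<Rightarrow> real \<Rightarrow> real"
  assumes dens: "density_representatives N \<mu> \<rho>"
begin

lemma rho_measurable: "i \<in> {1..N} \<Longrightarrow> \<rho> i \<in> borel_measurable borel"
  and rho_AE_nonneg: "i \<in> {1..N} \<Longrightarrow> AE x in lborel. 0 \<le> \<rho> i x"
  and slice_density: "i \<in> {1..N} \<Longrightarrow> m i = density lborel (\<lambda>x. ennreal (\<rho> i x))"
  using dens by (auto simp: density_representatives_def)

lemma slice_singleton:
  assumes i: "i \<in> {1..N}"
  shows "AE z in m i. z \<noteq> x"
  unfolding slice_density[OF i] using AE_lborel_singleton[of x] rho_measurable[OF i]
  by (subst AE_density) (auto elim: eventually_mono)

lemma rho_nonneg:
  assumes i: "i \<in> {1..N}" and cont: "continuous_on {p<..<q} (\<rho> i)" and x: "p < x" "x < q"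
  shows "0 \<le> \<rho> i x"
proof (rule ccontr)
  assume neg: "\<not> 0 \<le> \<rho> i x"
  define U where "U = {p<..<q} \<inter> \<rho> i -` {..<0}"
  have U: "open U" unfolding U_def by (rule continuous_open_preimage[OF cont]) auto
  have "AE x in lborel. x \<notin> U"
    using rho_AE_nonneg[OF i] by eventually_elim (auto simp: U_def)
  then have "U \<in> null_sets lborel" using U by (subst AE_iff_null_sets) auto
  then have "negligible U" by (simp add: negligible_iff_null_sets null_sets_completionI)
  moreover have "x \<in> U" using x neg by (auto simp: U_def)
  ultimately show False using open_not_negligible[OF U] by blast
qed

definition mass_above :: "nat \<Rightarrow> real \<Rightarrow> real" where
  "mass_above i x = measure (m i) {x<..}"

text \<open>
  The weak equation for steps at \<open>x\<close> of shrinking width: the steps converge to the indicator of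
  \<open>{x<..}\<close> off a single point, which carries no mass, while their derivatives concentrate at \<open>x\<close>.
\<close>

lemma flux_eq_mass_above:
  assumes i: "i \<in> {1..N}" and cont: "continuous_on {p<..<q} (\<rho> i)" and x: "p < x" "x < q"
  shows "u i x * \<rho> i x = rate i * mass_above i x - (\<Sum>j\<in>{1..N} - {i}. lam j i * mass_above j x)"
proof -
  define r where "r = min (x - p) (q - x)"
  have r: "0 < r" using x by (simp add: r_def)
  define c where "c n = r / real (n + 2)" for n
  have c: "0 < c n" for n using r by (simp add: c_def)
  have c0: "c \<longlonglongrightarrow> 0"
    unfolding c_def by (rule LIMSEQ_ignore_initial_segment[of "\<lambda>n. r / real n" 0 2]) (rule lim_const_over_n)
  have um: "u i \<in> borel_measurable borel" by (rule borel_measurable_continuous_onI[OF u_continuous[OF i]])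
  note rm = rho_measurable[OF i]
  have T: "test_function (\<lambda>z. smooth_step ((z - x) / c n)) (\<lambda>z. tent ((z - x) / c n) / c n)" for n
    by (rule test_function_smooth_step[OF c])
  have lhs: "(\<lambda>n. \<integral>z. tent ((z - x) / c n) / c n * u i z \<partial>m i) \<longlonglongrightarrow> u i x * \<rho> i x"
  proof -
    have "(\<integral>z. tent ((z - x) / c n) / c n * u i z \<partial>m i)
        = (\<integral>z. tent ((z - x) / c n) / c n * (u i z * \<rho> i z) \<partial>lborel)" for n
    proof -
      have "(\<lambda>z. tent ((z - x) / c n) / c n * u i z) \<in> borel_measurable borel"
        using test_function_measurable(2)[OF T] um by (rule borel_measurable_times)
      then show ?thesis
        unfolding slice_density[OF i] using rm rho_AE_nonneg[OF i]
        by (subst integral_density) (auto simp: mult_ac)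
    qed
    moreover have "(\<lambda>n. \<integral>z. tent ((z - x) / c n) / c n * (u i z * \<rho> i z) \<partial>lborel) \<longlonglongrightarrow> u i x * \<rho> i x"
      unfolding c_def
      by (rule tent_mollifier[where w = "\<lambda>z. u i z * \<rho> i z", OF _ r])
        (use um rm in \<open>auto intro!: continuous_intros continuous_on_subset[OF cont] continuous_on_subset[OF u_continuous[OF i]] simp: r_def\<close>)
    ultimately show ?thesis by (simp only:)
  qed
  have rhs: "(\<lambda>n. \<integral>z. smooth_step ((z - x) / c n) \<partial>m j) \<longlonglongrightarrow> mass_above j x" if j: "j \<in> {1..N}" for j
  proof -
    have "(\<lambda>n. \<integral>z. smooth_step ((z - x) / c n) \<partial>m j) \<longlonglongrightarrow> (\<integral>z. indicator {x<..} z \<partial>m j)"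
    proof (rule integral_dominated_convergence[where w = "\<lambda>_. 1"])
      show "indicator {x<..} \<in> borel_measurable (m j)" by (simp add: measurable_slice_iff)
      show "(\<lambda>z. smooth_step ((z - x) / c n)) \<in> borel_measurable (m j)" for n
        using test_function_measurable(1)[OF T] by (simp add: measurable_slice_iff)
      show "integrable (m j) (\<lambda>_. 1::real)" using finite_slice[OF j] by (simp add: finite_measure.integrable_const)
      show "AE z in m j. norm (smooth_step ((z - x) / c n)) \<le> 1" for n
        using smooth_step_bounds by (simp add: abs_of_nonneg)
      show "AE z in m j. (\<lambda>n. smooth_step ((z - x) / c n)) \<longlonglongrightarrow> indicator {x<..} z"
        using slice_singleton[OF j, of x]
      proof eventually_elim
        fix z assume z: "z \<noteq> x"
        have "\<forall>\<^sub>F n in sequentially. c n < \<bar>z - x\<bar>" using c0 z by (intro order_tendstoD(2)) auto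
        then have "\<forall>\<^sub>F n in sequentially. smooth_step ((z - x) / c n) = indicator {x<..} z"
        proof eventually_elim
          case (elim n)
          show ?case
          proof (cases "x < z")
            case True
            then have "1 \<le> (z - x) / c n" using elim c[of n] by simp
            then show ?thesis using True by (simp add: smooth_step_right)
          next
            case False
            then have "(z - x) / c n \<le> - 1" using elim c[of n] by (simp add: divide_le_eq)
            then show ?thesis using False by (simp add: smooth_step_left)
          qed
        qed
        then show "(\<lambda>n. smooth_step ((z - x) / c n)) \<longlonglongrightarrow> indicator {x<..} z" by (rule tendsto_eventually)
      qed
    qed
    then show ?thesis by (simp add: mass_above_def)
  qed
  have "(\<lambda>n. rate i * (\<integral>z. smooth_step ((z - x) / c n) \<partial>m i)
      - (\<Sum>j\<in>{1..N} - {i}. lam j i * (\<integral>z. smooth_step ((z - x) / c n) \<partial>m j)))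
    \<longlonglongrightarrow> rate i * mass_above i x - (\<Sum>j\<in>{1..N} - {i}. lam j i * mass_above j x)"
    by (intro tendsto_intros rhs i) auto
  then have "(\<lambda>n. \<integral>z. tent ((z - x) / c n) / c n * u i z \<partial>m i)
    \<longlonglongrightarrow> rate i * mass_above i x - (\<Sum>j\<in>{1..N} - {i}. lam j i * mass_above j x)"
    unfolding stationary_equation[OF T i] .
  with lhs show ?thesis by (rule LIMSEQ_unique)
qed

lemma total_flux_zero:
  assumes "\<And>i. i \<in> {1..N} \<Longrightarrow> continuous_on {p<..<q} (\<rho> i)" and x: "p < x" "x < q"
  shows "(\<Sum>i\<in>{1..N}. u i x * \<rho> i x) = 0"
proof -
  have "(\<Sum>i\<in>{1..N}. u i x * \<rho> i x)
      = (\<Sum>i\<in>{1..N}. rate i * mass_above i x - (\<Sum>j\<in>{1..N} - {i}. lam j i * mass_above j x))"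
    by (intro sum.cong refl flux_eq_mass_above[OF _ assms(1) x])
  then show ?thesis using sum_rates by simp
qed

lemma mass_above_diff:
  assumes i: "i \<in> {1..N}" and "x \<le> y"
  shows "mass_above i x - mass_above i y = measure (m i) {x<..y}"
proof -
  have "measure (m i) ({x<..y} \<union> {y<..}) = measure (m i) {x<..y} + measure (m i) {y<..}"
    using finite_slice[OF i] by (intro finite_measure.finite_measure_Union) auto
  moreover have "{x<..y} \<union> {y<..} = {x<..}" using assms(2) by auto
  ultimately show ?thesis by (simp add: mass_above_def)
qed

lemma DERIV_mass_above:
  assumes i: "i \<in> {1..N}" and cont: "continuous_on {p<..<q} (\<rho> i)" and x: "p < x" "x < q"
  shows "(mass_above i has_real_derivative - \<rho> i x) (at x)"
proof -
  define p' q' where "p' = (p + x) / 2" and "q' = (x + q) / 2"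
  have pq: "p < p'" "p' < x" "x < q'" "q' < q" using x by (auto simp: p'_def q'_def)
  have eq: "mass_above i y = mass_above i p' - (LBINT z=ereal p'..ereal y. \<rho> i z)" if y: "p' \<le> y" "y < q" for y
  proof -
    have cont': "continuous_on {p'..y} (\<rho> i)" using pq y by (intro continuous_on_subset[OF cont]) auto
    have nn: "0 \<le> \<rho> i z" if "z \<in> {p'..y}" for z using rho_nonneg[OF i cont, of z] that pq y by auto
    have "measure (m i) {p'<..y} = (LINT z:{p'<..y}|lborel. \<rho> i z)"
    proof -
      have int: "set_integrable lborel {p'<..y} (\<rho> i)"
        by (rule set_integrable_subset[OF borel_integrable_atLeastAtMost'[OF cont']]) auto
      have "emeasure (m i) {p'<..y} = (\<integral>\<^sup>+ z. ennreal (indicator {p'<..y} z * \<rho> i z) \<partial>lborel)"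
        unfolding slice_density[OF i] using rho_measurable[OF i]
        by (subst emeasure_density) (auto intro!: nn_integral_cong simp: indicator_def)
      also have "\<dots> = ennreal (LINT z:{p'<..y}|lborel. \<rho> i z)"
        unfolding set_lebesgue_integral_def real_scaleR_def
        using int nn by (intro nn_integral_eq_integral) (auto simp: set_integrable_def indicator_def)
      finally show ?thesis
        using nn by (simp add: measure_def set_lebesgue_integral_def indicator_def integral_nonneg)
    qed
    also have "\<dots> = (LBINT z=ereal p'..ereal y. \<rho> i z)"
      using y by (simp add: interval_integral_Ioc)
    finally show ?thesis using mass_above_diff[OF i y(1)] by simp
  qed
  have "((\<lambda>y. LBINT z=ereal p'..ereal y. \<rho> i z) has_vector_derivative \<rho> i x) (at x within {p'..q'})"
    using pq by (intro interval_integral_FTC2 continuous_on_subset[OF cont]) auto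
  moreover have "at x within {p'..q'} = at x" using pq by (intro at_within_interior) auto
  ultimately have "((\<lambda>y. LBINT z=ereal p'..ereal y. \<rho> i z) has_real_derivative \<rho> i x) (at x)"
    by (simp add: has_real_derivative_iff_has_vector_derivative)
  then have "((\<lambda>y. mass_above i p' - (LBINT z=ereal p'..ereal y. \<rho> i z)) has_real_derivative - \<rho> i x) (at x)"
    by (auto intro!: derivative_eq_intros)
  then show ?thesis
  proof (rule has_field_derivative_transform_within_open[of _ _ _ "{p'<..<q'}"])
    fix y assume "y \<in> {p'<..<q'}"
    then show "mass_above i p' - (LBINT z=ereal p'..ereal y. \<rho> i z) = mass_above i y"
      using pq by (intro eq[symmetric]) auto
  qed (use pq in auto)
qed

lemma DERIV_flux:
  assumes cont: "\<And>j. j \<in> {1..N} \<Longrightarrow> continuous_on {p<..<q} (\<rho> j)" and i: "i \<in> {1..N}" and x: "p < x" "x < q"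
  shows "((\<lambda>y. u i y * \<rho> i y) has_real_derivative (\<Sum>j\<in>{1..N} - {i}. lam j i * \<rho> j x) - rate i * \<rho> i x) (at x)"
proof -
  have "((\<lambda>y. rate i * mass_above i y - (\<Sum>j\<in>{1..N} - {i}. lam j i * mass_above j y)) has_real_derivative
      rate i * - \<rho> i x - (\<Sum>j\<in>{1..N} - {i}. lam j i * - \<rho> j x)) (at x)"
    by (intro DERIV_diff DERIV_sum DERIV_cmult DERIV_mass_above[OF _ cont x] i) auto
  then have "((\<lambda>y. u i y * \<rho> i y) has_real_derivative
      rate i * - \<rho> i x - (\<Sum>j\<in>{1..N} - {i}. lam j i * - \<rho> j x)) (at x)"
    by (rule has_field_derivative_transform_within_open[of _ _ _ "{p<..<q}"])
      (use x flux_eq_mass_above[OF i cont[OF i]] in auto)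
  then show ?thesis by (simp add: sum_negf)
qed

end

section \<open>Points charged by the invariant measure\<close>

lemma test_function_diff:
  assumes "test_function f h" "test_function f' h'"
  shows "test_function (\<lambda>z. f z - f' z) (\<lambda>z. h z - h' z)"
proof -
  obtain R R' B B' where R: "\<And>z. R \<le> \<bar>z\<bar> \<Longrightarrow> h z = 0" "\<And>z. R' \<le> \<bar>z\<bar> \<Longrightarrow> h' z = 0"
    and B: "\<And>z. \<bar>f z\<bar> \<le> B" "\<And>z. \<bar>f' z\<bar> \<le> B'"
    using assms unfolding test_function_def by blast
  have "h z - h' z = 0" if "max R R' \<le> \<bar>z\<bar>" for z using R that by simp
  moreover have "\<bar>f z - f' z\<bar> \<le> B + B'" for z using B[of z] by linarith
  moreover have "((\<lambda>z. f z - f' z) has_real_derivative h z - h' z) (at z)" "continuous_on UNIV (\<lambda>z. h z - h' z)" for z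
    using assms unfolding test_function_def by (auto intro!: DERIV_diff continuous_intros)
  ultimately show ?thesis unfolding test_function_def by blast
qed

context stationary_density
begin

text \<open>
  All \<open>\<mu>\<^sub>i\<close> have the same support. In the weak equation for a bump function on a \<open>\<mu>\<^sub>i\<close>-null interval
  the terms of \<open>\<mu>\<^sub>i\<close> vanish, and what remains is a sum of nonnegative inflows from the other
  states, weighted with positive rates.
\<close>

lemma null_near_transfer:
  assumes i: "i \<in> {1..N}" and r: "0 < r" and null: "measure (m i) {x - r<..<x + r} = 0"
  obtains s where "0 < s" "\<And>j. j \<in> {1..N} \<Longrightarrow> measure (m j) {x - s<..<x + s} = 0"
proof -
  define c where "c = r / 3"
  have c: "0 < c" using r by (simp add: c_def)
  \<comment> \<open>Two steps of half-width \<open>c\<close> at distance \<open>2 * c\<close> from \<open>x\<close>: a bump that is \<open>1\<close> within distance \<open>c\<close> of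
    \<open>x\<close> and \<open>0\<close> beyond distance \<open>3 * c\<close>.\<close>
  define f where "f z = smooth_step ((z - (x - 2 * c)) / c) - smooth_step ((z - (x + 2 * c)) / c)" for z
  define h where "h z = tent ((z - (x - 2 * c)) / c) / c - tent ((z - (x + 2 * c)) / c) / c" for z
  have T: "test_function f h"
    unfolding f_def[abs_def] h_def[abs_def] by (intro test_function_diff test_function_smooth_step c)
  have out: "f z = 0 \<and> h z = 0" if z: "z \<notin> {x - r<..<x + r}" for z
  proof -
    consider "z \<le> x - 3 * c" | "x + 3 * c \<le> z" using z by (fastforce simp: c_def)
    then show ?thesis
    proof cases
      case 1
      then have "(z - (x - 2 * c)) / c \<le> - 1" "(z - (x + 2 * c)) / c \<le> - 1"
        using c by (simp_all add: divide_le_eq)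
      moreover from this have "1 \<le> \<bar>(z - (x - 2 * c)) / c\<bar>" "1 \<le> \<bar>(z - (x + 2 * c)) / c\<bar>" by linarith+
      ultimately show ?thesis by (simp add: f_def h_def smooth_step_left tent_eq_0)
    next
      case 2
      then have "1 \<le> (z - (x - 2 * c)) / c" "1 \<le> (z - (x + 2 * c)) / c"
        using c by (simp_all add: le_divide_eq)
      moreover from this have "1 \<le> \<bar>(z - (x - 2 * c)) / c\<bar>" "1 \<le> \<bar>(z - (x + 2 * c)) / c\<bar>" by linarith+
      ultimately show ?thesis by (simp add: f_def h_def smooth_step_right tent_eq_0)
    qed
  qed
  have f0: "0 \<le> f z" for z
    unfolding f_def using c by (simp add: divide_right_mono smooth_step_mono)
  have f1: "f z = 1" if "z \<in> {x - c<..<x + c}" for z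
  proof -
    have "1 \<le> (z - (x - 2 * c)) / c" "(z - (x + 2 * c)) / c \<le> - 1"
      using that c by (auto simp: le_divide_eq divide_le_eq)
    then show ?thesis by (simp add: f_def smooth_step_right smooth_step_left)
  qed
  have "emeasure (m i) {x - r<..<x + r} = 0"
    using null finite_measure.emeasure_eq_measure[OF finite_slice[OF i]] by simp
  then have ae: "AE z in m i. z \<notin> {x - r<..<x + r}" by (intro AE_not_in) (simp add: null_sets_def)
  have "(\<integral>z. h z * u i z \<partial>m i) = 0" "(\<integral>z. f z \<partial>m i) = 0"
    by (intro integral_eq_zero_AE eventually_mono[OF ae]; use out in simp)+
  then have "(\<Sum>j\<in>{1..N} - {i}. lam j i * (\<integral>z. f z \<partial>m j)) = 0"
    using stationary_equation[OF T i] by simp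
  moreover have "0 \<le> lam j i * (\<integral>z. f z \<partial>m j)" if "j \<in> {1..N} - {i}" for j
    using that i rate_pos[of j i] f0 by (intro mult_nonneg_nonneg integral_nonneg) (auto simp: less_imp_le)
  ultimately have z: "lam j i * (\<integral>z. f z \<partial>m j) = 0" if "j \<in> {1..N} - {i}" for j
    using that by (subst (asm) sum_nonneg_eq_0_iff) auto
  have "measure (m j) {x - c<..<x + c} = 0" if j: "j \<in> {1..N}" for j
  proof -
    have If: "(\<integral>z. f z \<partial>m j) = 0"
    proof (cases "j = i")
      case False
      then show ?thesis using z[of j] rate_pos[of j i] i j by auto
    qed (use \<open>(\<integral>z. f z \<partial>m i) = 0\<close> in simp)
    obtain B where B: "\<And>x. \<bar>f x\<bar> \<le> B" using T by (auto simp: test_function_def)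
    have "measure (m j) {x - c<..<x + c} = (\<integral>z. indicator {x - c<..<x + c} z \<partial>m j)" by simp
    also have "\<dots> \<le> (\<integral>z. f z \<partial>m j)"
    proof (rule integral_mono)
      show "integrable (m j) f" by (rule integrable_slice[OF j test_function_measurable(1)[OF T] B])
      show "integrable (m j) (indicator {x - c<..<x + c} :: real \<Rightarrow> real)"
        by (rule integrable_slice[OF j, of _ 1]) (auto simp: indicator_def)
    qed (use f0 f1 in \<open>auto simp: indicator_def\<close>)
    finally show ?thesis using If by (simp add: measure_le_0_iff)
  qed
  then show thesis using that c by blast
qed

definition charged :: "real set" where
  "charged = {x. \<forall>i\<in>{1..N}. \<forall>r>0. 0 < measure (m i) {x - r<..<x + r}}"

lemma not_chargedD:
  assumes "x \<notin> charged"
  obtains s where "0 < s" "\<And>j. j \<in> {1..N} \<Longrightarrow> measure (m j) {x - s<..<x + s} = 0"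
proof -
  obtain i r where "i \<in> {1..N}" "0 < r" "measure (m i) {x - r<..<x + r} = 0"
    using assms measure_nonneg[of "m _"] by (auto simp: charged_def not_less order_antisym)
  then show thesis by (rule null_near_transfer) (rule that)
qed

lemma null_interval_not_charged:
  assumes "i \<in> {1..N}" "measure (m i) {p<..<q} = 0" "p < x" "x < q"
  shows "x \<notin> charged"
proof
  assume "x \<in> charged"
  then have "0 < measure (m i) {x - min (x - p) (q - x)<..<x + min (x - p) (q - x)}"
    using assms by (simp add: charged_def)
  also have "\<dots> \<le> measure (m i) {p<..<q}"
    using finite_slice[OF assms(1)] by (intro finite_measure.finite_measure_mono) auto
  finally show False using assms by simp
qed

lemma closed_charged: "closed charged"
proof -
  have "\<exists>e>0. \<forall>y. dist y x < e \<longrightarrow> y \<in> - charged" if "x \<in> - charged" for x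
  proof -
    have "x \<notin> charged" using that by simp
    then obtain s where s: "0 < s" "\<And>j. j \<in> {1..N} \<Longrightarrow> measure (m j) {x - s<..<x + s} = 0"
      by (rule not_chargedD) blast
    have "y \<notin> charged" if "dist y x < s" for y
      using null_interval_not_charged[OF _ s(2), of 1 y] N_ge_2 that by (auto simp: dist_real_def abs_less_iff)
    then show ?thesis using s(1) by blast
  qed
  then show ?thesis unfolding closed_def open_dist by blast
qed

text \<open>
  Paths without a jump carry a positive proportion of the mass near \<open>x\<close> along the flow, by continuity
  to a given neighbourhood of the image of \<open>x\<close>.
\<close>

lemma flow_charged:
  assumes x: "x \<in> charged" and k: "k \<in> {1..N}" and t: "0 \<le> t"
  shows "flow (u k) t x \<in> charged"
proof (rule ccontr)
  let ?y = "flow (u k) t x"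
  assume "?y \<notin> charged"
  then obtain s where s: "0 < s" "\<And>j. j \<in> {1..N} \<Longrightarrow> measure (m j) {?y - s<..<?y + s} = 0"
    by (rule not_chargedD) blast
  have "emeasure (m k) {?y - s<..<?y + s} = 0"
    using s(2)[OF k] finite_measure.emeasure_eq_measure[OF finite_slice[OF k]] by simp
  moreover have "ennreal (exp (- rate k * t)) * emeasure (m k) (flow (u k) t -` {?y - s<..<?y + s})
      + (\<Sum>j\<in>{1..N} - {k}. ennreal (jump_prob j k t) * emeasure (m j) {}) \<le> emeasure (m k) {?y - s<..<?y + s}"
    by (rule slice_ge[OF k t]) auto
  ultimately have null: "emeasure (m k) (flow (u k) t -` {?y - s<..<?y + s}) = 0" by simp
  have "(flow (u k) t \<longlongrightarrow> ?y) (at x)" using isCont_flow[OF fc[OF k] C1[OF k] t, of x] by (simp add: isCont_def)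
  then have "\<forall>\<^sub>F z in at x. dist (flow (u k) t z) ?y < s" using s(1) by (rule tendstoD)
  then obtain d where d: "0 < d" "\<And>z. z \<noteq> x \<Longrightarrow> dist z x < d \<Longrightarrow> dist (flow (u k) t z) ?y < s"
    unfolding eventually_at by blast
  have sub: "{x - d<..<x + d} \<subseteq> flow (u k) t -` {?y - s<..<?y + s}"
  proof
    fix z assume "z \<in> {x - d<..<x + d}"
    then have "dist z x < d" by (auto simp: dist_real_def)
    then have "dist (flow (u k) t z) ?y < s" using d(2)[of z] s(1) by (cases "z = x") auto
    then show "z \<in> flow (u k) t -` {?y - s<..<?y + s}" by (auto simp: dist_real_def)
  qed
  have "flow (u k) t -` {?y - s<..<?y + s} \<in> sets (m k)"
    using measurable_sets[OF measurable_flow_at[OF k, of t], of "{?y - s<..<?y + s}"] by simp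
  then have "emeasure (m k) {x - d<..<x + d} \<le> 0"
    using emeasure_mono[OF sub, of "m k"] unfolding null by blast
  then have "measure (m k) {x - d<..<x + d} = 0" by (simp add: measure_def)
  moreover have "0 < measure (m k) {x - d<..<x + d}" using x k d(1) unfolding charged_def by blast
  ultimately show False by simp
qed

text \<open>Countably many null intervals with rational endpoints cover the uncharged points.\<close>

lemma emeasure_uncharged: "emeasure \<mu> ((- charged) \<times> {1..N}) = 0"
proof -
  define Q where "Q = {(p, q) \<in> \<rat> \<times> \<rat>. \<forall>j\<in>{1..N}. emeasure (m j) {p<..<q} = 0}"
  have "countable Q"
    by (rule countable_subset[of _ "\<rat> \<times> \<rat>"]) (auto simp: Q_def countable_rat)
  then have U: "(\<Union>(p, q)\<in>Q. {p<..<q}) \<in> null_sets (m j)" if "j \<in> {1..N}" for j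
    by (intro null_sets_UN') (use that in \<open>auto simp: Q_def\<close>)
  have sub: "- charged \<subseteq> (\<Union>(p, q)\<in>Q. {p<..<q})"
  proof
    fix x assume "x \<in> - charged"
    then have "x \<notin> charged" by simp
    then obtain s where s: "0 < s" "\<And>j. j \<in> {1..N} \<Longrightarrow> measure (m j) {x - s<..<x + s} = 0"
      by (rule not_chargedD) blast
    obtain p where p: "p \<in> \<rat>" "x - s < p" "p < x" using Rats_dense_in_real[of "x - s" x] s by auto
    obtain q where q: "q \<in> \<rat>" "x < q" "q < x + s" using Rats_dense_in_real[of x "x + s"] s by auto
    have "emeasure (m j) {p<..<q} = 0" if j: "j \<in> {1..N}" for j
    proof -
      have "emeasure (m j) {p<..<q} \<le> emeasure (m j) {x - s<..<x + s}"
        using p q by (intro emeasure_mono) auto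
      then show ?thesis
        using s(2)[OF j] finite_measure.emeasure_eq_measure[OF finite_slice[OF j]] by simp
    qed
    then have "(p, q) \<in> Q" using p q by (auto simp: Q_def)
    then show "x \<in> (\<Union>(p, q)\<in>Q. {p<..<q})" using p q by force
  qed
  have cb: "- charged \<in> sets borel" using closed_charged by auto
  have "(- charged) \<times> {j} \<in> null_sets \<mu>" if j: "j \<in> {1..N}" for j
  proof -
    have "- charged \<in> null_sets (m j)"
      using null_sets_subset[OF U[OF j] _ sub] cb by simp
    then have "emeasure \<mu> ((- charged) \<times> {j}) = 0" using emeasure_slice[OF j cb] by auto
    moreover have "(- charged) \<times> {j} \<in> sets \<mu>" using cb j by (auto simp: sets_\<mu>)
    ultimately show ?thesis by auto
  qed
  then have "(\<Union>j\<in>{1..N}. (- charged) \<times> {j}) \<in> null_sets \<mu>" by (intro null_sets_UN') auto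
  moreover have "(\<Union>j\<in>{1..N}. (- charged) \<times> {j}) = (- charged) \<times> {1..N}" by auto
  ultimately show ?thesis by auto
qed

text \<open>
  A minimal invariant set \<open>J\<close> of positive mass meets the charged points. Their intersection is again
  invariant, hence equal to \<open>J\<close>, and the closure of \<open>J\<close> stays inside the closed set of charged
  points.
\<close>

lemma support_interval_charged:
  assumes "I \<in> support_intervals N u \<mu>"
  shows "I \<subseteq> charged"
proof -
  obtain J where J: "I = closure J" "minimal_invariant_set N u J" "emeasure \<mu> (J \<times> {1..N}) > 0"
    using assms by (auto simp: support_intervals_def)
  have inv: "invariant_set N u J" and min: "\<And>K. K \<subset> J \<Longrightarrow> \<not> invariant_set N u K"
    using J(2) by (auto simp: minimal_invariant_set_def)
  have "J \<inter> charged \<noteq> {}"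
  proof
    assume "J \<inter> charged = {}"
    then have "J \<times> {1..N} \<subseteq> (- charged) \<times> {1..N}" by auto
    moreover have "(- charged) \<times> {1..N} \<in> sets \<mu>" using closed_charged by (auto simp: sets_\<mu>)
    ultimately have "emeasure \<mu> (J \<times> {1..N}) \<le> emeasure \<mu> ((- charged) \<times> {1..N})" by (rule emeasure_mono)
    then show False using J(3) emeasure_uncharged by simp
  qed
  moreover have "composed_flow u its x \<in> charged"
    if "\<forall>(i, t)\<in>set its. i \<in> {1..N} \<and> 0 \<le> t" "x \<in> charged" for its x
    using that
  proof (induction its arbitrary: x)
    case Nil then show ?case by (simp add: composed_flow_def)
  next
    case (Cons a its)
    obtain i t where a: "a = (i, t)" by (cases a)
    have "composed_flow u its (flow (u i) t x) \<in> charged"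
      using Cons.prems by (intro Cons.IH flow_charged) (auto simp: a)
    then show ?case by (simp add: composed_flow_def a)
  qed
  ultimately have "invariant_set N u (J \<inter> charged)"
    using inv unfolding invariant_set_def by blast
  then have "J \<inter> charged = J" using min[of "J \<inter> charged"] by blast
  then show ?thesis unfolding J(1) using closed_charged by (intro closure_minimal) auto
qed

lemma support_interval_flow:
  assumes I: "I \<in> support_intervals N u \<mu>" and x: "x \<in> I" and k: "k \<in> {1..N}" and t: "0 \<le> t"
  shows "flow (u k) t x \<in> I"
proof -
  obtain J where J: "I = closure J" "invariant_set N u J"
    using I by (auto simp: support_intervals_def minimal_invariant_set_def)
  have inv: "\<forall>its. (\<forall>(i, t)\<in>set its. i \<in> {1..N} \<and> 0 \<le> t) \<longrightarrow> composed_flow u its ` J \<subseteq> J"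
    using J(2) by (simp add: invariant_set_def)
  have "composed_flow u [(k, t)] ` J \<subseteq> J"
    by (rule inv[rule_format]) (use k t in auto)
  then have "flow (u k) t ` J \<subseteq> closure J"
    using closure_subset[of J] by (auto simp: composed_flow_def)
  moreover have "continuous_on (closure J) (flow (u k) t)"
    using isCont_flow[OF fc[OF k] C1[OF k] t] by (intro continuous_at_imp_continuous_on) auto
  ultimately have "flow (u k) t ` closure J \<subseteq> closure J" by (intro image_closure_subset) auto
  then show ?thesis using x J(1) by auto
qed

text \<open>
  Upstream of \<open>0\<close>, that is on the side from which \<open>u k\<close> arrives, let \<open>M k y\<close> be the mass that \<open>\<mu>\<^sub>k\<close> puts
  on the interval of length \<open>y\<close> ending at \<open>0\<close>. The flux of state \<open>k\<close> vanishes at \<open>0\<close>, so the mass that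
  enters this interval must leave it by switching: the density at its far end is at most a
  constant times \<open>M k y\<close>. This density is the derivative of \<open>M k\<close>, and Gronwall's inequality with
  \<open>M k 0 = 0\<close> makes the interval null. The sign \<open>\<sigma>\<close> of \<open>u k 0\<close> treats both directions at once.
\<close>

lemma uncharged_upstream:
  assumes k: "k \<in> {1..N}" and d: "0 < d" and cont: "continuous_on {-d<..<d} (\<rho> k)"
    and u0: "u k 0 \<noteq> 0" and \<rho>0: "\<rho> k 0 = 0" and e: "0 < e"
  shows "\<exists>y. \<bar>y\<bar> < e \<and> y \<notin> charged"
proof -
  define \<sigma> where "\<sigma> = sgn (u k 0)"
  have \<sigma>: "\<sigma> = 1 \<or> \<sigma> = - 1" and \<sigma>2: "\<sigma> * \<sigma> = 1" using u0 by (auto simp: \<sigma>_def sgn_if)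
  define c where "c = \<bar>u k 0\<bar> / 2"
  have c: "0 < c" using u0 by (simp add: c_def)
  have "((\<lambda>y. \<sigma> * u k y) \<longlongrightarrow> \<sigma> * u k 0) (at 0)"
    using u_continuous[OF k] by (intro tendsto_intros) (simp add: continuous_on_def)
  moreover have "c < \<sigma> * u k 0" using u0 by (simp add: c_def \<sigma>_def sgn_if)
  ultimately have "\<forall>\<^sub>F y in at 0. c < \<sigma> * u k y" by (rule order_tendstoD)
  then obtain \<eta> where \<eta>: "0 < \<eta>" "\<And>y. y \<noteq> 0 \<Longrightarrow> \<bar>y\<bar> < \<eta> \<Longrightarrow> c < \<sigma> * u k y"
    unfolding eventually_at by (auto simp: dist_real_def)
  \<comment> \<open>For \<open>\<sigma> = 1\<close> this is the mass of \<open>{-y<..0}\<close>, for \<open>\<sigma> = - 1\<close> the mass of \<open>{0<..y}\<close>.\<close>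
  define M where "M j y = \<sigma> * (mass_above j (- \<sigma> * y) - mass_above j 0)" for j y
  define y0 where "y0 = min (min \<eta> d) e / 2"
  have y0: "0 < y0" "y0 < \<eta>" "y0 < d" "y0 < e" using \<eta> d e by (auto simp: y0_def)
  have M_meas: "M j y = measure (m j) (if \<sigma> = 1 then {-y<..0} else {0<..y})"
    if "j \<in> {1..N}" "0 \<le> y" for j y
    using \<sigma> mass_above_diff[OF that(1), of "-y" 0] mass_above_diff[OF that(1), of 0 y] that(2) by (auto simp: M_def)
  have M0: "0 \<le> M j y" if "j \<in> {1..N}" "0 \<le> y" for j y using M_meas[OF that] by simp
  have DM: "(M k has_real_derivative \<rho> k (- \<sigma> * y)) (at y)" if "\<bar>y\<bar> < d" for y
  proof -
    have in_d: "- d < - \<sigma> * y" "- \<sigma> * y < d" using that \<sigma> by auto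
    have "((\<lambda>y. - \<sigma> * y) has_real_derivative - \<sigma>) (at y)" by (auto intro!: derivative_eq_intros)
    from DERIV_chain2[OF DERIV_mass_above[OF k cont in_d] this]
    have "((\<lambda>y. \<sigma> * (mass_above k (- \<sigma> * y) - mass_above k 0)) has_real_derivative \<sigma> * (- \<rho> k (- \<sigma> * y) * - \<sigma> - 0)) (at y)"
      by (intro DERIV_cmult DERIV_diff DERIV_const)
    moreover have "\<sigma> * (- \<rho> k (- \<sigma> * y) * - \<sigma> - 0) = \<rho> k (- \<sigma> * y)" using \<sigma> by auto
    ultimately show ?thesis unfolding M_def[abs_def] by (simp only:)
  qed
  have bound: "c * \<rho> k (- \<sigma> * y) \<le> rate k * M k y" if y: "0 < y" "y \<le> y0" for y
  proof -
    have in_d: "- d < - \<sigma> * y" "- \<sigma> * y < d" using y y0 \<sigma> by auto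
    have "\<sigma> * (u k (- \<sigma> * y) * \<rho> k (- \<sigma> * y)) = \<sigma> * (u k (- \<sigma> * y) * \<rho> k (- \<sigma> * y) - u k 0 * \<rho> k 0)"
      by (simp add: \<rho>0)
    also have "\<dots> = \<sigma> * ((rate k * mass_above k (- \<sigma> * y) - (\<Sum>j\<in>{1..N} - {k}. lam j k * mass_above j (- \<sigma> * y)))
        - (rate k * mass_above k 0 - (\<Sum>j\<in>{1..N} - {k}. lam j k * mass_above j 0)))"
      using flux_eq_mass_above[OF k cont in_d] flux_eq_mass_above[OF k cont, of 0] d by simp
    also have "\<dots> = rate k * M k y - (\<Sum>j\<in>{1..N} - {k}. lam j k * M j y)"
      unfolding M_def by (simp add: algebra_simps sum_subtractf sum_distrib_left)
    also have "\<dots> \<le> rate k * M k y"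
      using M0 y rate_pos[of _ k] k by (auto intro!: sum_nonneg mult_nonneg_nonneg simp: less_imp_le)
    finally have 1: "\<sigma> * u k (- \<sigma> * y) * \<rho> k (- \<sigma> * y) \<le> rate k * M k y" by (simp add: mult.assoc)
    have "c \<le> \<sigma> * u k (- \<sigma> * y)" using \<eta>(2)[of "- \<sigma> * y"] y y0 \<sigma> by auto
    then have "c * \<rho> k (- \<sigma> * y) \<le> \<sigma> * u k (- \<sigma> * y) * \<rho> k (- \<sigma> * y)"
      using rho_nonneg[OF k cont in_d] by (rule mult_right_mono)
    with 1 show ?thesis by simp
  qed
  define C where "C = rate k / c"
  have "M k y0 * exp (- C * y0) \<le> M k 0 * exp (- C * 0)"
  proof (rule DERIV_nonpos_imp_decreasing_open[OF less_imp_le[OF y0(1)]])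
    show "continuous_on {0..y0} (\<lambda>y. M k y * exp (- C * y))"
      using y0 by (intro continuous_intros DERIV_atLeastAtMost_imp_continuous_on)
        (auto intro!: exI DM)
    fix y assume y: "0 < y" "y < y0"
    have "((\<lambda>y. M k y * exp (- C * y)) has_real_derivative
        \<rho> k (- \<sigma> * y) * exp (- C * y) + (exp (- C * y) * - C) * M k y) (at y)"
      by (intro DERIV_mult DM) (use y y0 in \<open>auto intro!: derivative_eq_intros\<close>)
    moreover have "\<rho> k (- \<sigma> * y) \<le> C * M k y"
      using bound[of y] y c by (simp add: C_def field_simps)
    then have "(\<rho> k (- \<sigma> * y) - C * M k y) * exp (- C * y) \<le> 0" by (simp add: mult_nonpos_nonneg)
    then have "\<rho> k (- \<sigma> * y) * exp (- C * y) + (exp (- C * y) * - C) * M k y \<le> 0"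
      by (simp add: algebra_simps)
    ultimately show "\<exists>D. ((\<lambda>y. M k y * exp (- C * y)) has_real_derivative D) (at y) \<and> D \<le> 0" by blast
  qed
  then have "M k y0 \<le> 0" by (simp add: M_def mult_le_0_iff)
  then have "M k y0 = 0" using M0[OF k, of y0] y0 by simp
  then have null: "measure (m k) (if \<sigma> = 1 then {-y0<..0} else {0<..y0}) = 0"
    using M_meas[OF k, of y0] y0 by simp
  have "- \<sigma> * y0 / 2 \<notin> charged"
  proof (cases "\<sigma> = 1")
    case True
    have "measure (m k) {-y0<..<0} \<le> measure (m k) {-y0<..0}"
      using finite_slice[OF k] by (intro finite_measure.finite_measure_mono) auto
    then have "measure (m k) {-y0<..<0} = 0" using null True by (simp add: measure_le_0_iff)
    then show ?thesis by (rule null_interval_not_charged[OF k]) (use True y0 in auto)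
  next
    case False
    have "measure (m k) {0<..<y0} \<le> measure (m k) {0<..y0}"
      using finite_slice[OF k] by (intro finite_measure.finite_measure_mono) auto
    then have "measure (m k) {0<..<y0} = 0" using null False by (simp add: measure_le_0_iff)
    then show ?thesis by (rule null_interval_not_charged[OF k]) (use False \<sigma> y0 in auto)
  qed
  moreover have "\<bar>- \<sigma> * y0 / 2\<bar> < e" using \<sigma> y0 by auto
  ultimately show ?thesis by blast
qed

end

section \<open>A scalar flux equation with a simple sink at the origin\<close>

lemma at_within_Ioo_at_right:
  "0 < e \<Longrightarrow> at 0 within {0<..<e} = at_right (0::real)"
  by (rule at_within_nhd[of _ "{..<e}"]) auto

text \<open>A Lipschitz function on an open interval extends continuously to its endpoints.\<close>

lemma tendsto_at_right_of_bounded_deriv: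
  fixes \<phi> :: "real \<Rightarrow> real"
  assumes "0 < e" and d: "\<And>x. 0 < x \<Longrightarrow> x < e \<Longrightarrow> (\<phi> has_real_derivative \<phi>' x) (at x)"
    and b: "\<And>x. 0 < x \<Longrightarrow> x < e \<Longrightarrow> \<bar>\<phi>' x\<bar> \<le> B"
  obtains L where "(\<phi> \<longlongrightarrow> L) (at_right 0)"
proof -
  have "B \<ge> 0" using b[of "e/2"] assms(1) by auto
  have lip: "B-lipschitz_on {0<..<e} \<phi>"
    using field_differentiable_bound[of "{0<..<e}" \<phi> \<phi>' B] d b \<open>B \<ge> 0\<close>
    by (intro lipschitz_onI) (auto simp: dist_real_def has_field_derivative_at_within)
  have "uniformly_continuous_on {0<..<e} \<phi>"
    by (rule lipschitz_on_uniformly_continuous[OF lip])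
  moreover have "0 \<in> closure {0<..<e}" using assms(1) by simp
  ultimately obtain L where "(\<phi> \<longlongrightarrow> L) (at 0 within {0<..<e})"
    using uniformly_continuous_on_extension_at_closure by blast
  then show thesis
    using that assms(1) by (simp add: at_within_Ioo_at_right)
qed

lemma antimono_tendsto_at_right:
  fixes g :: "real \<Rightarrow> real"
  assumes "0 < e" and anti: "\<And>x y. 0 < x \<Longrightarrow> x \<le> y \<Longrightarrow> y < e \<Longrightarrow> g y \<le> g x"
    and b: "\<And>x. 0 < x \<Longrightarrow> x < e \<Longrightarrow> g x \<le> B"
  obtains G where "(g \<longlongrightarrow> G) (at_right 0)" "\<And>x. 0 < x \<Longrightarrow> x < e \<Longrightarrow> g x \<le> G"
proof -
  define G where "G = (SUP x\<in>{0<..<e}. g x)"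
  have bdd: "bdd_above (g ` {0<..<e})" using b by (auto intro!: bdd_aboveI[of _ B])
  have up: "g x \<le> G" if "0 < x" "x < e" for x
    unfolding G_def using bdd that by (intro cSUP_upper) auto
  have "(g \<longlongrightarrow> G) (at_right 0)"
  proof (rule order_tendstoI)
    fix c assume "c < G"
    then obtain y where y: "0 < y" "y < e" "c < g y"
      unfolding G_def using bdd assms(1) less_cSUP_iff[of "{0<..<e}" g c] by auto
    have "\<forall>\<^sub>F x in at_right 0. 0 < x \<and> x < y"
      using y(1) by (auto simp: eventually_at_right_field)
    then show "\<forall>\<^sub>F x in at_right 0. c < g x"
      by eventually_elim (use anti y in \<open>fastforce intro: less_le_trans\<close>)
  next
    fix c assume c: "G < c"
    have "\<forall>\<^sub>F x in at_right 0. 0 < x \<and> x < e"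
      using assms(1) by (auto simp: eventually_at_right_field)
    then show "\<forall>\<^sub>F x in at_right 0. g x < c"
      by eventually_elim (use up c in \<open>fastforce intro: le_less_trans\<close>)
  qed
  then show thesis using that up by blast
qed

text \<open>
  Here \<open>v\<close> is the field with the sink, \<open>r\<close> its density, \<open>s\<close> the source that feeds it by switching and
  \<open>l\<close> the rate at which it is left.
\<close>

locale sink_equation =
  fixes v r s :: "real \<Rightarrow> real" and a l \<delta> :: real
  assumes a_pos: "0 < a" and l_pos: "0 < l" and \<delta>_pos: "0 < \<delta>"
    and v_cont: "continuous_on {0<..<\<delta>} v"
    and v_asymp: "(\<lambda>\<eta>. v \<eta> - (- a * \<eta>)) \<in> O[at_right 0](\<lambda>\<eta>. \<eta>\<^sup>2)"
    and r_nonneg: "\<And>x. 0 < x \<Longrightarrow> x < \<delta> \<Longrightarrow> 0 \<le> r x"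
    and s_cont: "continuous_on {0..<\<delta>} s" and s_nonneg: "\<And>x. 0 < x \<Longrightarrow> x < \<delta> \<Longrightarrow> 0 \<le> s x"
    and flux_deriv: "\<And>x. 0 < x \<Longrightarrow> x < \<delta> \<Longrightarrow> ((\<lambda>x. v x * r x) has_real_derivative s x - l * r x) (at x)"
begin

lemma sink_bounds:
  obtains e C where "0 < e" "e < \<delta>" "\<And>x. 0 < x \<Longrightarrow> x < e \<Longrightarrow> a * x / 2 \<le> - v x"
    "\<And>x. 0 < x \<Longrightarrow> x < e \<Longrightarrow> \<bar>v x + a * x\<bar> \<le> C * x\<^sup>2"
proof -
  obtain C where C: "C > 0" "\<forall>\<^sub>F x in at_right 0. norm (v x - - a * x) \<le> C * norm (x\<^sup>2)"
    using landau_o.bigE[OF v_asymp] by blast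
  obtain d where d: "d > 0" "\<And>x. 0 < x \<Longrightarrow> x < d \<Longrightarrow> \<bar>v x + a * x\<bar> \<le> C * x\<^sup>2"
    using C(2) by (auto simp: eventually_at_right_field)
  \<comment> \<open>The bound \<open>a / (2 * C)\<close> keeps the quadratic error of \<open>v\<close> below half of its linear part.\<close>
  define e where "e = min (min d (\<delta> / 2)) (a / (2 * C))"
  have "a * x / 2 \<le> - v x" if x: "0 < x" "x < e" for x
  proof -
    have "C * x \<le> a / 2" using x C(1) by (simp add: e_def field_simps)
    then have "C * x\<^sup>2 \<le> a / 2 * x" using x by (simp add: power2_eq_square mult_right_mono flip: mult.assoc)
    then show ?thesis using d(2)[of x] x by (auto simp: e_def)
  qed
  then show thesis
    using d a_pos C(1) \<delta>_pos by (intro that[of e C]) (auto simp: e_def)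
qed

text \<open>
  With the flux \<open>f = - v r\<close>, the forward equation becomes \<open>(H f)' = - H s\<close> on \<open>(0, e)\<close>, and \<open>H x\<close> behaves
  like \<open>K * x powr (- l / a)\<close> at \<open>0\<close>.
\<close>

definition integrating_factor :: "real \<Rightarrow> (real \<Rightarrow> real) \<Rightarrow> real \<Rightarrow> bool" where
  "integrating_factor e H K \<longleftrightarrow> 0 < e \<and> e < \<delta> \<and>
     (\<forall>x. 0 < x \<longrightarrow> x < e \<longrightarrow> v x < 0 \<and> 0 < H x \<and>
        ((\<lambda>x. - H x * v x * r x) has_real_derivative - H x * s x) (at x)) \<and>
     0 < K \<and> ((\<lambda>x. H x * x powr (l / a)) \<longlongrightarrow> K) (at_right 0)"

lemma integrating_factorD:
  assumes "integrating_factor e H K"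
  shows "0 < e" "e < \<delta>" "\<And>x. 0 < x \<Longrightarrow> x < e \<Longrightarrow> v x < 0"
    "\<And>x. 0 < x \<Longrightarrow> x < e \<Longrightarrow> 0 < H x"
    "\<And>x. 0 < x \<Longrightarrow> x < e \<Longrightarrow> ((\<lambda>x. - H x * v x * r x) has_real_derivative - H x * s x) (at x)"
    "0 < K" "((\<lambda>x. H x * x powr (l / a)) \<longlongrightarrow> K) (at_right 0)"
  using assms unfolding integrating_factor_def by auto

text \<open>
  The logarithmic derivative of \<open>H\<close> has to be \<open>l / v\<close>, which differs from that of \<open>x powr (- l / a)\<close>
  by \<open>b x = l / v x + l / (a * x)\<close>. The quadratic error of \<open>v\<close> makes \<open>b\<close> bounded, so its antiderivative
  \<open>\<phi>\<close> converges at \<open>0\<close>.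
\<close>

lemma integrating_factor_exists:
  obtains e H K where "integrating_factor e H K"
proof -
  obtain e C where e: "0 < e" "e < \<delta>" and v: "\<And>x. 0 < x \<Longrightarrow> x < e \<Longrightarrow> a * x / 2 \<le> - v x"
    and C: "\<And>x. 0 < x \<Longrightarrow> x < e \<Longrightarrow> \<bar>v x + a * x\<bar> \<le> C * x\<^sup>2"
    using sink_bounds by metis
  have vneg: "v x < 0" if "0 < x" "x < e" for x
    using v[OF that] mult_pos_pos[OF a_pos that(1)] by simp
  define b where "b x = l / v x + l / (a * x)" for x
  define \<phi> where "\<phi> x = (LBINT y=ereal (e / 2)..ereal x. b y)" for x
  have \<phi>: "(\<phi> has_real_derivative b x) (at x)" if x: "0 < x" "x < e" for x
  proof -
    define p q where "p = min (x / 2) (e / 4)" and "q = (max x (e / 2) + e) / 2"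
    have pq: "0 < p" "p < x" "x < q" "q < e" "p \<le> e / 2" "e / 2 \<le> q" using x by (auto simp: p_def q_def)
    have "continuous_on {p..q} b"
      unfolding b_def using pq e vneg a_pos
      by (intro continuous_intros continuous_on_subset[OF v_cont]) (auto simp: less_imp_neq)
    then have "(\<phi> has_vector_derivative b x) (at x within {p..q})"
      unfolding \<phi>_def using pq by (intro interval_integral_FTC2) auto
    moreover have "at x within {p..q} = at x" using pq by (intro at_within_interior) auto
    ultimately show ?thesis by (simp add: has_real_derivative_iff_has_vector_derivative)
  qed
  have b_bound: "\<bar>b x\<bar> \<le> 2 * l * C / a\<^sup>2" if x: "0 < x" "x < e" for x
  proof -
    have "b x = l * (v x + a * x) / (v x * (a * x))"
      unfolding b_def using vneg[OF x] a_pos x by (simp add: field_simps)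
    then have "\<bar>b x\<bar> = l * \<bar>v x + a * x\<bar> / (- v x * (a * x))"
      using vneg[OF x] a_pos x l_pos by (simp add: abs_mult)
    also have "\<dots> \<le> l * (C * x\<^sup>2) / (a * x / 2 * (a * x))"
      using C[OF x] v[OF x] a_pos x l_pos
      by (intro frac_le mult_left_mono mult_right_mono mult_pos_pos) (auto intro: order_trans[OF abs_ge_zero])
    also have "\<dots> = 2 * l * C / a\<^sup>2" using x a_pos by (simp add: field_simps power2_eq_square)
    finally show ?thesis .
  qed
  obtain L where L: "(\<phi> \<longlongrightarrow> L) (at_right 0)"
    using tendsto_at_right_of_bounded_deriv[OF e(1) \<phi> b_bound] by blast
  define H where "H x = x powr (- l / a) * exp (\<phi> x)" for x
  have H: "(H has_real_derivative H x * (l / v x)) (at x)" if x: "0 < x" "x < e" for x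
  proof -
    have D: "(H has_real_derivative (- l / a) * x powr (- l / a - 1) * exp (\<phi> x) + x powr (- l / a) * (exp (\<phi> x) * b x)) (at x)"
      unfolding H_def by (rule derivative_eq_intros \<phi>[OF x] refl | use x in force)+
    have "x powr (- l / a - 1) = x powr (- l / a) / x" using x by (simp add: powr_diff)
    then have "(- l / a) * x powr (- l / a - 1) * exp (\<phi> x) + x powr (- l / a) * (exp (\<phi> x) * b x)
        = H x * (l / v x)"
      using vneg[OF x] x a_pos by (simp add: H_def b_def divide_simps) (simp add: algebra_simps)
    then show ?thesis using D by simp
  qed
  have "integrating_factor e H (exp L)" unfolding integrating_factor_def
  proof (intro conjI allI impI e vneg)
    show "0 < H x" if "0 < x" "x < e" for x using that by (simp add: H_def)
    show "((\<lambda>x. - H x * v x * r x) has_real_derivative - H x * s x) (at x)" if x: "0 < x" "x < e" for x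
    proof -
      have "((\<lambda>x. - H x * (v x * r x)) has_real_derivative
          - (H x * (l / v x)) * (v x * r x) + (s x - l * r x) * (- H x)) (at x)"
        using x e by (intro DERIV_mult DERIV_minus H flux_deriv) auto
      then show ?thesis using vneg[OF x] by (simp add: algebra_simps)
    qed
    have "((\<lambda>x. exp (\<phi> x)) \<longlongrightarrow> exp L) (at_right 0)" by (intro tendsto_intros L)
    then show "((\<lambda>x. H x * x powr (l / a)) \<longlongrightarrow> exp L) (at_right 0)"
    proof (rule Lim_transform_eventually)
      show "\<forall>\<^sub>F x in at_right 0. exp (\<phi> x) = H x * x powr (l / a)"
        using eventually_at_right_less[of "0::real"]
        by eventually_elim (simp add: H_def powr_minus field_simps flip: powr_add)
    qed
  qed auto
  then show thesis by (rule that)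
qed

text \<open>
  Recovers the density from \<open>H f\<close>: \<open>r x\<close> is \<open>H f\<close> divided by \<open>- H x * v x\<close>, and this divisor behaves
  like \<open>K * a * x powr (1 - l / a)\<close>. The scale \<open>T\<close> is \<open>1\<close>, a power or a logarithm below.
\<close>

lemma density_asymp:
  assumes F: "integrating_factor e H K"
    and lim: "((\<lambda>x. - H x * v x * r x / T x) \<longlongrightarrow> c) (at_right 0)"
  shows "((\<lambda>x. r x / (x powr (l / a - 1) * T x)) \<longlongrightarrow> c / (K * a)) (at_right 0)"
proof -
  note e = integrating_factorD(1)[OF F] and Hpos = integrating_factorD(4)[OF F]
    and H = integrating_factorD(7,6)[OF F]
  obtain d C where d: "0 < d" "d < \<delta>" and v: "\<And>x. 0 < x \<Longrightarrow> x < d \<Longrightarrow> a * x / 2 \<le> - v x"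
    and C: "\<And>x. 0 < x \<Longrightarrow> x < d \<Longrightarrow> \<bar>v x + a * x\<bar> \<le> C * x\<^sup>2"
    using sink_bounds by metis
  have near: "\<forall>\<^sub>F x in at_right 0. 0 < x \<and> x < min d e"
    using d e unfolding eventually_at_right_field by (intro exI[of _ "min d e"]) auto
  have "((\<lambda>x. v x / x + a) \<longlongrightarrow> 0) (at_right 0)"
  proof (rule Lim_null_comparison)
    show "\<forall>\<^sub>F x in at_right 0. norm (v x / x + a) \<le> C * x"
      using near
    proof eventually_elim
      case (elim x)
      then have "v x / x + a = (v x + a * x) / x" by (simp add: add_divide_distrib)
      then have "\<bar>v x / x + a\<bar> = \<bar>v x + a * x\<bar> / x" using elim by (simp only: abs_div_pos)
      also have "\<dots> \<le> C * x\<^sup>2 / x" using elim C[of x] by (intro divide_right_mono) auto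
      finally show ?case using elim by (simp add: power2_eq_square)
    qed
    show "((\<lambda>x. C * x) \<longlongrightarrow> 0) (at_right 0)" by (auto intro!: tendsto_eq_intros)
  qed
  then have vx: "((\<lambda>x. - (v x / x + a) + a) \<longlongrightarrow> - 0 + a) (at_right 0)" by (intro tendsto_intros)
  have "((\<lambda>x. - H x * v x * r x / T x / (H x * x powr (l / a) * (- (v x / x + a) + a))) \<longlongrightarrow> c / (K * (- 0 + a))) (at_right 0)"
    using H a_pos by (intro tendsto_intros lim vx) auto
  then have "((\<lambda>x. - H x * v x * r x / T x / (H x * x powr (l / a) * (- (v x / x + a) + a))) \<longlongrightarrow> c / (K * a)) (at_right 0)"
    by simp
  then show ?thesis
  proof (rule Lim_transform_eventually)
    show "\<forall>\<^sub>F x in at_right 0. - H x * v x * r x / T x / (H x * x powr (l / a) * (- (v x / x + a) + a))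
        = r x / (x powr (l / a - 1) * T x)"
      using near
    proof eventually_elim
      case (elim x)
      have "v x < 0" using v[of x] mult_pos_pos[OF a_pos, of x] elim by auto
      then show ?case
        using elim Hpos[of x] by (cases "T x = 0") (simp_all add: powr_diff field_simps)
    qed
  qed
qed

text \<open>
  \<open>H f\<close> decreases in \<open>x\<close>, so boundedness gives a limit at \<open>0\<close>. The limit is at least as large as every
  value, and one of these values is positive.
\<close>

lemma power_law_of_bounded:
  assumes F: "integrating_factor e H K"
    and bd: "\<And>x. 0 < x \<Longrightarrow> x < d \<Longrightarrow> - H x * v x * r x \<le> B" "0 < d"
    and nontriv: "\<And>\<epsilon>. 0 < \<epsilon> \<Longrightarrow> \<exists>x>0. x < \<epsilon> \<and> 0 < r x"
  shows "\<exists>c>0. ((\<lambda>x. r x / x powr (l / a - 1)) \<longlongrightarrow> c) (at_right 0)"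
proof -
  note e = integrating_factorD(1-3)[OF F] and Hpos = integrating_factorD(4)[OF F]
    and dg = integrating_factorD(5)[OF F] and K = integrating_factorD(6,7)[OF F]
  define m where "m = min d e"
  have m: "0 < m" "m \<le> d" "m \<le> e" using e bd by (auto simp: m_def)
  have anti: "- H y * v y * r y \<le> - H x * v x * r x" if xy: "0 < x" "x \<le> y" "y < m" for x y
  proof (rule DERIV_nonpos_imp_nonincreasing[OF xy(2)])
    fix z assume "x \<le> z" "z \<le> y"
    then have z: "0 < z" "z < e" using xy m by auto
    moreover have "- H z * s z \<le> 0" using Hpos[OF z] s_nonneg[of z] z e by simp
    ultimately show "\<exists>D. ((\<lambda>x. - H x * v x * r x) has_real_derivative D) (at z) \<and> D \<le> 0"
      using dg by blast
  qed
  obtain G where G: "((\<lambda>x. - H x * v x * r x) \<longlongrightarrow> G) (at_right 0)"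
      "\<And>x. 0 < x \<Longrightarrow> x < m \<Longrightarrow> - H x * v x * r x \<le> G"
  proof (rule antimono_tendsto_at_right[OF m(1)])
    show "- H x * v x * r x \<le> B" if "0 < x" "x < m" for x using bd(1)[of x] that m by simp
  qed (use anti in auto)
  obtain x where x: "0 < x" "x < m" "0 < r x" using nontriv m by blast
  have "0 < - v x" "0 < H x" using e(3)[of x] Hpos[of x] x m by auto
  then have "0 < H x * (- v x) * r x" using x by (intro mult_pos_pos)
  then have "0 < G" using G(2)[of x] x by simp
  moreover have "((\<lambda>x. r x / (x powr (l / a - 1) * 1)) \<longlongrightarrow> G / (K * a)) (at_right 0)"
    by (rule density_asymp[OF F]) (use G in simp_all)
  ultimately show ?thesis using K a_pos by (auto intro!: exI[of _ "G / (K * a)"])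
qed

text \<open>
  The derivative of \<open>H f\<close> is at least \<open>- C\<close> times \<open>H f\<close>. Multiplying \<open>H f\<close> by \<open>exp (\<bar>C\<bar> * x)\<close> therefore
  gives a function that increases in \<open>x\<close>, so \<open>H f\<close> is bounded near \<open>0\<close>.
\<close>

lemma power_law_comparable:
  assumes d: "0 < d" and cmp: "\<And>x. 0 < x \<Longrightarrow> x < d \<Longrightarrow> s x \<le> C * (- v x * r x)"
    and nontriv: "\<And>\<epsilon>. 0 < \<epsilon> \<Longrightarrow> \<exists>x>0. x < \<epsilon> \<and> 0 < r x"
  shows "\<exists>c>0. ((\<lambda>x. r x / x powr (l / a - 1)) \<longlongrightarrow> c) (at_right 0)"
proof -
  obtain e H K where F: "integrating_factor e H K" by (rule integrating_factor_exists)
  note e = integrating_factorD(1-3)[OF F] and Hpos = integrating_factorD(4)[OF F]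
    and dg = integrating_factorD(5)[OF F] and K = integrating_factorD(6,7)[OF F]
  define y where "y = min d e / 2"
  have y: "0 < y" "y < d" "y < e" using d e by (auto simp: y_def)
  define C' where "C' = \<bar>C\<bar>"
  have g0: "0 \<le> - H x * v x * r x" if "0 < x" "x < e" for x
    using that Hpos[of x] e r_nonneg[of x] by (simp add: mult_nonneg_nonneg mult_nonneg_nonpos mult_nonpos_nonneg less_imp_le)
  have "- H x * v x * r x \<le> exp (C' * y) * (- H y * v y * r y)" if x: "0 < x" "x < y" for x
  proof -
    have "exp (C' * x) * (- H x * v x * r x) \<le> exp (C' * y) * (- H y * v y * r y)"
    proof (rule DERIV_nonneg_imp_nondecreasing[OF less_imp_le[OF x(2)]])
      fix z assume "x \<le> z" "z \<le> y"
      then have z: "0 < z" "z < e" "z < d" using x y by auto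
      have "((\<lambda>x. exp (C' * x) * (- H x * v x * r x)) has_real_derivative
          (exp (C' * z) * C') * (- H z * v z * r z) + (- H z * s z) * exp (C' * z)) (at z)"
        by (intro DERIV_mult dg z) (auto intro!: derivative_eq_intros)
      moreover have "H z * s z \<le> C' * (- H z * v z * r z)"
      proof -
        have "- v z * r z \<ge> 0"
          using z e r_nonneg[of z] by (simp add: mult_nonpos_nonneg less_imp_le)
        then have "C * (- v z * r z) \<le> C' * (- v z * r z)"
          unfolding C'_def by (intro mult_right_mono) auto
        with cmp[OF z(1,3)] have "s z \<le> C' * (- v z * r z)" by linarith
        then have "H z * s z \<le> H z * (C' * (- v z * r z))"
          using Hpos[OF z(1,2)] by (intro mult_left_mono) auto
        then show ?thesis by (simp add: algebra_simps)
      qed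
      then have "0 \<le> exp (C' * z) * (C' * (- H z * v z * r z) - H z * s z)" by simp
      then have "0 \<le> (exp (C' * z) * C') * (- H z * v z * r z) + (- H z * s z) * exp (C' * z)"
        by (simp add: algebra_simps)
      ultimately show "\<exists>D. ((\<lambda>x. exp (C' * x) * (- H x * v x * r x)) has_real_derivative D) (at z) \<and> 0 \<le> D"
        by blast
    qed
    moreover have "1 * (- H x * v x * r x) \<le> exp (C' * x) * (- H x * v x * r x)"
      using x y g0 by (intro mult_right_mono) (auto simp: C'_def)
    ultimately show ?thesis by simp
  qed
  then show ?thesis
    using power_law_of_bounded[OF F _ y(1) nontriv] by blast
qed

lemma s_tendsto: "(s \<longlongrightarrow> s 0) (at_right 0)"
proof -
  have "(s \<longlongrightarrow> s 0) (at 0 within {0..<\<delta>})"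
    using s_cont \<delta>_pos by (simp add: continuous_on_def)
  then have "(s \<longlongrightarrow> s 0) (at 0 within {0<..<\<delta>})" by (rule tendsto_within_subset) auto
  then show ?thesis using \<delta>_pos by (simp add: at_within_Ioo_at_right)
qed

text \<open>If \<open>r\<close> vanished to the right of \<open>0\<close>, the equation would force \<open>s\<close> to vanish there as well.\<close>

lemma r_pos_of_source:
  assumes "0 < s 0" "0 < \<epsilon>"
  shows "\<exists>x>0. x < \<epsilon> \<and> 0 < r x"
proof (rule ccontr)
  assume "\<not> ?thesis"
  then have r0: "r x = 0" if "0 < x" "x < min \<epsilon> \<delta>" for x
    using r_nonneg[of x] that by fastforce
  have "\<forall>\<^sub>F x in at_right 0. 0 < s x" using s_tendsto assms(1) by (rule order_tendstoD)
  moreover have "\<forall>\<^sub>F x in at_right 0. 0 < x \<and> x < min \<epsilon> \<delta>"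
    using assms \<delta>_pos unfolding eventually_at_right_field by (intro exI[of _ "min \<epsilon> \<delta>"]) auto
  ultimately have "\<forall>\<^sub>F x in at_right 0. 0 < s x \<and> 0 < x \<and> x < min \<epsilon> \<delta>" by eventually_elim auto
  then obtain x where x: "0 < s x" "0 < x" "x < min \<epsilon> \<delta>"
    using eventually_happens'[OF trivial_limit_at_right_real] by blast
  have "((\<lambda>x. v x * r x) has_real_derivative s x - l * r x) (at x)" using flux_deriv x by simp
  then have "((\<lambda>x. v x * r x) has_real_derivative s x) (at x)" using r0 x by simp
  then have "((\<lambda>x. 0) has_real_derivative s x) (at x)"
    by (rule has_field_derivative_transform_within_open[of _ _ _ "{0<..<min \<epsilon> \<delta>}"])
      (use x r0 in auto)
  then have "s x = 0" by (metis DERIV_const DERIV_unique)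
  then show False using x by simp
qed

text \<open>
  The derivative of \<open>H f\<close> is at least \<open>- M * x powr (- l / a)\<close>, and the exponent exceeds \<open>- 1\<close>: adding
  the antiderivative \<open>M / q * x powr q\<close> of the bound gives an increasing function, which is bounded
  near \<open>0\<close>.
\<close>

lemma power_law_subcritical:
  assumes la: "l < a"
    and nontriv: "\<And>\<epsilon>. 0 < \<epsilon> \<Longrightarrow> \<exists>x>0. x < \<epsilon> \<and> 0 < r x"
  shows "\<exists>c>0. ((\<lambda>x. r x / x powr (l / a - 1)) \<longlongrightarrow> c) (at_right 0)"
proof -
  obtain e H K where F: "integrating_factor e H K" by (rule integrating_factor_exists)
  note e = integrating_factorD(1-3)[OF F] and Hpos = integrating_factorD(4)[OF F]
    and dg = integrating_factorD(5)[OF F] and K = integrating_factorD(6,7)[OF F]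
  have "\<forall>\<^sub>F x in at_right 0. H x * x powr (l / a) < K + 1"
    using K(2) by (rule order_tendstoD) simp
  moreover have "\<forall>\<^sub>F x in at_right 0. s x < s 0 + 1"
    using s_tendsto by (rule order_tendstoD) simp
  ultimately have "\<forall>\<^sub>F x in at_right 0. H x * x powr (l / a) < K + 1 \<and> s x < s 0 + 1"
    by eventually_elim auto
  then obtain d where d: "0 < d" "\<And>x. 0 < x \<Longrightarrow> x < d \<Longrightarrow> H x * x powr (l / a) < K + 1 \<and> s x < s 0 + 1"
    unfolding eventually_at_right_field by auto
  define y where "y = min d e / 2"
  have y: "0 < y" "y < d" "y < e" using d e by (auto simp: y_def)
  define q where "q = 1 - l / a"
  have q: "0 < q" using la a_pos by (simp add: q_def)
  define M where "M = (K + 1) * (s 0 + 1)"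
  have "- H x * v x * r x \<le> - H y * v y * r y + M / q * y powr q" if x: "0 < x" "x < y" for x
  proof -
    have "- H x * v x * r x + M / q * x powr q \<le> - H y * v y * r y + M / q * y powr q"
    proof (rule DERIV_nonneg_imp_nondecreasing[OF less_imp_le[OF x(2)]])
      fix z assume "x \<le> z" "z \<le> y"
      then have z: "0 < z" "z < e" "z < d" using x y by auto
      have "((\<lambda>x. - H x * v x * r x + M / q * x powr q) has_real_derivative
          - H z * s z + M / q * (q * z powr (q - 1))) (at z)"
        using z by (intro DERIV_add dg DERIV_cmult has_real_derivative_powr)
      moreover have "0 \<le> - H z * s z + M / q * (q * z powr (q - 1))"
      proof -
        have "H z * z powr (l / a) * s z \<le> M"
          unfolding M_def using d(2)[OF z(1,3)] Hpos[OF z(1,2)] s_nonneg[of z] z e K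
          by (intro mult_mono) (auto simp: less_imp_le)
        then have "(H z * z powr (l / a) * s z) * z powr (- l / a) \<le> M * z powr (- l / a)"
          by (rule mult_right_mono) simp
        then have "H z * s z * (z powr (l / a) * z powr (- l / a)) \<le> M * z powr (- l / a)"
          by (simp only: mult_ac)
        then show ?thesis using z q la by (simp add: q_def flip: powr_add)
      qed
      ultimately show "\<exists>D. ((\<lambda>x. - H x * v x * r x + M / q * x powr q) has_real_derivative D) (at z) \<and> 0 \<le> D"
        by blast
    qed
    moreover have "0 \<le> M / q * x powr q"
    proof -
      have "0 \<le> M" using K(1) d(2)[OF y(1,2)] s_nonneg[of y] y e by (auto simp: M_def)
      then show ?thesis using q by simp
    qed
    ultimately show ?thesis by simp
  qed
  then show ?thesis
    using power_law_of_bounded[OF F _ y(1) nontriv] by blast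
qed

text \<open>
  L'Hopital's rule for \<open>H f\<close> and \<open>x powr q\<close> with \<open>q = 1 - l / a < 0\<close>; the exponent \<open>q\<close> cancels the one of
  \<open>density_asymp\<close>, and so does the constant \<open>K\<close>.
\<close>

lemma limit_supercritical:
  assumes la: "a < l"
  shows "(r \<longlongrightarrow> s 0 / (l - a)) (at_right 0)"
proof -
  obtain e H K where F: "integrating_factor e H K" by (rule integrating_factor_exists)
  note e = integrating_factorD(1-3)[OF F] and Hpos = integrating_factorD(4)[OF F]
    and dg = integrating_factorD(5)[OF F] and K = integrating_factorD(6,7)[OF F]
  define q where "q = 1 - l / a"
  have q: "q < 0" using la a_pos by (simp add: q_def)
  have near: "\<forall>\<^sub>F x in at_right 0. 0 < x \<and> x < e"
    using e unfolding eventually_at_right_field by (intro exI[of _ e]) auto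
  have "((\<lambda>x. - H x * v x * r x / x powr q) \<longlongrightarrow> K * s 0 / - q) (at_right 0)"
  proof (rule lhopital_right_at_top)
    show "filterlim (\<lambda>x. x powr q) at_top (at_right (0::real))"
      using q by real_asymp
    show "\<forall>\<^sub>F x in at_right 0. q * x powr (q - 1) \<noteq> 0"
      using near by eventually_elim (use q in auto)
    show "\<forall>\<^sub>F x in at_right 0. ((\<lambda>x. - H x * v x * r x) has_real_derivative - H x * s x) (at x)"
      using near by eventually_elim (use dg in auto)
    show "\<forall>\<^sub>F x in at_right 0. ((\<lambda>x. x powr q) has_real_derivative q * x powr (q - 1)) (at x)"
      using near by eventually_elim (auto intro: has_real_derivative_powr)
    have "((\<lambda>x. H x * x powr (l / a) * s x / - q) \<longlongrightarrow> K * s 0 / - q) (at_right 0)"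
      using q by (intro tendsto_intros K s_tendsto) auto
    then show "((\<lambda>x. - H x * s x / (q * x powr (q - 1))) \<longlongrightarrow> K * s 0 / - q) (at_right 0)"
    proof (rule Lim_transform_eventually)
      show "\<forall>\<^sub>F x in at_right 0. H x * x powr (l / a) * s x / - q = - H x * s x / (q * x powr (q - 1))"
        using near
      proof eventually_elim
        case (elim x)
        have "x powr (q - 1) = inverse (x powr (l / a))" by (simp add: q_def powr_minus)
        then show ?case using q by (simp add: field_simps)
      qed
    qed
  qed
  then have "((\<lambda>x. r x / (x powr (l / a - 1) * x powr q)) \<longlongrightarrow> K * s 0 / - q / (K * a)) (at_right 0)"
    by (rule density_asymp[OF F])
  moreover have "K * s 0 / - q / (K * a) = s 0 / (l - a)"
    using K(1) a_pos la by (simp add: q_def field_simps)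
  ultimately have "((\<lambda>x. r x / (x powr (l / a - 1) * x powr q)) \<longlongrightarrow> s 0 / (l - a)) (at_right 0)" by simp
  then show ?thesis
  proof (rule Lim_transform_eventually)
    show "\<forall>\<^sub>F x in at_right 0. r x / (x powr (l / a - 1) * x powr q) = r x"
      using near by eventually_elim (simp add: q_def flip: powr_add)
  qed
qed

text \<open>As for \<open>limit_supercritical\<close>, but \<open>H\<close> now behaves like \<open>K / x\<close>, whose antiderivative is logarithmic.\<close>

lemma log_law_critical:
  assumes la: "l = a"
  shows "((\<lambda>x. r x / - ln x) \<longlongrightarrow> s 0 / a) (at_right 0)"
proof -
  obtain e H K where F: "integrating_factor e H K" by (rule integrating_factor_exists)
  note e = integrating_factorD(1-3)[OF F] and Hpos = integrating_factorD(4)[OF F]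
    and dg = integrating_factorD(5)[OF F] and K = integrating_factorD(6,7)[OF F]
  have near: "\<forall>\<^sub>F x in at_right 0. 0 < x \<and> x < e"
    using e unfolding eventually_at_right_field by (intro exI[of _ e]) auto
  have "((\<lambda>x. - H x * v x * r x / - ln x) \<longlongrightarrow> K * s 0) (at_right 0)"
  proof (rule lhopital_right_at_top)
    show "filterlim (\<lambda>x. - ln x) at_top (at_right (0::real))" by real_asymp
    show "\<forall>\<^sub>F x::real in at_right 0. - (1 / x) \<noteq> 0"
      using near by eventually_elim auto
    show "\<forall>\<^sub>F x in at_right 0. ((\<lambda>x. - H x * v x * r x) has_real_derivative - H x * s x) (at x)"
      using near by eventually_elim (use dg in auto)
    show "\<forall>\<^sub>F x::real in at_right 0. ((\<lambda>x. - ln x) has_real_derivative - (1 / x)) (at x)"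
      using near by eventually_elim (auto intro!: derivative_eq_intros)
    have "((\<lambda>x. H x * x powr (l / a) * s x) \<longlongrightarrow> K * s 0) (at_right 0)"
      by (intro tendsto_intros K s_tendsto)
    then show "((\<lambda>x. - H x * s x / - (1 / x)) \<longlongrightarrow> K * s 0) (at_right 0)"
    proof (rule Lim_transform_eventually)
      show "\<forall>\<^sub>F x in at_right 0. H x * x powr (l / a) * s x = - H x * s x / - (1 / x)"
        using near by eventually_elim (use a_pos in \<open>simp add: la\<close>)
    qed
  qed
  then have "((\<lambda>x. r x / (x powr (l / a - 1) * - ln x)) \<longlongrightarrow> K * s 0 / (K * a)) (at_right 0)"
    by (rule density_asymp[OF F])
  then have "((\<lambda>x. r x / (x powr (l / a - 1) * - ln x)) \<longlongrightarrow> s 0 / a) (at_right 0)"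
    using K(1) by simp
  then show ?thesis
  proof (rule Lim_transform_eventually)
    show "\<forall>\<^sub>F x in at_right 0. r x / (x powr (l / a - 1) * - ln x) = r x / - ln x"
      using near by eventually_elim (use a_pos in \<open>simp add: la\<close>)
  qed
qed

end

section \<open>The density of the critical field\<close>

lemma smallo_of_ratio:
  fixes f g :: "real \<Rightarrow> real"
  assumes "((\<lambda>x. f x / g x) \<longlongrightarrow> c) F" "\<forall>\<^sub>F x in F. g x \<noteq> 0"
  shows "(\<lambda>x. f x - c * g x) \<in> o[F](g)"
proof (rule smalloI_tendsto[OF _ assms(2)])
  have "((\<lambda>x. f x / g x - c) \<longlongrightarrow> c - c) F" by (intro tendsto_intros assms)
  then have "((\<lambda>x. f x / g x - c) \<longlongrightarrow> 0) F" by simp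
  then show "((\<lambda>x. (f x - c * g x) / g x) \<longlongrightarrow> 0) F"
    by (rule Lim_transform_eventually) (use assms(2) in eventually_elim, simp add: diff_divide_distrib)
qed

locale critical_at_zero = stationary_density +
  fixes a \<delta> :: real
  assumes \<delta>: "0 < \<delta>"
    and cont1: "continuous_on {0<..<\<delta>} (\<rho> 1)"
    and conti: "\<And>i. i \<in> {2..N} \<Longrightarrow> continuous_on {-\<delta><..<\<delta>} (\<rho> i)"
    and noncritical: "\<And>i. i \<in> {2..N} \<Longrightarrow> u i 0 \<noteq> 0"
    and a: "0 < a"
    and u1: "(\<lambda>\<eta>. u 1 \<eta> - (- a * \<eta>)) \<in> O[at_right 0](\<lambda>\<eta>. \<eta>\<^sup>2)"
begin

lemma states: "{1..N} - {1} = {2..N}" "1 \<in> {1..N}" "2 \<in> {2..N}" "i \<in> {2..N} \<Longrightarrow> i \<in> {1..N}"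
  using N_ge_2 by auto

lemma cont_right: "i \<in> {1..N} \<Longrightarrow> continuous_on {0<..<\<delta>} (\<rho> i)"
  using cont1 conti[of i] by (cases "i = 1") (auto intro: continuous_on_subset)

lemma rho_nonneg_right: "i \<in> {1..N} \<Longrightarrow> 0 < x \<Longrightarrow> x < \<delta> \<Longrightarrow> 0 \<le> \<rho> i x"
  by (rule rho_nonneg[OF _ cont_right])

lemma lam_1_pos: "i \<in> {2..N} \<Longrightarrow> 0 < lam i 1"
  by (rule rate_pos) auto

sublocale sink: sink_equation "u 1" "\<rho> 1" "rho_bar N lam \<rho>" a "rate 1" \<delta>
proof
  show "continuous_on {0<..<\<delta>} (u 1)" using u_continuous[OF states(2)] by (rule continuous_on_subset) auto
  show "0 \<le> \<rho> 1 x" if "0 < x" "x < \<delta>" for x using rho_nonneg_right[OF states(2) that] .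
  show "0 \<le> rho_bar N lam \<rho> x" if "0 < x" "x < \<delta>" for x
    unfolding rho_bar_def
    by (intro sum_nonneg mult_nonneg_nonneg less_imp_le[OF lam_1_pos] rho_nonneg_right states(4) that)
  show "continuous_on {0..<\<delta>} (rho_bar N lam \<rho>)"
    unfolding rho_bar_def by (intro continuous_intros continuous_on_subset[OF conti]) (use \<delta> in auto)
  show "((\<lambda>x. u 1 x * \<rho> 1 x) has_real_derivative rho_bar N lam \<rho> x - rate 1 * \<rho> 1 x) (at x)"
    if "0 < x" "x < \<delta>" for x
    using DERIV_flux[OF cont_right states(2) that] by (simp only: states(1) rho_bar_def)
qed (use \<delta> a cont1 u1 total_rate_pos[OF states(2)] in auto)

lemma case_B_rho_bar_pos:
  assumes "case_B N u \<mu>"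
  shows "0 < rho_bar N lam \<rho> 0"
proof -
  obtain I where I: "I \<in> support_intervals N u \<mu>" "0 \<in> interior I"
    using assms by (auto simp: case_B_def)
  then obtain e where e: "0 < e" "ball 0 e \<subseteq> I"
    using mem_interior[of 0 I] by auto
  have pos: "0 < \<rho> i 0" if i: "i \<in> {2..N}" for i
  proof -
    have "0 \<le> \<rho> i 0" by (rule rho_nonneg[OF states(4)[OF i] conti[OF i]]) (use \<delta> in auto)
    moreover have "\<rho> i 0 \<noteq> 0"
    proof
      assume "\<rho> i 0 = 0"
      then obtain y where y: "\<bar>y\<bar> < e" "y \<notin> charged"
        using uncharged_upstream[OF states(4)[OF i] \<delta> conti[OF i] noncritical[OF i] _ e(1)] by blast
      then have "y \<in> I" using e(2) by (auto simp: subset_iff dist_real_def)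
      then show False using support_interval_charged[OF I(1)] y(2) by blast
    qed
    ultimately show ?thesis by simp
  qed
  show ?thesis unfolding rho_bar_def
    using states(3) by (intro sum_pos mult_pos_pos lam_1_pos pos) auto
qed

text \<open>
  Following a field from \<open>0\<close> stays in the support interval, which lies in \<open>{0..}\<close>. So no field points to
  the left at \<open>0\<close>. The flow of \<open>u 2\<close> reaches charged points arbitrarily close to \<open>0\<close> on its right, which
  prevents \<open>\<rho> 1\<close> from vanishing identically there.
\<close>

lemma case_C_inflow:
  assumes "case_C N u \<mu>"
  shows "\<And>i. i \<in> {2..N} \<Longrightarrow> 0 < u i 0" and "\<And>\<epsilon>. 0 < \<epsilon> \<Longrightarrow> \<exists>x>0. x < \<epsilon> \<and> 0 < \<rho> 1 x"
proof -
  obtain I where I: "I \<in> support_intervals N u \<mu>" "0 \<in> I" and I0: "\<And>x. x \<in> I \<Longrightarrow> 0 \<le> x"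
    using assms by (auto simp: case_C_def)
  have d: "((\<lambda>t. flow (u i) t 0) has_real_derivative u i 0) (at 0 within {0..})" if "i \<in> {2..N}" for i
  proof -
    have "((\<lambda>t. flow (u i) t 0) has_real_derivative u i (flow (u i) 0 0)) (at 0 within {0..})"
      using solves_ivp_flow[OF fc[OF states(4)[OF that]], of 0] unfolding solves_ivp_def by blast
    then show ?thesis unfolding flow_0[OF fc[OF states(4)[OF that]]] .
  qed
  show pos: "0 < u i 0" if i: "i \<in> {2..N}" for i
  proof (rule ccontr)
    assume "\<not> 0 < u i 0"
    then have "u i 0 < 0" using noncritical[OF i] by simp
    then obtain r where r: "0 < r" "\<And>h. 0 < h \<Longrightarrow> 0 + h \<in> {0..} \<Longrightarrow> h < r \<Longrightarrow> flow (u i) (0 + h) 0 < flow (u i) 0 0"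
      using has_real_derivative_neg_dec_right[OF d[OF i]] by blast
    then have "flow (u i) (r / 2) 0 < 0" using r(2)[of "r / 2"] fc[OF states(4)[OF i]] by simp
    moreover have "flow (u i) (r / 2) 0 \<in> I"
      using support_interval_flow[OF I states(4)[OF i]] r(1) by simp
    ultimately show False using I0 by force
  qed
  show "\<exists>x>0. x < \<epsilon> \<and> 0 < \<rho> 1 x" if \<epsilon>: "0 < \<epsilon>" for \<epsilon>
  proof (rule ccontr)
    assume neg: "\<not> ?thesis"
    define e where "e = min \<epsilon> \<delta>"
    have e: "0 < e" using \<epsilon> \<delta> by (simp add: e_def)
    have z: "\<rho> 1 x = 0" if "x \<in> {0<..<e}" for x
    proof -
      have "\<not> 0 < \<rho> 1 x" using neg that by (auto simp: e_def)
      then show ?thesis using rho_nonneg_right[OF states(2), of x] that by (simp add: e_def)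
    qed
    have "emeasure (m 1) {0<..<e} = (\<integral>\<^sup>+ x. ennreal (\<rho> 1 x) * indicator {0<..<e} x \<partial>lborel)"
      unfolding slice_density[OF states(2)] using rho_measurable[OF states(2)] by (subst emeasure_density) auto
    also have "\<dots> = (\<integral>\<^sup>+ x. 0 \<partial>(lborel :: real measure))"
      by (intro nn_integral_cong) (use z in \<open>auto simp: indicator_def\<close>)
    finally have null: "measure (m 1) {0<..<e} = 0" by (simp add: measure_def)
    have f2: "forward_complete (u 2)" using fc[OF states(4)[OF states(3)]] .
    obtain r where r: "0 < r" "\<And>h. 0 < h \<Longrightarrow> 0 + h \<in> {0..} \<Longrightarrow> h < r \<Longrightarrow> flow (u 2) 0 0 < flow (u 2) (0 + h) 0"
      using has_real_derivative_pos_inc_right[OF d[OF states(3)] pos[OF states(3)]] by blast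
    have "((\<lambda>t. flow (u 2) t 0) \<longlongrightarrow> flow (u 2) 0 0) (at_right 0)"
      using DERIV_continuous[OF d[OF states(3)]] by (simp add: continuous_within at_within_Ici_at_right)
    then have "\<forall>\<^sub>F t in at_right 0. flow (u 2) t 0 < e"
      by (rule order_tendstoD) (simp add: f2 e)
    moreover have "\<forall>\<^sub>F t in at_right 0. 0 < t \<and> t < r"
      using r(1) unfolding eventually_at_right_field by (intro exI[of _ r]) auto
    ultimately have "\<forall>\<^sub>F t in at_right 0. flow (u 2) t 0 < e \<and> 0 < t \<and> t < r" by eventually_elim auto
    then obtain t where t: "flow (u 2) t 0 < e" "0 < t" "t < r"
      using eventually_happens'[OF trivial_limit_at_right_real] by blast
    have "0 < flow (u 2) t 0" using r(2)[of t] t f2 by simp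
    then have "flow (u 2) t 0 \<notin> charged"
      using t(1) by (intro null_interval_not_charged[OF states(2) null])
    moreover have "flow (u 2) t 0 \<in> I"
      using support_interval_flow[OF I states(4)[OF states(3)]] t(2) by simp
    ultimately show False using support_interval_charged[OF I(1)] by blast
  qed
qed

text \<open>
  The total flux vanishes, so \<open>- u 1 x * \<rho> 1 x\<close> is the sum of the fluxes \<open>u i x * \<rho> i x\<close> over \<open>i > 1\<close>. Near
  \<open>0\<close> these fields are bounded below by positive constants.
\<close>

lemma case_C_source_bound:
  assumes "case_C N u \<mu>"
  obtains d C where "0 < d" "\<And>x. 0 < x \<Longrightarrow> x < d \<Longrightarrow> rho_bar N lam \<rho> x \<le> C * (- u 1 x * \<rho> 1 x)"
proof -
  define b where "b i = 2 * lam i 1 / u i 0" for i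
  have b: "0 < b i" if "i \<in> {2..N}" for i
    using case_C_inflow(1)[OF assms that] lam_1_pos[OF that] by (simp add: b_def)
  have "\<forall>\<^sub>F x in at_right 0. lam i 1 < b i * u i x" if i: "i \<in> {2..N}" for i
  proof -
    have "(u i \<longlongrightarrow> u i 0) (at_right 0)"
      using u_continuous[OF states(4)[OF i]] by (auto simp: continuous_on_def intro: tendsto_within_subset)
    then have "((\<lambda>x. b i * u i x) \<longlongrightarrow> b i * u i 0) (at_right 0)" by (intro tendsto_intros)
    moreover have "lam i 1 < b i * u i 0"
      using case_C_inflow(1)[OF assms i] lam_1_pos[OF i] by (simp add: b_def)
    ultimately show ?thesis by (rule order_tendstoD)
  qed
  then have "\<forall>\<^sub>F x in at_right 0. \<forall>i\<in>{2..N}. lam i 1 < b i * u i x"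
    by (intro eventually_ball_finite) auto
  then obtain d where d: "0 < d" "\<And>x i. 0 < x \<Longrightarrow> x < d \<Longrightarrow> i \<in> {2..N} \<Longrightarrow> lam i 1 < b i * u i x"
    unfolding eventually_at_right_field by auto
  define C where "C = (\<Sum>i\<in>{2..N}. b i)"
  have "rho_bar N lam \<rho> x \<le> C * (- u 1 x * \<rho> 1 x)" if x: "0 < x" "x < min d \<delta>" for x
  proof -
    have r0: "0 \<le> \<rho> i x" if "i \<in> {2..N}" for i using rho_nonneg_right[OF states(4)[OF that]] x by simp
    have u0: "0 < u i x" if "i \<in> {2..N}" for i
    proof -
      have "0 < b i * u i x" using d(2)[OF x(1) _ that] x lam_1_pos[OF that] by simp
      then show ?thesis using b[OF that] by (simp add: zero_less_mult_iff)
    qed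
    have "rho_bar N lam \<rho> x \<le> (\<Sum>i\<in>{2..N}. C * (u i x * \<rho> i x))"
      unfolding rho_bar_def
    proof (rule sum_mono)
      fix i assume i: "i \<in> {2..N}"
      have "b i \<le> C" unfolding C_def using i b by (intro member_le_sum) (auto simp: less_imp_le)
      then have "b i * u i x \<le> C * u i x" using u0[OF i] by (intro mult_right_mono) auto
      then have "lam i 1 \<le> C * u i x" using d(2)[OF x(1) _ i] x by simp
      then have "lam i 1 * \<rho> i x \<le> C * u i x * \<rho> i x" using r0[OF i] by (rule mult_right_mono)
      then show "lam i 1 * \<rho> i x \<le> C * (u i x * \<rho> i x)" by (simp add: mult.assoc)
    qed
    also have "\<dots> = C * (\<Sum>i\<in>{2..N}. u i x * \<rho> i x)" by (simp add: sum_distrib_left)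
    also have "(\<Sum>i\<in>{2..N}. u i x * \<rho> i x) = - u 1 x * \<rho> 1 x"
    proof -
      have "(\<Sum>i\<in>{1..N}. u i x * \<rho> i x) = 0"
        by (rule total_flux_zero[OF cont_right]) (use x in auto)
      moreover have "(\<Sum>i\<in>{1..N}. u i x * \<rho> i x) = u 1 x * \<rho> 1 x + (\<Sum>i\<in>{1..N} - {1}. u i x * \<rho> i x)"
        using states(2) by (intro sum.remove) auto
      ultimately show ?thesis unfolding states(1) by linarith
    qed
    finally show ?thesis .
  qed
  moreover have "0 < min d \<delta>" using d \<delta> by simp
  ultimately show thesis using that by blast
qed

lemma case_C_power_law:
  assumes "case_C N u \<mu>"
  shows "\<exists>c>0. ((\<lambda>x. \<rho> 1 x / x powr (rate 1 / a - 1)) \<longlongrightarrow> c) (at_right 0)"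
proof -
  obtain d C where "0 < d" "\<And>x. 0 < x \<Longrightarrow> x < d \<Longrightarrow> rho_bar N lam \<rho> x \<le> C * (- u 1 x * \<rho> 1 x)"
    using case_C_source_bound[OF assms] by blast
  then show ?thesis by (rule sink.power_law_comparable[OF _ _ case_C_inflow(2)[OF assms]])
qed

lemma case_B_power_law:
  assumes "case_B N u \<mu>" "rate 1 < a"
  shows "\<exists>c>0. ((\<lambda>x. \<rho> 1 x / x powr (rate 1 / a - 1)) \<longlongrightarrow> c) (at_right 0)"
  by (rule sink.power_law_subcritical[OF assms(2) sink.r_pos_of_source[OF case_B_rho_bar_pos[OF assms(1)]]])

end

theorem theorem2:
  fixes N :: nat
    and u :: "nat \<Rightarrow> real \<Rightarrow> real"
    and lam :: "nat \<Rightarrow> nat \<Rightarrow> real"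
    and \<mu> :: "(real \<times> nat) measure"
    and \<rho> :: "nat \<Rightarrow> real \<Rightarrow> real"
    and a p q \<delta> :: real
  assumes "N \<ge> 2"
    and "\<And>i. i \<in> {1..N} \<Longrightarrow> u i C1_differentiable_on UNIV"
    and "\<And>i. i \<in> {1..N} \<Longrightarrow> forward_complete (u i)"
    and "\<And>i j. i \<in> {1..N} \<Longrightarrow> j \<in> {1..N} \<Longrightarrow> i \<noteq> j \<Longrightarrow> lam i j > 0"
    and "\<And>x. \<not> x islimpt {y. \<exists>i\<in>{1..N}. u i y = 0}"
    and "invariant_measure N u lam \<mu>"
    and "absolutely_continuous (lborel \<Otimes>\<^sub>M count_space {1..N}) \<mu>"
    and "density_representatives N \<mu> \<rho>"
    and "\<delta> > 0"
    and "continuous_on {0<..<\<delta>} (\<rho> 1)"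
    and "\<And>i. i \<in> {2..N} \<Longrightarrow> continuous_on {-\<delta><..<\<delta>} (\<rho> i)"
    and "u 1 0 = 0"
    and "\<And>i. i \<in> {1..N} - {1} \<Longrightarrow> u i 0 \<noteq> 0"
    and "a \<noteq> 0"
    and "(\<lambda>\<eta>. u 1 \<eta> - (- a * \<eta>)) \<in> O[at_right 0](\<lambda>\<eta>. \<eta>\<^sup>2)"
    and "p < 0" and "0 < q"
    and "\<And>i. i \<in> {1..N} \<Longrightarrow> real_analytic_on (u i) {p<..<q}"
  shows
    "(total_rate N lam 1 < a \<longrightarrow> case_B N u \<mu> \<or> case_C N u \<mu> \<longrightarrow>
        (\<exists>c>0. (\<lambda>\<eta>. \<rho> 1 \<eta> - c * \<eta> powr (total_rate N lam 1 / a - 1))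
                  \<in> o[at_right 0](\<lambda>\<eta>. \<eta> powr (total_rate N lam 1 / a - 1)))) \<and>
     (total_rate N lam 1 > a \<and> a > 0 \<longrightarrow>
        (case_B N u \<mu> \<longrightarrow>
           (\<rho> 1 \<longlongrightarrow> rho_bar N lam \<rho> 0 / (total_rate N lam 1 - a)) (at_right 0) \<and> rho_bar N lam \<rho> 0 / (total_rate N lam 1 - a) > 0) \<and>
        (case_C N u \<mu> \<longrightarrow>
           (\<exists>c>0. (\<lambda>\<eta>. \<rho> 1 \<eta> - c * \<eta> powr (total_rate N lam 1 / a - 1))
                     \<in> o[at_right 0](\<lambda>\<eta>. \<eta> powr (total_rate N lam 1 / a - 1))))) \<and>
     (total_rate N lam 1 = a \<longrightarrow>
        (case_B N u \<mu> \<longrightarrow>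
           (\<exists>c>0. (\<lambda>\<eta>. \<rho> 1 \<eta> - (- c * ln \<eta>)) \<in> o[at_right 0](\<lambda>\<eta>. ln \<eta>))) \<and>
        (case_C N u \<mu> \<longrightarrow> (\<exists>c>0. (\<rho> 1 \<longlongrightarrow> c) (at_right 0))))"
proof -
  interpret stationary_density N u lam \<mu> \<rho>
    using assms(1-4,6,8) by unfold_locales auto
  have crit: "critical_at_zero N u lam \<mu> \<rho> a \<delta>" if "0 < a"
    using that assms(9-11,13,15) by unfold_locales auto
  have rate1: "0 < rate 1" using assms(1) by (intro total_rate_pos) auto
  have small: "\<exists>c>0. (\<lambda>\<eta>. \<rho> 1 \<eta> - c * \<eta> powr e) \<in> o[at_right 0](\<lambda>\<eta>. \<eta> powr e)"
    if ex: "\<exists>c>0. ((\<lambda>x. \<rho> 1 x / x powr e) \<longlongrightarrow> c) (at_right 0)" for e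
  proof -
    obtain c where c: "0 < c" "((\<lambda>x. \<rho> 1 x / x powr e) \<longlongrightarrow> c) (at_right 0)" using ex by blast
    have "\<forall>\<^sub>F x::real in at_right 0. x powr e \<noteq> 0"
      using eventually_at_right_less[of "0::real"] by eventually_elim simp
    with c(2) have "(\<lambda>\<eta>. \<rho> 1 \<eta> - c * \<eta> powr e) \<in> o[at_right 0](\<lambda>\<eta>. \<eta> powr e)"
      by (rule smallo_of_ratio)
    with c(1) show ?thesis by (intro exI[of _ c] conjI)
  qed
  show ?thesis
  proof (intro conjI impI; (elim conjE)?)
    assume *: "rate 1 < a" "case_B N u \<mu> \<or> case_C N u \<mu>"
    interpret critical_at_zero N u lam \<mu> \<rho> a \<delta> using crit rate1 * by simp
    show "\<exists>c>0. (\<lambda>\<eta>. \<rho> 1 \<eta> - c * \<eta> powr (rate 1 / a - 1)) \<in> o[at_right 0](\<lambda>\<eta>. \<eta> powr (rate 1 / a - 1))"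
      using * case_B_power_law case_C_power_law by (intro small) blast
  next
    assume *: "a < rate 1" "0 < a" "case_B N u \<mu>"
    interpret critical_at_zero N u lam \<mu> \<rho> a \<delta> using crit * by simp
    show "(\<rho> 1 \<longlongrightarrow> rho_bar N lam \<rho> 0 / (rate 1 - a)) (at_right 0)"
      by (rule sink.limit_supercritical[OF *(1)])
    show "0 < rho_bar N lam \<rho> 0 / (rate 1 - a)"
      using case_B_rho_bar_pos[OF *(3)] *(1) by simp
  next
    assume *: "a < rate 1" "0 < a" "case_C N u \<mu>"
    interpret critical_at_zero N u lam \<mu> \<rho> a \<delta> using crit * by simp
    show "\<exists>c>0. (\<lambda>\<eta>. \<rho> 1 \<eta> - c * \<eta> powr (rate 1 / a - 1)) \<in> o[at_right 0](\<lambda>\<eta>. \<eta> powr (rate 1 / a - 1))"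
      by (rule small[OF case_C_power_law[OF *(3)]])
  next
    assume *: "rate 1 = a" "case_B N u \<mu>"
    interpret critical_at_zero N u lam \<mu> \<rho> a \<delta> using crit rate1 * by simp
    let ?c = "rho_bar N lam \<rho> 0 / a"
    have c: "0 < ?c" using case_B_rho_bar_pos[OF *(2)] a by simp
    have "((\<lambda>x. - (\<rho> 1 x / - ln x)) \<longlongrightarrow> - ?c) (at_right 0)"
      by (intro tendsto_intros sink.log_law_critical[OF *(1)])
    then have "((\<lambda>x. \<rho> 1 x / ln x) \<longlongrightarrow> - ?c) (at_right 0)" by simp
    moreover have "\<forall>\<^sub>F x::real in at_right 0. ln x \<noteq> 0"
      unfolding eventually_at_right_field by (intro exI[of _ 1]) auto
    ultimately have "(\<lambda>\<eta>. \<rho> 1 \<eta> - - ?c * ln \<eta>) \<in> o[at_right 0](\<lambda>\<eta>. ln \<eta>)"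
      by (rule smallo_of_ratio)
    with c show "\<exists>c>0. (\<lambda>\<eta>. \<rho> 1 \<eta> - - c * ln \<eta>) \<in> o[at_right 0](\<lambda>\<eta>. ln \<eta>)" by blast
  next
    assume *: "rate 1 = a" "case_C N u \<mu>"
    interpret critical_at_zero N u lam \<mu> \<rho> a \<delta> using crit rate1 * by simp
    obtain c where c: "0 < c" "((\<lambda>x. \<rho> 1 x / x powr (rate 1 / a - 1)) \<longlongrightarrow> c) (at_right 0)"
      using case_C_power_law[OF *(2)] by blast
    have "\<forall>\<^sub>F x::real in at_right 0. \<rho> 1 x / x powr (rate 1 / a - 1) = \<rho> 1 x"
      using eventually_at_right_less[of "0::real"] by eventually_elim (use * a in simp)
    then have "(\<rho> 1 \<longlongrightarrow> c) (at_right 0)" using c(2) by (rule Lim_transform_eventually[rotated])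
    with c(1) show "\<exists>c>0. (\<rho> 1 \<longlongrightarrow> c) (at_right 0)" by blast
  qed
qed

end
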